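(* Let $M$ be a smooth manifold with base point $*$. Let $\pi_2^{2,1}(M,* )$ be the set of 2-tracks $[\Gamma]$ with $\partial_l[\Gamma]=\partial_r[\Gamma]=*$ and $\partial_d[\Gamma]=[*]$ (the class of the constant path), with product given by horizontal composition, and let $\partial:=\partial_u\colon\pi_2^{2,1}(M,* )\to\pi_1^1(M,* )$. Let $\pi_1^1(M,* )$ act on $\pi_2^{2,1}(M,* )$ by $[\gamma]\triangleright[\Gamma]=\mathrm{id}_{[\gamma]}\circ_h[\Gamma]\circ_h\mathrm{id}_{[\gamma^{-1}]}$, where $\mathrm{id}_{[\gamma]}$ is the 2-track of the 2-path $(t,s)\mapsto\gamma(t)$. Then $\pi_2^{2,1}(M,* )$ is a group, $\partial$ is a group morphism, and $(\partial\colon\pi_2^{2,1}(M,* )\to\pi_1^1(M,* ),\triangleright)$ is a crossed module, denoted $\Pi_2^{2,1}(M,* )$.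
   Context: Notation as follows. A 1-path is a smooth map $\gamma\colon[0,1]\to M$ constant near $0$ and near $1$; concatenation $\gamma\phi$ runs $\gamma$ on $[0,1/2]$ and $\phi$ on $[1/2,1]$ at double speed; $\gamma^{-1}(t)=\gamma(1-t)$. A 2-path is a smooth $\Gamma\colon[0,1]^2\to M$ such that for some $\epsilon>0$: $\Gamma(t,s)=\Gamma(0,0)$ for $t\le\epsilon$, $\Gamma(t,s)=\Gamma(1,0)$ for $t\ge1-\epsilon$, $\Gamma(t,s)=\Gamma(t,0)$ for $s\le\epsilon$, $\Gamma(t,s)=\Gamma(t,1)$ for $s\ge1-\epsilon$; boundaries $\partial_l\Gamma=\Gamma(0,\cdot)$, $\partial_r\Gamma=\Gamma(1,\cdot)$ (points), $\partial_d\Gamma=\Gamma(\cdot,0)$, $\partial_u\Gamma=\Gamma(\cdot,1)$; horizontal composition $(\Gamma\circ_h\Gamma')(t,s)=\Gamma(2t,s)$ for $t\le 1/2$, $\Gamma'(2t-1,s)$ for $t\ge1/2$. Two 1-paths are rank-1 homotopic if joined by a 2-path whose derivative has rank $\le1$ everywhere; classes are 1-tracks, and $\pi_1^1(M,* )$ is the group of 1-tracks of 1-paths from $*$ to $*$ under concatenation. Two 2-paths $\Gamma,\Gamma'$ are rank-2 homotopic if there is smooth $J\colon[0,1]^3\to M$ with $J(\cdot,\cdot,0)=\Gamma$, $J(\cdot,\cdot,1)=\Gamma'$, $J$ constant on $\{0\}\times[0,1]^2$ and on $\{1\}\times[0,1]^2$, $J$ restricting to rank-1 homotopies $\partial_d\Gamma\to\partial_d\Gamma'$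 on $s=0$ and $\partial_u\Gamma\to\partial_u\Gamma'$ on $s=1$, $J$ independent of the normal coordinate within some $\epsilon$ of each face of $[0,1]^3$, and $\mathrm{Rank}(\mathcal DJ)\le2$ everywhere; classes are 2-tracks. *)

theory Defs
  imports "HOL-Analysis.Analysis" "HOL-Algebra.Group"
begin

fun Ck_on :: "nat \<Rightarrow> 'a::euclidean_space set \<Rightarrow> ('a \<Rightarrow> 'b::euclidean_space) \<Rightarrow> bool" where
  "Ck_on 0 S f = continuous_on S f"
| "Ck_on (Suc k) S f =
     (\<exists>f'. (\<forall>x\<in>S. (f has_derivative f' x) (at x)) \<and> (\<forall>v. Ck_on k S (\<lambda>x. f' x v)))"

definition smooth_on :: "'a::euclidean_space set \<Rightarrow> ('a \<Rightarrow> 'b::euclidean_space) \<Rightarrow> bool" where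
  "smooth_on S f \<longleftrightarrow> (\<forall>k. Ck_on k S f)"

text \<open>A chart is a pair (U, phi) with U open in M and phi a homeomorphism of U onto an open
  subset of the model space 'e. The manifold is the type 'm (Hausdorff, second countable).\<close>

type_synonym ('m, 'e) atlas = "('m set \<times> ('m \<Rightarrow> 'e)) set"

definition smooth_atlas :: "('m::topological_space, 'e::euclidean_space) atlas \<Rightarrow> bool" where
  "smooth_atlas A \<longleftrightarrow>
     \<Union>(fst ` A) = UNIV \<and>
     (\<forall>(U, \<phi>)\<in>A. open U \<and> inj_on \<phi> U \<and> continuous_on U \<phi> \<and> open (\<phi> ` U)
                  \<and> continuous_on (\<phi> ` U) (inv_into U \<phi>)) \<and>
     (\<forall>(U, \<phi>)\<in>A. \<forall>(V, \<psi>)\<in>A. smooth_on (\<phi> ` (U \<inter> V)) (\<psi> \<circ> inv_into U \<phi>))"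

definition smooth_manifold ::
  "('m::{t2_space, second_countable_topology}, 'e::euclidean_space) atlas \<Rightarrow> bool" where
  "smooth_manifold A \<longleftrightarrow> smooth_atlas A"

definition mfld_smooth :: "('m::topological_space, 'e::euclidean_space) atlas \<Rightarrow> 'a::euclidean_space set
    \<Rightarrow> ('a \<Rightarrow> 'm) \<Rightarrow> bool" where
  "mfld_smooth A W G \<longleftrightarrow> continuous_on W G \<and>
     (\<forall>(U, \<phi>)\<in>A. smooth_on (W \<inter> G -` U) (\<phi> \<circ> G))"

definition smooth_cube :: "('m::topological_space, 'e::euclidean_space) atlas \<Rightarrow> 'a::euclidean_space set
    \<Rightarrow> ('a \<Rightarrow> 'm) \<Rightarrow> bool" where
  "smooth_cube A K F \<longleftrightarrow>
     (\<exists>W G. open W \<and> K \<subseteq> W \<and> mfld_smooth A W G \<and> (\<forall>x\<in>K. G x = F x))"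

text \<open>Rank of the derivative of F is at most r at every point of K (computed in charts,
  using any smooth extension; the value is independent of the extension).\<close>
definition rank_le :: "('m::topological_space, 'e::euclidean_space) atlas \<Rightarrow> 'a::euclidean_space set
    \<Rightarrow> ('a \<Rightarrow> 'm) \<Rightarrow> nat \<Rightarrow> bool" where
  "rank_le A K F r \<longleftrightarrow>
     (\<forall>x\<in>K. \<forall>(U, \<phi>)\<in>A. F x \<in> U \<longrightarrow>
        (\<forall>W G D. open W \<and> K \<subseteq> W \<and> mfld_smooth A W G \<and> (\<forall>y\<in>K. G y = F y)
             \<and> ((\<phi> \<circ> G) has_derivative D) (at x) \<longrightarrow> dim (range D) \<le> r))"

abbreviation unit_sq :: "(real \<times> real) set" where
  "unit_sq \<equiv> cbox (0, 0) (1, 1)"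

abbreviation unit_cube3 :: "(real \<times> real \<times> real) set" where
  "unit_cube3 \<equiv> cbox (0, 0, 0) (1, 1, 1)"

definition path1 :: "('m::topological_space, 'e::euclidean_space) atlas \<Rightarrow> (real \<Rightarrow> 'm) \<Rightarrow> bool" where
  "path1 A \<gamma> \<longleftrightarrow> smooth_cube A {0..1} \<gamma> \<and>
     (\<exists>\<epsilon>>0. \<forall>t\<in>{0..1}. (t \<le> \<epsilon> \<longrightarrow> \<gamma> t = \<gamma> 0) \<and> (t \<ge> 1 - \<epsilon> \<longrightarrow> \<gamma> t = \<gamma> 1))"

definition concat1 :: "(real \<Rightarrow> 'm) \<Rightarrow> (real \<Rightarrow> 'm) \<Rightarrow> real \<Rightarrow> 'm" where
  "concat1 \<gamma> \<phi> t = (if t \<le> 1/2 then \<gamma> (2 * t) else \<phi> (2 * t - 1))"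

definition rev1 :: "(real \<Rightarrow> 'm) \<Rightarrow> real \<Rightarrow> 'm" where
  "rev1 \<gamma> t = \<gamma> (1 - t)"

definition path2 :: "('m::topological_space, 'e::euclidean_space) atlas \<Rightarrow> (real \<Rightarrow> real \<Rightarrow> 'm) \<Rightarrow> bool" where
  "path2 A \<Gamma> \<longleftrightarrow> smooth_cube A unit_sq (\<lambda>p. \<Gamma> (fst p) (snd p)) \<and>
     (\<exists>\<epsilon>>0. \<forall>t\<in>{0..1}. \<forall>s\<in>{0..1}.
        (t \<le> \<epsilon> \<longrightarrow> \<Gamma> t s = \<Gamma> 0 0) \<and> (t \<ge> 1 - \<epsilon> \<longrightarrow> \<Gamma> t s = \<Gamma> 1 0) \<and>
        (s \<le> \<epsilon> \<longrightarrow> \<Gamma> t s = \<Gamma> t 0) \<and> (s \<ge> 1 - \<epsilon> \<longrightarrow> \<Gamma> t s = \<Gamma> t 1))"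

definition hcomp :: "(real \<Rightarrow> real \<Rightarrow> 'm) \<Rightarrow> (real \<Rightarrow> real \<Rightarrow> 'm) \<Rightarrow> real \<Rightarrow> real \<Rightarrow> 'm" where
  "hcomp \<Gamma> \<Gamma>' t s = (if t \<le> 1/2 then \<Gamma> (2 * t) s else \<Gamma>' (2 * t - 1) s)"

definition idpath2 :: "(real \<Rightarrow> 'm) \<Rightarrow> real \<Rightarrow> real \<Rightarrow> 'm" where
  "idpath2 \<gamma> t s = \<gamma> t"

definition rank1_htpy_via :: "('m::topological_space, 'e::euclidean_space) atlas
    \<Rightarrow> (real \<Rightarrow> real \<Rightarrow> 'm) \<Rightarrow> (real \<Rightarrow> 'm) \<Rightarrow> (real \<Rightarrow> 'm) \<Rightarrow> bool" where
  "rank1_htpy_via A H \<gamma> \<phi> \<longleftrightarrow> path2 A H \<and> rank_le A unit_sq (\<lambda>p. H (fst p) (snd p)) 1 \<and>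
     (\<forall>t\<in>{0..1}. H t 0 = \<gamma> t \<and> H t 1 = \<phi> t)"

definition rank1_htpc :: "('m::topological_space, 'e::euclidean_space) atlas
    \<Rightarrow> (real \<Rightarrow> 'm) \<Rightarrow> (real \<Rightarrow> 'm) \<Rightarrow> bool" where
  "rank1_htpc A \<gamma> \<phi> \<longleftrightarrow> path1 A \<gamma> \<and> path1 A \<phi> \<and> (\<exists>H. rank1_htpy_via A H \<gamma> \<phi>)"

definition track1 :: "('m::topological_space, 'e::euclidean_space) atlas
    \<Rightarrow> (real \<Rightarrow> 'm) \<Rightarrow> (real \<Rightarrow> 'm) set" where
  "track1 A \<gamma> = {\<phi>. rank1_htpc A \<gamma> \<phi>}"

definition rank2_htpc :: "('m::topological_space, 'e::euclidean_space) atlas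
    \<Rightarrow> (real \<Rightarrow> real \<Rightarrow> 'm) \<Rightarrow> (real \<Rightarrow> real \<Rightarrow> 'm) \<Rightarrow> bool" where
  "rank2_htpc A \<Gamma> \<Gamma>' \<longleftrightarrow> path2 A \<Gamma> \<and> path2 A \<Gamma>' \<and>
     (\<exists>J :: real \<Rightarrow> real \<Rightarrow> real \<Rightarrow> 'm.
        smooth_cube A unit_cube3 (\<lambda>p. J (fst p) (fst (snd p)) (snd (snd p))) \<and>
        (\<forall>t\<in>{0..1}. \<forall>s\<in>{0..1}. J t s 0 = \<Gamma> t s \<and> J t s 1 = \<Gamma>' t s) \<and>
        (\<forall>s\<in>{0..1}. \<forall>r\<in>{0..1}. J 0 s r = J 0 0 0 \<and> J 1 s r = J 1 0 0) \<and>
        rank1_htpy_via A (\<lambda>t r. J t 0 r) (\<lambda>t. \<Gamma> t 0) (\<lambda>t. \<Gamma>' t 0) \<and>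
        rank1_htpy_via A (\<lambda>t r. J t 1 r) (\<lambda>t. \<Gamma> t 1) (\<lambda>t. \<Gamma>' t 1) \<and>
        (\<exists>\<epsilon>>0. \<forall>t\<in>{0..1}. \<forall>s\<in>{0..1}. \<forall>r\<in>{0..1}.
           (t \<le> \<epsilon> \<longrightarrow> J t s r = J 0 s r) \<and> (t \<ge> 1 - \<epsilon> \<longrightarrow> J t s r = J 1 s r) \<and>
           (s \<le> \<epsilon> \<longrightarrow> J t s r = J t 0 r) \<and> (s \<ge> 1 - \<epsilon> \<longrightarrow> J t s r = J t 1 r) \<and>
           (r \<le> \<epsilon> \<longrightarrow> J t s r = J t s 0) \<and> (r \<ge> 1 - \<epsilon> \<longrightarrow> J t s r = J t s 1)) \<and>
        rank_le A unit_cube3 (\<lambda>p. J (fst p) (fst (snd p)) (snd (snd p))) 2)"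

definition track2 :: "('m::topological_space, 'e::euclidean_space) atlas
    \<Rightarrow> (real \<Rightarrow> real \<Rightarrow> 'm) \<Rightarrow> (real \<Rightarrow> real \<Rightarrow> 'm) set" where
  "track2 A \<Gamma> = {\<Gamma>'. rank2_htpc A \<Gamma> \<Gamma>'}"

definition loops1 :: "('m::topological_space, 'e::euclidean_space) atlas \<Rightarrow> 'm \<Rightarrow> (real \<Rightarrow> 'm) set set" where
  "loops1 A x = {track1 A \<gamma> | \<gamma>. path1 A \<gamma> \<and> \<gamma> 0 = x \<and> \<gamma> 1 = x}"

definition pi11 :: "('m::topological_space, 'e::euclidean_space) atlas \<Rightarrow> 'm \<Rightarrow> (real \<Rightarrow> 'm) set monoid" where
  "pi11 A x = \<lparr> carrier = loops1 A x,
                mult = (\<lambda>P Q. track1 A (concat1 (SOME \<gamma>. \<gamma> \<in> P) (SOME \<phi>. \<phi> \<in> Q))),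
                one = track1 A (\<lambda>t. x) \<rparr>"

definition loops21 :: "('m::topological_space, 'e::euclidean_space) atlas \<Rightarrow> 'm
    \<Rightarrow> (real \<Rightarrow> real \<Rightarrow> 'm) set set" where
  "loops21 A x = {track2 A \<Gamma> | \<Gamma>. path2 A \<Gamma> \<and> \<Gamma> 0 0 = x \<and> \<Gamma> 1 0 = x \<and>
                      track1 A (\<lambda>t. \<Gamma> t 0) = track1 A (\<lambda>t. x)}"

definition pi221 :: "('m::topological_space, 'e::euclidean_space) atlas \<Rightarrow> 'm
    \<Rightarrow> (real \<Rightarrow> real \<Rightarrow> 'm) set monoid" where
  "pi221 A x = \<lparr> carrier = loops21 A x,
                 mult = (\<lambda>X Y. track2 A (hcomp (SOME \<Gamma>. \<Gamma> \<in> X) (SOME \<Gamma>'. \<Gamma>' \<in> Y))),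
                 one = track2 A (\<lambda>t s. x) \<rparr>"

definition bdry_u :: "('m::topological_space, 'e::euclidean_space) atlas
    \<Rightarrow> (real \<Rightarrow> real \<Rightarrow> 'm) set \<Rightarrow> (real \<Rightarrow> 'm) set" where
  "bdry_u A X = track1 A (\<lambda>t. (SOME \<Gamma>. \<Gamma> \<in> X) t 1)"

definition act21 :: "('m::topological_space, 'e::euclidean_space) atlas
    \<Rightarrow> (real \<Rightarrow> 'm) set \<Rightarrow> (real \<Rightarrow> real \<Rightarrow> 'm) set \<Rightarrow> (real \<Rightarrow> real \<Rightarrow> 'm) set" where
  "act21 A P X = (let \<gamma> = (SOME \<gamma>. \<gamma> \<in> P); \<Gamma> = (SOME \<Gamma>. \<Gamma> \<in> X) in
                    track2 A (hcomp (hcomp (idpath2 \<gamma>) \<Gamma>) (idpath2 (rev1 \<gamma>))))"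

definition crossed_module :: "('a, 'c) monoid_scheme \<Rightarrow> ('b, 'd) monoid_scheme
    \<Rightarrow> ('a \<Rightarrow> 'b) \<Rightarrow> ('b \<Rightarrow> 'a \<Rightarrow> 'a) \<Rightarrow> bool" where
  "crossed_module G H d act \<longleftrightarrow>
     group G \<and> group H \<and> d \<in> hom G H \<and>
     (\<forall>h\<in>carrier H. act h \<in> hom G G \<and> bij_betw (act h) (carrier G) (carrier G)) \<and>
     (\<forall>g\<in>carrier G. act \<one>\<^bsub>H\<^esub> g = g) \<and>
     (\<forall>h\<in>carrier H. \<forall>k\<in>carrier H. \<forall>g\<in>carrier G.
        act (h \<otimes>\<^bsub>H\<^esub> k) g = act h (act k g)) \<and>
     (\<forall>h\<in>carrier H. \<forall>g\<in>carrier G. d (act h g) = h \<otimes>\<^bsub>H\<^esub> d g \<otimes>\<^bsub>H\<^esub> inv\<^bsub>H\<^esub> h) \<and>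
     (\<forall>g\<in>carrier G. \<forall>g'\<in>carrier G. act (d g) g' = g \<otimes>\<^bsub>G\<^esub> g' \<otimes>\<^bsub>G\<^esub> inv\<^bsub>G\<^esub> g)"

end

(*
  The 2-tracks all of whose corners are the base point form a group G under horizontal composition,
  and the identity 2-tracks embed P = pi_1^1 into G as a common section i of the two homomorphisms
  d, u : G -> P (lower and upper edge). The set pi_2^{2,1} is the kernel of d, and the action is
  conjugation by i. The crossed module axioms then reduce to the statement that ker d and ker u
  commute (a cat^1-group). Up to rank-2 homotopy an element of ker u is concentrated in the lower part
  and an element of ker d in the upper part of the square, so the two can be slid past each other.

  All homotopies are maps J = Gamma o f (locally) with Gamma defined on the plane, so that the bound
  Rank(DJ) <= 2 is automatic. To make sense of such composites, 2-paths are extended to the plane by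
  clamping the coordinates. The laws for 1-tracks follow from those for 2-tracks, since two 1-paths
  are rank-1 homotopic iff their identity 2-paths are rank-2 homotopic.
*)
theory Submission
  imports Defs
begin

section \<open>Smooth functions on Euclidean spaces\<close>

text \<open>Bounding the rank inside the cube is easy; two other demands shape the construction. The
  restrictions of a homotopy to \<open>s = 0\<close> and \<open>s = 1\<close> must have rank at most
  1. A homotopy that moves 2-paths in \<open>t\<close> alone meets this, because its edges factor
  through a line. One that moves \<open>s\<close> may sweep an edge across the interior of a 2-path,
  so vertical motions are arranged to keep each edge fixed or to let it follow a given rank-1
  homotopy. The other demand is gluing, while smoothness and rank on a closed cube are defined
  through arbitrary extensions. Both are replaced by a condition on germs of maps defined
  everywhere. A glued map then has to agree near each point with one of its pieces, and collars
  ensure this: at a seam the pieces coincide on a neighbourhood, or one of them is constant there.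
  With the collars in place, the explicit homotopies reduce to polynomial inequalities in
  \<open>t\<close> and the homotopy parameter \<open>q\<close>. Widths such as \<open>e / 2\<close>
  and \<open>e / 4\<close> are the original width divided by the largest slope of the
  reparametrization in \<open>t\<close>.\<close>

lemma Ck_on_cong:
  assumes "open S" "\<And>y. y \<in> S \<Longrightarrow> f y = g y" "Ck_on k S f"
  shows "Ck_on k S g"
proof (cases k)
  case 0
  then show ?thesis using assms by (metis Ck_on.simps(1) continuous_on_cong)
next
  case (Suc m)
  with assms(3) obtain f' where f': "\<forall>y\<in>S. (f has_derivative f' y) (at y)" "\<forall>v. Ck_on m S (\<lambda>y. f' y v)"
    by auto
  have "(g has_derivative f' y) (at y)" if "y \<in> S" for y
    by (rule has_derivative_transform_within_open[where f=f and s=S]) (use that assms(1,2) f' in auto)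
  with f'(2) show ?thesis unfolding Suc Ck_on.simps by blast
qed

lemma Ck_on_subset: "Ck_on k S f \<Longrightarrow> T \<subseteq> S \<Longrightarrow> Ck_on k T f"
proof (induction k arbitrary: f)
  case 0
  then show ?case by (auto intro: continuous_on_subset)
next
  case (Suc k)
  then show ?case by (auto 0 4)
qed

lemma Ck_on_continuous: "Ck_on k S f \<Longrightarrow> continuous_on S f"
  by (cases k)
    (auto simp: continuous_on_eq_continuous_within
      intro: continuous_at_imp_continuous_within has_derivative_continuous)

lemma Ck_on_Suc_D: "Ck_on (Suc k) S f \<Longrightarrow> Ck_on k S f"
proof (induction k arbitrary: f)
  case 0
  then show ?case using Ck_on_continuous by (metis Ck_on.simps(1))
next
  case (Suc k)
  then show ?case by (metis Ck_on.simps(2))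
qed

lemma Ck_on_const: "Ck_on k S (\<lambda>_. c)"
proof (induction k arbitrary: c)
  case (Suc k)
  then show ?case by (auto intro!: exI[of _ "\<lambda>_ _. 0"])
qed auto

lemma Ck_on_bounded_linear:
  assumes "bounded_linear f"
  shows "Ck_on k S f"
proof (cases k)
  case 0
  then show ?thesis using assms by (simp add: linear_continuous_on)
next
  case (Suc m)
  then show ?thesis
    using bounded_linear_imp_has_derivative[OF assms] Ck_on_const
    by (auto intro!: exI[of _ "\<lambda>_. f"])
qed

lemma Ck_on_add: "Ck_on k S f \<Longrightarrow> Ck_on k S g \<Longrightarrow> Ck_on k S (\<lambda>y. f y + g y)"
proof (induction k arbitrary: f g)
  case 0
  then show ?case by (auto intro: continuous_on_add)
next
  case (Suc k)
  then obtain f' g' where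
    "\<forall>y\<in>S. (f has_derivative f' y) (at y)" "\<forall>v. Ck_on k S (\<lambda>y. f' y v)"
    "\<forall>y\<in>S. (g has_derivative g' y) (at y)" "\<forall>v. Ck_on k S (\<lambda>y. g' y v)"
    by auto
  then show ?case using Suc.IH
    by (auto intro!: exI[of _ "\<lambda>y v. f' y v + g' y v"] has_derivative_add)
qed

lemma Ck_on_sum: "finite I \<Longrightarrow> (\<And>i. i \<in> I \<Longrightarrow> Ck_on k S (f i)) \<Longrightarrow> Ck_on k S (\<lambda>y. \<Sum>i\<in>I. f i y)"
  by (induction I rule: finite_induct) (auto intro: Ck_on_const Ck_on_add)

lemma Ck_on_bilinear:
  assumes B: "bounded_bilinear B"
  shows "Ck_on k S f \<Longrightarrow> Ck_on k S g \<Longrightarrow> Ck_on k S (\<lambda>y. B (f y) (g y))"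
proof (induction k arbitrary: f g)
  case 0
  then show ?case using bounded_bilinear.continuous_on[OF B] by auto
next
  case (Suc k)
  then obtain f' g' where
    *: "\<forall>y\<in>S. (f has_derivative f' y) (at y)" "\<forall>v. Ck_on k S (\<lambda>y. f' y v)"
    "\<forall>y\<in>S. (g has_derivative g' y) (at y)" "\<forall>v. Ck_on k S (\<lambda>y. g' y v)"
    by auto
  have "\<forall>y\<in>S. ((\<lambda>y. B (f y) (g y)) has_derivative (\<lambda>v. B (f y) (g' y v) + B (f' y v) (g y))) (at y)"
    using * bounded_bilinear.FDERIV[OF B] by blast
  moreover have "Ck_on k S (\<lambda>y. B (f y) (g' y v) + B (f' y v) (g y))" for v
    by (intro Ck_on_add Suc.IH Ck_on_Suc_D[OF Suc.prems(1)] Ck_on_Suc_D[OF Suc.prems(2)]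
        *(2)[rule_format] *(4)[rule_format])
  ultimately show ?case by (auto intro!: exI[of _ "\<lambda>y v. B (f y) (g' y v) + B (f' y v) (g y)"])
qed

text \<open>The chain rule yields \<open>g' (f y) (f' y v)\<close>, whose direction varies with
  \<open>y\<close>, whereas the induction hypothesis treats fixed directions. Expanding the
  direction in \<open>Basis\<close> leaves a sum of products to which it applies.\<close>

lemma Ck_on_compose:
  "Ck_on k S f \<Longrightarrow> Ck_on k T g \<Longrightarrow> f ` S \<subseteq> T \<Longrightarrow> Ck_on k S (g \<circ> f)"
proof (induction k arbitrary: g)
  case 0
  then show ?case by (metis Ck_on.simps(1) continuous_on_compose continuous_on_subset)
next
  case (Suc k)
  then obtain f' g' where
    *: "\<forall>y\<in>S. (f has_derivative f' y) (at y)" "\<forall>v. Ck_on k S (\<lambda>y. f' y v)"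
    "\<forall>y\<in>T. (g has_derivative g' y) (at y)" "\<forall>v. Ck_on k T (\<lambda>y. g' y v)"
    by auto
  have 1: "(g \<circ> f has_derivative (\<lambda>v. g' (f y) (f' y v))) (at y)" if "y \<in> S" for y
    using diff_chain_at[of f "f' y" y g "g' (f y)"] * that Suc.prems by (auto simp: o_def)
  have 2: "g' (f y) (f' y v) = (\<Sum>b\<in>Basis. (f' y v \<bullet> b) *\<^sub>R ((\<lambda>z. g' z b) \<circ> f) y)" if "y \<in> S" for y v
  proof -
    have "linear (g' (f y))" using * that Suc.prems by (blast intro: has_derivative_linear)
    then have "g' (f y) (\<Sum>b\<in>Basis. (f' y v \<bullet> b) *\<^sub>R b) = (\<Sum>b\<in>Basis. (f' y v \<bullet> b) *\<^sub>R g' (f y) b)"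
      by (simp add: linear_sum linear_scale)
    then show ?thesis by (simp add: euclidean_representation)
  qed
  have 3: "Ck_on k S (\<lambda>y. \<Sum>b\<in>Basis. (f' y v \<bullet> b) *\<^sub>R ((\<lambda>z. g' z b) \<circ> f) y)" for v
  proof (intro Ck_on_sum Ck_on_bilinear[OF bounded_bilinear_scaleR] Suc.IH)
    show "Ck_on k S (\<lambda>y. f' y v \<bullet> b)" for b
      by (rule Ck_on_bilinear[OF bounded_bilinear_inner, of k S "\<lambda>y. f' y v" "\<lambda>_. b"])
        (use * Ck_on_const in blast)+
    show "Ck_on k S f" using Suc.prems Ck_on_Suc_D by blast
  qed (use * Suc.prems in auto)
  \<comment> \<open>\<open>S\<close> may fail to be open, so equality on \<open>S\<close> alone does
    not transport \<open>Ck_on\<close>. Off \<open>S\<close> the value is taken to be the expansion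
    itself, which makes the identity hold everywhere.\<close>
  define D where "D y v = (if y \<in> S then g' (f y) (f' y v)
      else (\<Sum>b\<in>Basis. (f' y v \<bullet> b) *\<^sub>R ((\<lambda>z. g' z b) \<circ> f) y))" for y v
  have "D y v = (\<Sum>b\<in>Basis. (f' y v \<bullet> b) *\<^sub>R ((\<lambda>z. g' z b) \<circ> f) y)" for y v
    using 2 by (auto simp: D_def)
  then have "Ck_on k S (\<lambda>y. D y v)" for v using 3 by simp
  moreover have "(g \<circ> f has_derivative D y) (at y)" if "y \<in> S" for y
    using 1[OF that] that by (simp add: D_def[abs_def])
  ultimately show ?case unfolding Ck_on.simps by blast
qed

text \<open>The hypothesis supplies a different derivative witness near each point. By uniqueness of
  derivatives they all coincide with \<open>frechet_derivative\<close>, which serves as a common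
  witness.\<close>

lemma Ck_on_local:
  "(\<And>y. y \<in> S \<Longrightarrow> \<exists>N. open N \<and> y \<in> N \<and> Ck_on k N f) \<Longrightarrow> Ck_on k S f"
proof (induction k arbitrary: f)
  case 0
  have "isCont f y" if "y \<in> S" for y
  proof -
    from 0[OF that] obtain N where "open N" "y \<in> N" "Ck_on 0 N f" by auto
    then show ?thesis by (simp add: continuous_on_eq_continuous_at)
  qed
  then show ?case by (simp add: continuous_at_imp_continuous_on)
next
  case (Suc k)
  let ?D = "\<lambda>y. frechet_derivative f (at y)"
  have *: "\<exists>N. open N \<and> y \<in> N \<and> (\<forall>z\<in>N. (f has_derivative ?D z) (at z)) \<and> (\<forall>v. Ck_on k N (\<lambda>z. ?D z v))"
    if "y \<in> S" for y
  proof -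
    from Suc.prems[OF that] obtain N where N: "open N" "y \<in> N" "Ck_on (Suc k) N f" by auto
    then obtain f' where f': "\<forall>z\<in>N. (f has_derivative f' z) (at z)" "\<forall>v. Ck_on k N (\<lambda>z. f' z v)" by auto
    then have eq: "f' z = ?D z" if "z \<in> N" for z using that frechet_derivative_at by blast
    have "Ck_on k N (\<lambda>z. ?D z v)" for v
      by (rule Ck_on_cong[OF N(1), where f="\<lambda>z. f' z v"]) (use eq f' in auto)
    then show ?thesis using N f' eq by auto
  qed
  have "\<forall>y\<in>S. (f has_derivative ?D y) (at y)" using * by blast
  moreover have "Ck_on k S (\<lambda>y. ?D y v)" for v by (rule Suc.IH) (use * in blast)
  ultimately show ?case by auto
qed

lemma smooth_on_cong: "open S \<Longrightarrow> (\<And>y. y \<in> S \<Longrightarrow> f y = g y) \<Longrightarrow> smooth_on S f \<Longrightarrow> smooth_on S g"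
  unfolding smooth_on_def by (simp add: Ck_on_cong[where f=f and g=g])

lemma smooth_on_subset: "smooth_on S f \<Longrightarrow> T \<subseteq> S \<Longrightarrow> smooth_on T f"
  using Ck_on_subset unfolding smooth_on_def by blast

lemma smooth_on_local:
  "(\<And>y. y \<in> S \<Longrightarrow> \<exists>N. open N \<and> y \<in> N \<and> smooth_on N f) \<Longrightarrow> smooth_on S f"
  unfolding smooth_on_def by (auto intro!: Ck_on_local)

lemma smooth_on_compose: "smooth_on S f \<Longrightarrow> smooth_on T g \<Longrightarrow> f ` S \<subseteq> T \<Longrightarrow> smooth_on S (g \<circ> f)"
  unfolding smooth_on_def by (blast intro: Ck_on_compose)

lemma smooth_on_has_derivative:
  "smooth_on S f \<Longrightarrow> y \<in> S \<Longrightarrow> \<exists>D. (f has_derivative D) (at y)"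
  unfolding smooth_on_def by (drule spec[of _ "Suc 0"]) auto

lemma smooth_on_continuous: "smooth_on S f \<Longrightarrow> continuous_on S f"
  unfolding smooth_on_def by (metis Ck_on.simps(1))

lemma smooth_on_const: "smooth_on S (\<lambda>_. c)"
  unfolding smooth_on_def by (simp add: Ck_on_const)

lemma smooth_on_bounded_linear: "bounded_linear f \<Longrightarrow> smooth_on S f"
  unfolding smooth_on_def by (simp add: Ck_on_bounded_linear)

lemma smooth_on_compose_linear: "bounded_linear L \<Longrightarrow> smooth_on S f \<Longrightarrow> smooth_on S (\<lambda>y. L (f y))"
  using smooth_on_compose[OF _ smooth_on_bounded_linear, of S f L UNIV] by (simp add: o_def)

lemma smooth_on_add: "smooth_on S f \<Longrightarrow> smooth_on S g \<Longrightarrow> smooth_on S (\<lambda>y. f y + g y)"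
  unfolding smooth_on_def by (simp add: Ck_on_add)

lemma smooth_on_scaleR:
  "smooth_on S f \<Longrightarrow> smooth_on S g \<Longrightarrow> smooth_on S (\<lambda>y. (f y :: real) *\<^sub>R g y)"
  unfolding smooth_on_def by (simp add: Ck_on_bilinear[OF bounded_bilinear_scaleR])

lemma smooth_on_mult:
  fixes f g :: "'a::euclidean_space \<Rightarrow> real"
  shows "smooth_on S f \<Longrightarrow> smooth_on S g \<Longrightarrow> smooth_on S (\<lambda>y. f y * g y)"
  using smooth_on_scaleR[of S f g] by simp

lemma smooth_on_minus: "smooth_on S f \<Longrightarrow> smooth_on S (\<lambda>y. - f y)"
  by (rule smooth_on_compose_linear[OF bounded_linear_minus[OF bounded_linear_ident]])

lemma smooth_on_diff: "smooth_on S f \<Longrightarrow> smooth_on S g \<Longrightarrow> smooth_on S (\<lambda>y. f y - g y)"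
  using smooth_on_add[OF _ smooth_on_minus, of S f g] by simp

lemma smooth_on_power:
  fixes f :: "'a::euclidean_space \<Rightarrow> real"
  shows "smooth_on S f \<Longrightarrow> smooth_on S (\<lambda>y. f y ^ n)"
  by (induction n) (auto intro: smooth_on_const smooth_on_mult)

lemma smooth_on_Pair: 
  assumes "smooth_on S f" "smooth_on S g" shows "smooth_on S (\<lambda>y. (f y, g y))"
proof -
  have "bounded_linear (\<lambda>z::'b. (z, 0::'c))" "bounded_linear (\<lambda>z::'c. (0::'b, z))"
    by (intro bounded_linear_Pair bounded_linear_ident bounded_linear_zero)+
  from smooth_on_add[OF smooth_on_compose_linear[OF this(1) assms(1)] smooth_on_compose_linear[OF this(2) assms(2)]]
  show ?thesis by simp
qed

lemma smooth_on_fst: "smooth_on S f \<Longrightarrow> smooth_on S (\<lambda>y. fst (f y))"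
  and smooth_on_snd: "smooth_on S f \<Longrightarrow> smooth_on S (\<lambda>y. snd (f y))"
  by (auto intro: smooth_on_compose_linear bounded_linear_fst bounded_linear_snd)

lemma smooth_on_id: "smooth_on S (\<lambda>y. y)"
  by (rule smooth_on_bounded_linear[OF bounded_linear_ident])

section \<open>Flat functions and a smooth step\<close>

text \<open>With $g_n(x) = x^{-n} e^{-1/x}$ for $x > 0$ and $g_n(x) = 0$ otherwise, one has
  $g_n' = g_{n+2} - n g_{n+1}$; hence all $g_n$ are smooth.\<close>

definition flat_exp :: "nat \<Rightarrow> real \<Rightarrow> real" where
  "flat_exp n u = (if u \<le> 0 then 0 else inverse u ^ n * exp (- inverse u))"

lemma flat_exp_tendsto_0: "(flat_exp n \<longlongrightarrow> 0) (at 0)"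
proof -
  have "((\<lambda>y::real. y ^ n / exp y) \<longlongrightarrow> 0) at_top" by (rule tendsto_power_div_exp_0)
  then have "((\<lambda>u::real. inverse u ^ n / exp (inverse u)) \<longlongrightarrow> 0) (at_right 0)"
    using filterlim_inverse_at_top_right filterlim_compose by blast
  then have "(flat_exp n \<longlongrightarrow> 0) (at_right 0)"
    by (rule Lim_transform_eventually)
      (auto simp: eventually_at_filter flat_exp_def exp_minus field_simps)
  moreover have "(flat_exp n \<longlongrightarrow> 0) (at_left 0)"
    by (rule tendsto_eventually) (auto simp: eventually_at_filter flat_exp_def)
  ultimately show ?thesis by (simp add: filterlim_split_at)
qed

lemma flat_exp_deriv:
  "(flat_exp n has_derivative (\<lambda>h. (flat_exp (n + 2) u - n * flat_exp (Suc n) u) * h)) (at u)"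
proof -
  consider "u < 0" | "u = 0" | "u > 0" by linarith
  then have "(flat_exp n has_real_derivative (flat_exp (n + 2) u - n * flat_exp (Suc n) u)) (at u)"
  proof cases
    case 1
    have "((\<lambda>_. 0) has_real_derivative (flat_exp (n + 2) u - n * flat_exp (Suc n) u)) (at u)"
      using 1 by (simp add: flat_exp_def)
    then show ?thesis
      by (rule has_field_derivative_transform_within_open[where S="{..<0}"])
        (use 1 in \<open>auto simp: flat_exp_def\<close>)
  next
    case 2
    \<comment> \<open>The difference quotient of \<open>flat_exp n\<close> at 0 is
      \<open>flat_exp (Suc n)\<close>.\<close>
    have "(flat_exp n has_real_derivative 0) (at 0)"
      unfolding has_field_derivative_iff
      by (rule Lim_transform_eventually[OF flat_exp_tendsto_0[of "Suc n"]])
        (auto simp: eventually_at_filter flat_exp_def field_simps)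
    then show ?thesis using 2 by (simp add: flat_exp_def)
  next
    case 3
    have 1: "(inverse has_real_derivative - (inverse u ^ Suc (Suc 0))) (at u)"
      using DERIV_inverse[of u] 3 by simp
    have "((\<lambda>u. inverse u ^ n * exp (- inverse u)) has_real_derivative
        real n * (- (inverse u ^ Suc (Suc 0)) * inverse u ^ (n - Suc 0)) * exp (- inverse u)
        + exp (- inverse u) * - (- (inverse u ^ Suc (Suc 0))) * inverse u ^ n) (at u)"
      by (intro DERIV_mult DERIV_power DERIV_fun_exp DERIV_minus 1)
    also have "real n * (- (inverse u ^ Suc (Suc 0)) * inverse u ^ (n - Suc 0)) * exp (- inverse u)
        + exp (- inverse u) * - (- (inverse u ^ Suc (Suc 0))) * inverse u ^ n =
        flat_exp (n + 2) u - n * flat_exp (Suc n) u"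
      using 3 by (cases n) (simp_all add: flat_exp_def algebra_simps)
    finally have "((\<lambda>u. inverse u ^ n * exp (- inverse u)) has_real_derivative
        (flat_exp (n + 2) u - n * flat_exp (Suc n) u)) (at u)" .
    then show ?thesis
      by (rule has_field_derivative_transform_within_open[where S="{0<..}"])
        (use 3 in \<open>auto simp: flat_exp_def\<close>)
  qed
  then show ?thesis by (simp add: has_field_derivative_def)
qed

lemma smooth_flat_exp: "smooth_on UNIV (flat_exp n)"
proof -
  have "Ck_on k UNIV (flat_exp n)" for k
  proof (induction k arbitrary: n)
    case 0
    then show ?case
      using has_derivative_continuous[OF flat_exp_deriv] by (simp add: continuous_on_eq_continuous_at)
  next
    case (Suc k)
    have "Ck_on k UNIV (\<lambda>u. (flat_exp (n + 2) u + (- real n) *\<^sub>R flat_exp (Suc n) u) *\<^sub>R h)" for h :: real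
      by (intro Ck_on_bilinear[OF bounded_bilinear_scaleR] Ck_on_add Ck_on_const Suc)
    then show ?case using flat_exp_deriv[of n]
      by (auto intro!: exI[of _ "\<lambda>u h. (flat_exp (n + 2) u - n * flat_exp (Suc n) u) * h"])
  qed
  then show ?thesis by (simp add: smooth_on_def)
qed

text \<open>Flatness is used twice: the inner function vanishes up to \<open>u = 1/3\<close>, and
  the outer one vanishes once the inner one has reached \<open>flat_exp 0 1\<close>, at
  \<open>u = 2/3\<close>. The denominator is a constant, so smoothness involves no quotient
  rule.\<close>

definition smooth_step :: "real \<Rightarrow> real" where
  "smooth_step u = 1 - flat_exp 0 (flat_exp 0 1 - flat_exp 0 (3 * u - 1)) / flat_exp 0 (flat_exp 0 1)"

lemma smooth_smooth_step: 
  assumes "smooth_on S f" shows "smooth_on S (\<lambda>y. smooth_step (f y))"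
proof -
  have *: "smooth_on S (\<lambda>y. flat_exp 0 (g y))" if "smooth_on S g" for g :: "'a \<Rightarrow> real"
    using smooth_on_compose[OF that smooth_flat_exp] by (simp add: o_def)
  show ?thesis unfolding smooth_step_def divide_inverse
    by (intro smooth_on_diff smooth_on_mult smooth_on_const * assms)
qed

lemma flat_exp_mono: "u \<le> v \<Longrightarrow> flat_exp 0 u \<le> flat_exp 0 v"
  by (auto simp: flat_exp_def)

lemma smooth_step_0: "u \<le> 1/3 \<Longrightarrow> smooth_step u = 0"
  by (simp add: smooth_step_def flat_exp_def)

lemma smooth_step_1: "u \<ge> 2/3 \<Longrightarrow> smooth_step u = 1"
  using flat_exp_mono[of 1 "3 * u - 1"] by (simp add: smooth_step_def flat_exp_def[of 0 "_ - _"])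

lemma smooth_step_range: "0 \<le> smooth_step u" "smooth_step u \<le> 1"
proof -
  have "flat_exp 0 (flat_exp 0 1 - flat_exp 0 (3 * u - 1)) \<le> flat_exp 0 (flat_exp 0 1)"
    by (rule flat_exp_mono) (simp add: flat_exp_def)
  moreover have "flat_exp 0 (flat_exp 0 1) > 0" by (simp add: flat_exp_def)
  ultimately show "0 \<le> smooth_step u" by (simp add: smooth_step_def field_simps)
  show "smooth_step u \<le> 1" by (simp add: smooth_step_def) (simp add: flat_exp_def)
qed

lemmas smooth_intros =
  smooth_on_const smooth_on_id smooth_on_add smooth_on_diff smooth_on_mult smooth_on_minus
  smooth_on_power smooth_on_Pair smooth_on_fst smooth_on_snd smooth_smooth_step

section \<open>Maps into the manifold with bounded rank\<close>

text \<open>Used with two kinds of \<open>e\<close>: \<open>clamp_to 0\<close> retracts the line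
  onto the unit interval and defines extensions, while for a collar width \<open>e\<close> a
  collared map takes the same value at \<open>u\<close> and at \<open>clamp_to e u\<close>.\<close>

definition clamp_to :: "real \<Rightarrow> real \<Rightarrow> real" where
  "clamp_to e u = max e (min (1 - e) u)"

definition clamp_vec :: "real \<Rightarrow> 'a::euclidean_space \<Rightarrow> 'a" where
  "clamp_vec e p = (\<Sum>b\<in>Basis. clamp_to e (p \<bullet> b) *\<^sub>R b)"

lemma clamp_vec_inner: "b \<in> Basis \<Longrightarrow> clamp_vec e p \<bullet> b = clamp_to e (p \<bullet> b)"
  by (simp add: clamp_vec_def)

lemma clamp_vec_Pair: "clamp_vec e (p, q) = (clamp_vec e p, clamp_vec e q)"
  by (rule euclidean_eqI) (auto simp: clamp_vec_inner Basis_prod_def inner_Pair)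

lemma clamp_vec_real: "clamp_vec e (u::real) = clamp_to e u"
  by (simp add: clamp_vec_def)

lemma One_Pair: "(One :: 'a::euclidean_space \<times> 'b::euclidean_space) = (One, One)"
proof (rule euclidean_eqI)
  fix b :: "'a \<times> 'b" assume b: "b \<in> Basis"
  then have "(One :: 'a \<times> 'b) \<bullet> b = 1" by (rule inner_sum_Basis)
  moreover have "(One, One) \<bullet> b = 1"
    using b by (auto simp: Basis_prod_def inner_sum_Basis)
  ultimately show "(One :: 'a \<times> 'b) \<bullet> b = (One, One) \<bullet> b" by simp
qed

text \<open>Square and cube are brought to the form \<open>cbox 0 One\<close>, for which clamping
  and rank bounds are treated once in every dimension.\<close>

lemma unit_sq_eq: "unit_sq = cbox 0 One"
  by (simp only: One_Pair zero_prod_def) simp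

lemma unit_cube3_eq: "unit_cube3 = cbox 0 One"
  by (simp only: One_Pair zero_prod_def) simp

lemma cbox_One_iff: "p \<in> cbox 0 One \<longleftrightarrow> (\<forall>b\<in>Basis. 0 \<le> p \<bullet> b \<and> p \<bullet> b \<le> 1)"
  by (simp add: mem_box inner_sum_Basis)

lemma mem_unit_sq: "(t, s) \<in> unit_sq \<longleftrightarrow> t \<in> {0..1} \<and> s \<in> {0..1}"
  by auto

lemma mem_unit_cube3: "(t, s, r) \<in> unit_cube3 \<longleftrightarrow> t \<in> {0..1} \<and> s \<in> {0..1} \<and> r \<in> {0..1}"
  by auto

lemma clamp_to_unit [simp]: "clamp_to 0 u \<in> {0..1}" "0 \<le> clamp_to 0 u" "clamp_to 0 u \<le> 1"
  by (auto simp: clamp_to_def)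

lemma clamp_to_id [simp]: "0 \<le> u \<Longrightarrow> u \<le> 1 \<Longrightarrow> clamp_to 0 u = u"
  by (auto simp: clamp_to_def)

lemma clamp_vec_mem: "clamp_vec 0 p \<in> cbox 0 One"
  by (simp add: cbox_One_iff clamp_vec_inner)

lemma clamp_vec_id: "p \<in> cbox 0 One \<Longrightarrow> clamp_vec 0 p = p"
  by (rule euclidean_eqI) (simp add: cbox_One_iff clamp_vec_inner)

lemma mfld_smoothI:
  "continuous_on W G \<Longrightarrow> (\<And>U \<phi>. (U, \<phi>) \<in> A \<Longrightarrow> smooth_on (W \<inter> G -` U) (\<phi> \<circ> G)) \<Longrightarrow> mfld_smooth A W G"
  and mfld_smooth_continuous: "mfld_smooth A W G \<Longrightarrow> continuous_on W G"
  and mfld_smooth_chart: "mfld_smooth A W G \<Longrightarrow> (U, \<phi>) \<in> A \<Longrightarrow> smooth_on (W \<inter> G -` U) (\<phi> \<circ> G)"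
  unfolding mfld_smooth_def by auto

lemma mfld_smooth_subset:
  assumes "mfld_smooth A W G" "V \<subseteq> W"
  shows "mfld_smooth A V G"
proof (rule mfld_smoothI)
  show "continuous_on V G"
    by (rule continuous_on_subset[OF mfld_smooth_continuous[OF assms(1)] assms(2)])
  show "smooth_on (V \<inter> G -` U) (\<phi> \<circ> G)" if "(U, \<phi>) \<in> A" for U \<phi>
    by (rule smooth_on_subset[OF mfld_smooth_chart[OF assms(1) that]]) (use assms(2) in auto)
qed

lemma mfld_smooth_compose:
  assumes G: "mfld_smooth A W G" and f: "smooth_on V f" "f ` V \<subseteq> W"
  shows "mfld_smooth A V (G \<circ> f)"
proof (rule mfld_smoothI)
  show "continuous_on V (G \<circ> f)"
    by (rule continuous_on_compose[OF smooth_on_continuous[OF f(1)]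
          continuous_on_subset[OF mfld_smooth_continuous[OF G] f(2)]])
  fix U \<phi> assume c: "(U, \<phi>) \<in> A"
  have "smooth_on (V \<inter> (G \<circ> f) -` U) ((\<phi> \<circ> G) \<circ> f)"
    by (rule smooth_on_compose[OF smooth_on_subset[OF f(1)] mfld_smooth_chart[OF G c]])
      (use f in auto)
  then show "smooth_on (V \<inter> (G \<circ> f) -` U) (\<phi> \<circ> (G \<circ> f))" by (simp only: o_assoc)
qed

text \<open>By the chain rule and uniqueness of derivatives, \<open>D\<close> factors through the
  derivative of \<open>\<phi> \<circ> G\<close> at \<open>f p\<close>; precomposition therefore
  cannot raise the rank.\<close>

lemma chart_rank_compose:
  assumes G: "mfld_smooth A W G" and f: "smooth_on V f" "p \<in> V" "f p \<in> W"
    and c: "(U, \<phi>) \<in> A" "G (f p) \<in> U"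
    and D: "((\<phi> \<circ> (G \<circ> f)) has_derivative D) (at p)"
  shows "\<exists>D'. ((\<phi> \<circ> G) has_derivative D') (at (f p)) \<and> dim (range D) \<le> dim (range D')"
proof -
  obtain D' where D': "((\<phi> \<circ> G) has_derivative D') (at (f p))"
    using smooth_on_has_derivative[OF mfld_smooth_chart[OF G c(1)], of "f p"] f c by auto
  obtain f' where f': "(f has_derivative f') (at p)" using smooth_on_has_derivative[OF f(1,2)] by auto
  have "D = D' \<circ> f'"
    by (rule has_derivative_unique[OF D diff_chain_at[OF f' D', unfolded o_assoc[symmetric]]])
  then have "range D \<subseteq> range D'" by auto
  then show ?thesis using D' dim_subset by blast
qed

lemma rank_leD:
  assumes "rank_le A K F r" "p \<in> K" "(U, \<phi>) \<in> A" "F p \<in> U"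
    "open W" "K \<subseteq> W" "mfld_smooth A W G" "\<And>y. y \<in> K \<Longrightarrow> G y = F y"
    "((\<phi> \<circ> G) has_derivative D) (at p)"
  shows "dim (range D) \<le> r"
proof -
  have "case (U, \<phi>) of (U, \<phi>) \<Rightarrow> F p \<in> U \<longrightarrow>
        (\<forall>W G D. open W \<and> K \<subseteq> W \<and> mfld_smooth A W G \<and> (\<forall>y\<in>K. G y = F y)
             \<and> ((\<phi> \<circ> G) has_derivative D) (at p) \<longrightarrow> dim (range D) \<le> r)"
    using assms(1)[unfolded rank_le_def, THEN bspec, OF assms(2), THEN bspec, OF assms(3)] .
  then show ?thesis using assms(4-) by (simp only: prod.case) blast
qed

text \<open>Open chart domains have open preimages under continuous maps, which makes smoothness and
  rank local conditions that can be glued.\<close>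

locale charted =
  fixes A :: "('m::topological_space, 'e::euclidean_space) atlas"
  assumes open_chart: "(U, \<phi>) \<in> A \<Longrightarrow> open U"
begin

lemma mfld_smooth_open_preimage:
  assumes "mfld_smooth A V F" "open V" "(U, \<phi>) \<in> A"
  shows "open (V \<inter> F -` U)"
  by (rule continuous_open_preimage[OF mfld_smooth_continuous[OF assms(1)] assms(2) open_chart[OF assms(3)]])

lemma mfld_smooth_cong:
  assumes V: "open V" and eq: "\<And>q. q \<in> V \<Longrightarrow> F q = G q" and F: "mfld_smooth A V F"
  shows "mfld_smooth A V G"
proof (rule mfld_smoothI)
  show "continuous_on V G"
    using mfld_smooth_continuous[OF F] eq by (simp cong: continuous_on_cong)
  fix U \<phi> assume c: "(U, \<phi>) \<in> A"
  have "smooth_on (V \<inter> F -` U) (\<phi> \<circ> G)"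
    by (rule smooth_on_cong[OF mfld_smooth_open_preimage[OF F V c] _ mfld_smooth_chart[OF F c]])
      (use eq in auto)
  moreover have "V \<inter> G -` U = V \<inter> F -` U" using eq by auto
  ultimately show "smooth_on (V \<inter> G -` U) (\<phi> \<circ> G)" by simp
qed

lemma mfld_smooth_local:
  assumes "\<And>q. q \<in> V \<Longrightarrow> \<exists>N. open N \<and> q \<in> N \<and> mfld_smooth A N F"
  shows "mfld_smooth A V F"
proof (rule mfld_smoothI)
  have "isCont F q" if "q \<in> V" for q
  proof -
    from assms[OF that] obtain N where "open N" "q \<in> N" "continuous_on N F"
      using mfld_smooth_continuous by auto
    then show ?thesis by (simp add: continuous_on_eq_continuous_at)
  qed
  then show "continuous_on V F" by (simp add: continuous_at_imp_continuous_on)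
  fix U \<phi> assume c: "(U, \<phi>) \<in> A"
  show "smooth_on (V \<inter> F -` U) (\<phi> \<circ> F)"
  proof (rule smooth_on_local)
    fix q assume q: "q \<in> V \<inter> F -` U"
    then obtain N where N: "open N" "q \<in> N" "mfld_smooth A N F" using assms by auto
    show "\<exists>N. open N \<and> q \<in> N \<and> smooth_on N (\<phi> \<circ> F)"
      using mfld_smooth_open_preimage[OF N(3,1) c] mfld_smooth_chart[OF N(3) c] q N(2) by blast
  qed
qed

section \<open>Germs of smooth maps with bounded rank\<close>

definition chart_rank_le :: "nat \<Rightarrow> ('a::euclidean_space \<Rightarrow> 'm) \<Rightarrow> 'a \<Rightarrow> bool" where
  "chart_rank_le r F p \<longleftrightarrow> (\<forall>(U, \<phi>)\<in>A. F p \<in> U \<longrightarrow>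
     (\<forall>D. ((\<phi> \<circ> F) has_derivative D) (at p) \<longrightarrow> dim (range D) \<le> r))"

text \<open>A condition on the germ of \<open>F\<close> at \<open>p\<close> that mentions no
  extension. Asking for the bound on a whole neighbourhood makes it stable under local equality and
  under smooth substitution, the two operations from which all homotopies below are built.\<close>

definition good :: "nat \<Rightarrow> ('a::euclidean_space \<Rightarrow> 'm) \<Rightarrow> 'a \<Rightarrow> bool" where
  "good r F p \<longleftrightarrow> (\<exists>V. open V \<and> p \<in> V \<and> mfld_smooth A V F \<and> (\<forall>q\<in>V. chart_rank_le r F q))"

lemma chart_rank_leI:
  "(\<And>U \<phi> D. (U, \<phi>) \<in> A \<Longrightarrow> F p \<in> U \<Longrightarrow> ((\<phi> \<circ> F) has_derivative D) (at p) \<Longrightarrow> dim (range D) \<le> r)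
    \<Longrightarrow> chart_rank_le r F p"
  and chart_rank_leD: "chart_rank_le r F p \<Longrightarrow> (U, \<phi>) \<in> A \<Longrightarrow> F p \<in> U
    \<Longrightarrow> ((\<phi> \<circ> F) has_derivative D) (at p) \<Longrightarrow> dim (range D) \<le> r"
  unfolding chart_rank_le_def by auto

lemma chart_rank_le_cong:
  assumes "open V" "p \<in> V" "\<And>q. q \<in> V \<Longrightarrow> F q = G q" "chart_rank_le r F p"
  shows "chart_rank_le r G p"
proof (rule chart_rank_leI)
  fix U \<phi> D assume c: "(U, \<phi>) \<in> A" "G p \<in> U" and D: "((\<phi> \<circ> G) has_derivative D) (at p)"
  have "((\<phi> \<circ> F) has_derivative D) (at p)"
    by (rule has_derivative_transform_within_open[OF D assms(1,2)]) (use assms(3) in auto)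
  then show "dim (range D) \<le> r" using chart_rank_leD[OF assms(4) c(1)] c(2) assms(2,3) by simp
qed

lemma chart_rank_le_compose:
  assumes "mfld_smooth A W G" "smooth_on V f" "p \<in> V" "f p \<in> W" "chart_rank_le r G (f p)"
  shows "chart_rank_le r (G \<circ> f) p"
proof (rule chart_rank_leI)
  fix U \<phi> D assume c: "(U, \<phi>) \<in> A" "(G \<circ> f) p \<in> U" and D: "((\<phi> \<circ> (G \<circ> f)) has_derivative D) (at p)"
  obtain D' where "((\<phi> \<circ> G) has_derivative D') (at (f p))" "dim (range D) \<le> dim (range D')"
    using chart_rank_compose[OF assms(1-4) c(1) _ D] c by auto
  then show "dim (range D) \<le> r" using chart_rank_leD[OF assms(5) c(1)] c(2) by fastforce
qed

lemma good_cong: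
  assumes "good r F p" "\<forall>\<^sub>F q in nhds p. F q = G q"
  shows "good r G p"
proof -
  obtain V where V: "open V" "p \<in> V" "mfld_smooth A V F" "\<forall>q\<in>V. chart_rank_le r F q"
    using assms unfolding good_def by auto
  obtain N where N: "open N" "p \<in> N" "\<And>q. q \<in> N \<Longrightarrow> F q = G q"
    using assms(2) unfolding eventually_nhds by auto
  have "mfld_smooth A (V \<inter> N) G"
    by (rule mfld_smooth_cong[OF _ _ mfld_smooth_subset[OF V(3)]]) (use V N in auto)
  moreover have "chart_rank_le r G q" if "q \<in> V \<inter> N" for q
    by (rule chart_rank_le_cong[of "V \<inter> N" _ F]) (use V N that in auto)
  ultimately show ?thesis unfolding good_def using V N by (intro exI[of _ "V \<inter> N"]) auto
qed

lemma good_compose: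
  assumes "good r G (f p)" "smooth_on UNIV f"
  shows "good r (\<lambda>q. G (f q)) p"
proof -
  obtain W where W: "open W" "f p \<in> W" "mfld_smooth A W G" "\<forall>q\<in>W. chart_rank_le r G q"
    using assms unfolding good_def by auto
  have V: "open (f -` W)"
    using W(1) smooth_on_continuous[OF assms(2)] continuous_on_open_vimage[of UNIV f] by auto
  have f: "smooth_on (f -` W) f" using smooth_on_subset[OF assms(2)] by auto
  have "mfld_smooth A (f -` W) (G \<circ> f)" by (rule mfld_smooth_compose[OF W(3) f]) auto
  moreover have "chart_rank_le r (G \<circ> f) q" if "q \<in> f -` W" for q
    using chart_rank_le_compose[OF W(3) f that] W that by auto
  ultimately have "good r (G \<circ> f) p" using V W unfolding good_def by (intro exI[of _ "f -` W"]) auto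
  then show ?thesis by (simp add: o_def)
qed

lemma good_mono:
  assumes "good r F p" "r \<le> r'"
  shows "good r' F p"
proof -
  have "chart_rank_le r' F q" if "chart_rank_le r F q" for q
    by (rule chart_rank_leI) (meson that assms(2) chart_rank_leD order_trans)
  then show ?thesis using assms(1) unfolding good_def by blast
qed

text \<open>A derivative has rank at most the dimension of its source. Combined with
  \<open>good_compose\<close>, maps that factor through the line or the plane get their rank bound
  for free.\<close>

lemma good_DIM:
  fixes F :: "'a::euclidean_space \<Rightarrow> 'm"
  assumes "good r F p" "DIM('a) \<le> k"
  shows "good k F p"
proof -
  have "chart_rank_le k F q" for q
  proof (rule chart_rank_leI)
    fix U D and \<phi> :: "'m \<Rightarrow> 'e" assume "((\<phi> \<circ> F) has_derivative D) (at q)"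
    then have "linear D" by (rule has_derivative_linear)
    then have "dim (range D) \<le> dim (UNIV :: 'a set)" by (rule dim_image_le)
    then show "dim (range D) \<le> k" using assms(2) by simp
  qed
  then show ?thesis using assms(1) unfolding good_def by blast
qed

lemma good_const: "good r (\<lambda>_. x) p"
proof -
  have "mfld_smooth A UNIV (\<lambda>_::'a. x)"
    by (rule mfld_smoothI) (simp_all add: o_def smooth_on_const)
  moreover have "chart_rank_le r (\<lambda>_. x) q" for q :: 'a
  proof (rule chart_rank_leI)
    fix U D and \<phi> :: "'m \<Rightarrow> 'e" assume "((\<phi> \<circ> (\<lambda>_::'a. x)) has_derivative D) (at q)"
    then have "D = (\<lambda>_. 0)"
      by (rule has_derivative_unique) (simp add: o_def)
    then have "dim (range D) = 0" by (subst dim_eq_0) auto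
    then show "dim (range D) \<le> r" by linarith
  qed
  ultimately show ?thesis unfolding good_def by blast
qed

lemma mfld_smooth_good: "(\<And>p. good r F p) \<Longrightarrow> mfld_smooth A UNIV F"
  unfolding good_def by (rule mfld_smooth_local) blast

lemma smooth_cube_good:
  assumes "\<And>p. good r F p" "\<And>p. p \<in> K \<Longrightarrow> F p = F' p"
  shows "smooth_cube A K F'"
  unfolding smooth_cube_def
  by (intro exI[of _ UNIV] exI[of _ F]) (use mfld_smooth_good[OF assms(1)] assms(2) in simp)

text \<open>\<open>rank_le\<close> ranges over all extensions \<open>G\<close>, but derivatives
  within a nondegenerate closed box are unique even at boundary points. At points of the cube every
  differentiable \<open>\<phi> \<circ> G\<close> hence has the derivative of
  \<open>\<phi> \<circ> F\<close>.\<close>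

lemma rank_le_good:
  fixes F :: "'a::euclidean_space \<Rightarrow> 'm"
  assumes "\<And>p. good r F p" "\<And>p. p \<in> cbox 0 One \<Longrightarrow> F p = F' p"
  shows "rank_le A (cbox 0 One) F' r"
  unfolding rank_le_def
proof clarify
  let ?K = "cbox 0 One :: 'a set"
  fix p U \<phi> W G D
  assume p: "p \<in> ?K" "(U, \<phi>) \<in> A" "F' p \<in> U" and G: "?K \<subseteq> W" "\<forall>y\<in>?K. G y = F' y"
    and D: "((\<phi> \<circ> G) has_derivative D) (at p)"
  have "F p \<in> U" using p assms(2) by simp
  then obtain D' where D': "((\<phi> \<circ> F) has_derivative D') (at p)"
    using smooth_on_has_derivative[OF mfld_smooth_chart[OF mfld_smooth_good[OF assms(1)] p(2)], of p]
    by auto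
  have "((\<phi> \<circ> G) has_derivative D') (at p within ?K)"
    by (rule has_derivative_transform[OF p(1) _ has_derivative_at_withinI[OF D']]) (use G assms in auto)
  then have "D = D'"
    using frechet_derivative_unique_within_closed_interval[OF _ p(1) has_derivative_at_withinI[OF D]]
    by (simp add: inner_sum_Basis)
  moreover have "chart_rank_le r F p" using assms(1)[of p] unfolding good_def by auto
  ultimately show "dim (range D) \<le> r"
    using chart_rank_leD[of r F p U \<phi> D'] D' p(2) \<open>F p \<in> U\<close> by simp
qed

text \<open>A map that is constant along the normal directions near the faces of the cube extends smoothly
  to the whole space by clamping the coordinates: near each point the clamping map may be replaced
  by an affine one which freezes the coordinates outside the open interval.\<close>

lemma good_clamp:
  fixes F :: "'a::euclidean_space \<Rightarrow> 'm"
  assumes sm: "smooth_cube A (cbox 0 One) F" and rk: "rank_le A (cbox 0 One) F r"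
    and e: "0 < e" "e < 1/2" and F: "\<And>p. p \<in> cbox 0 One \<Longrightarrow> F p = F (clamp_vec e p)"
  shows "good r (\<lambda>q. F (clamp_vec 0 q)) p"
proof -
  let ?K = "cbox 0 One :: 'a set"
  let ?F = "\<lambda>q. F (clamp_vec 0 q)"
  obtain W G where W: "open W" "?K \<subseteq> W" "mfld_smooth A W G" "\<forall>x\<in>?K. G x = F x"
    using sm unfolding smooth_cube_def by auto
  have FF: "?F q = F (clamp_vec e q)" for q
  proof -
    have "clamp_vec e (clamp_vec 0 q) = clamp_vec e q"
      by (rule euclidean_eqI) (use e in \<open>auto simp: clamp_vec_inner clamp_to_def\<close>)
    then show ?thesis using F[OF clamp_vec_mem] by simp
  qed
  have main: "\<exists>N c. open N \<and> p \<in> N \<and> smooth_on UNIV c \<and> c ` N \<subseteq> ?K \<and> (\<forall>q\<in>N. ?F q = F (c q))" for p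
  proof -
    define k where "k b = (if p \<bullet> b \<le> 0 then e else 1 - e)" for b
    define I where "I = {b \<in> Basis. 0 < p \<bullet> b \<and> p \<bullet> b < 1}"
    define c where "c q = (\<Sum>b\<in>Basis. if b \<in> I then (q \<bullet> b) *\<^sub>R b else k b *\<^sub>R b)" for q
    have [simp]: "finite I" by (simp add: I_def)
    have cb: "c q \<bullet> b = (if b \<in> I then q \<bullet> b else k b)" if "b \<in> Basis" for q b
    proof -
      have "c q = (\<Sum>b\<in>Basis. (if b \<in> I then q \<bullet> b else k b) *\<^sub>R b)"
        unfolding c_def by (rule sum.cong) auto
      then show ?thesis using that by simp
    qed
    define N where "N = (\<Inter>b\<in>Basis. {q. (if b \<in> I then 0 < q \<bullet> b \<and> q \<bullet> b < 1 else
        if p \<bullet> b \<le> 0 then q \<bullet> b < e else 1 - e < q \<bullet> b)})"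
    have "open {q. (if b \<in> I then 0 < q \<bullet> b \<and> q \<bullet> b < 1 else
        if p \<bullet> b \<le> 0 then q \<bullet> b < e else 1 - e < q \<bullet> b)}" for b
      by (cases "b \<in> I"; cases "p \<bullet> b \<le> 0")
        (auto intro!: open_Collect_conj open_Collect_less continuous_intros)
    then have "open N" unfolding N_def by (intro open_INT) auto
    moreover have "p \<in> N" using e by (auto simp: N_def I_def)
    moreover have "smooth_on UNIV c"
    proof -
      have "smooth_on UNIV (\<lambda>q. (if b \<in> I then (q \<bullet> b) *\<^sub>R b else k b *\<^sub>R b))" for b
        by (cases "b \<in> I") (auto intro!: smooth_on_const smooth_on_bounded_linear
            bounded_linear_scaleR_const bounded_linear_inner_left)
      then show ?thesis unfolding c_def smooth_on_def by (auto intro!: Ck_on_sum)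
    qed
    moreover have cK: "c q \<in> ?K" if "q \<in> N" for q
      unfolding cbox_One_iff
    proof
      fix b :: 'a assume b: "b \<in> Basis"
      show "0 \<le> c q \<bullet> b \<and> c q \<bullet> b \<le> 1"
        using that b e unfolding cb[OF b] N_def k_def by (auto split: if_splits)
    qed
    moreover have "?F q = F (c q)" if "q \<in> N" for q
    proof -
      have "clamp_vec e (c q) = clamp_vec e q"
      proof (rule euclidean_eqI)
        fix b :: 'a assume b: "b \<in> Basis"
        then have "if b \<in> I then 0 < q \<bullet> b \<and> q \<bullet> b < 1 else
            if p \<bullet> b \<le> 0 then q \<bullet> b < e else 1 - e < q \<bullet> b"
          using that by (auto simp: N_def)
        then show "clamp_vec e (c q) \<bullet> b = clamp_vec e q \<bullet> b"
          using e b unfolding clamp_vec_inner[OF b] cb[OF b] k_def clamp_to_def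
          by (auto split: if_splits)
      qed
      then show ?thesis using F[OF cK[OF that]] FF[of q] by simp
    qed
    ultimately show ?thesis by blast
  qed
  have smooth: "mfld_smooth A UNIV ?F"
  proof (rule mfld_smooth_local)
    fix p
    obtain N c where N: "open N" "p \<in> N" "smooth_on UNIV c" "c ` N \<subseteq> ?K" "\<forall>q\<in>N. ?F q = F (c q)"
      using main[of p] by blast
    have "mfld_smooth A N (G \<circ> c)"
      by (rule mfld_smooth_compose[OF W(3) smooth_on_subset[OF N(3)]]) (use N W in auto)
    moreover have "(G \<circ> c) q = ?F q" if "q \<in> N" for q
    proof -
      have "c q \<in> ?K" using N that by blast
      then show ?thesis using N W that by simp
    qed
    ultimately have "mfld_smooth A N ?F" using mfld_smooth_cong[OF N(1), of "G \<circ> c" ?F] by simp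
    then show "\<exists>N. open N \<and> p \<in> N \<and> mfld_smooth A N ?F" using N by blast
  qed
  \<comment> \<open>\<open>?F\<close> is itself one of the extensions over which
    \<open>rank_le\<close> quantifies, so on the cube its rank bound is the hypothesis.\<close>
  have rkK: "chart_rank_le r ?F q" if q: "q \<in> ?K" for q
  proof (rule chart_rank_leI)
    fix U \<phi> D assume c: "(U, \<phi>) \<in> A" "?F q \<in> U" and D: "((\<phi> \<circ> ?F) has_derivative D) (at q)"
    have "F q \<in> U" using c(2) clamp_vec_id[OF q] by simp
    then show "dim (range D) \<le> r"
      by (rule rank_leD[OF rk q c(1) _ open_UNIV subset_UNIV smooth _ D]) (simp add: clamp_vec_id)
  qed
  \<comment> \<open>Away from the cube, \<open>?F\<close> coincides near \<open>p\<close> with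
    \<open>?F \<circ> c\<close>, and \<open>c p\<close> lies in the cube.\<close>
  have "chart_rank_le r ?F p" for p
  proof -
    obtain N c where N: "open N" "p \<in> N" "smooth_on UNIV c" "c ` N \<subseteq> ?K" "\<forall>q\<in>N. ?F q = F (c q)"
      using main[of p] by blast
    then have "chart_rank_le r ?F (c p)" by (intro rkK) auto
    then have "chart_rank_le r (?F \<circ> c) p"
      by (intro chart_rank_le_compose[OF smooth N(3)]) auto
    moreover have "(?F \<circ> c) q = ?F q" if "q \<in> N" for q
    proof -
      have "c q \<in> ?K" using N that by blast
      then show ?thesis using N that by (simp add: clamp_vec_id)
    qed
    ultimately show ?thesis using chart_rank_le_cong[OF N(1,2), of "?F \<circ> c" ?F r] by simp
  qed
  then show ?thesis using smooth unfolding good_def by blast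
qed

end

section \<open>Extension of 2-paths and homotopies to the whole space\<close>

abbreviation unc2 :: "(real \<Rightarrow> real \<Rightarrow> 'm) \<Rightarrow> real \<times> real \<Rightarrow> 'm" where
  "unc2 H \<equiv> (\<lambda>p. H (fst p) (snd p))"

abbreviation unc3 :: "(real \<Rightarrow> real \<Rightarrow> real \<Rightarrow> 'm) \<Rightarrow> real \<times> real \<times> real \<Rightarrow> 'm" where
  "unc3 J \<equiv> (\<lambda>p. J (fst p) (fst (snd p)) (snd (snd p)))"

definition ext2 :: "(real \<Rightarrow> real \<Rightarrow> 'm) \<Rightarrow> real \<Rightarrow> real \<Rightarrow> 'm" where
  "ext2 G t s = G (clamp_to 0 t) (clamp_to 0 s)"

lemma ext2_unit: "t \<in> {0..1} \<Longrightarrow> s \<in> {0..1} \<Longrightarrow> ext2 G t s = G t s"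
  by (simp add: ext2_def)

definition collar :: "real \<Rightarrow> (real \<Rightarrow> 'm) \<Rightarrow> bool" where
  "collar e f \<longleftrightarrow> (\<forall>t\<in>{0..1}. (t \<le> e \<longrightarrow> f t = f 0) \<and> (t \<ge> 1 - e \<longrightarrow> f t = f 1))"

lemma collarI:
  "(\<And>t. t \<in> {0..1} \<Longrightarrow> t \<le> e \<Longrightarrow> f t = f 0) \<Longrightarrow> (\<And>t. t \<in> {0..1} \<Longrightarrow> t \<ge> 1 - e \<Longrightarrow> f t = f 1)
    \<Longrightarrow> collar e f"
  and collar_left: "collar e f \<Longrightarrow> t \<in> {0..1} \<Longrightarrow> t \<le> e \<Longrightarrow> f t = f 0"
  and collar_right: "collar e f \<Longrightarrow> t \<in> {0..1} \<Longrightarrow> t \<ge> 1 - e \<Longrightarrow> f t = f 1"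
  unfolding collar_def by blast+

lemma collar_clamp:
  assumes "collar e f" "0 < e" "e < 1/2" "t \<in> {0..1}"
  shows "f (clamp_to e t) = f t"
proof -
  consider "t \<le> e" | "t \<ge> 1 - e" | "e < t" "t < 1 - e" by linarith
  then show ?thesis
  proof cases
    case 1
    then have "clamp_to e t = e" using assms by (simp add: clamp_to_def)
    moreover have "f t = f 0" "f e = f 0"
      by (rule collar_left[OF assms(1)]; use assms 1 in simp)+
    ultimately show ?thesis by simp
  next
    case 2
    then have "clamp_to e t = 1 - e" using assms by (simp add: clamp_to_def)
    moreover have "f t = f 1" "f (1 - e) = f 1"
      by (rule collar_right[OF assms(1)]; use assms 2 in simp)+
    ultimately show ?thesis by simp
  qed (use assms in \<open>simp add: clamp_to_def\<close>)
qed

lemma collar_ext: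
  assumes "collar e f" "0 \<le> e"
  shows "u \<le> e \<Longrightarrow> f (clamp_to 0 u) = f 0" and "u \<ge> 1 - e \<Longrightarrow> f (clamp_to 0 u) = f 1"
proof -
  have "clamp_to 0 u \<le> e" if "u \<le> e" using that assms(2) by (auto simp: clamp_to_def)
  then show "u \<le> e \<Longrightarrow> f (clamp_to 0 u) = f 0" by (rule collar_left[OF assms(1) clamp_to_unit(1)])
  have "clamp_to 0 u \<ge> 1 - e" if "u \<ge> 1 - e" using that assms(2) by (auto simp: clamp_to_def)
  then show "u \<ge> 1 - e \<Longrightarrow> f (clamp_to 0 u) = f 1" by (rule collar_right[OF assms(1) clamp_to_unit(1)])
qed

text \<open>A 2-path carries no rank condition; the dimension of the plane supplies the bound 2 with
  which it enters the clamping argument.\<close>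

lemma rank_le_DIM:
  fixes F :: "'a::euclidean_space \<Rightarrow> 'm::topological_space"
  shows "rank_le A K F (DIM('a))"
proof -
  have "dim (range D) \<le> DIM('a)" if "(f has_derivative D) (at p)" for f D and p :: 'a
    using dim_image_le[OF has_derivative_linear[OF that], of UNIV] by simp
  then show ?thesis unfolding rank_le_def by blast
qed

context charted begin

lemma good_clamp2:
  assumes "smooth_cube A unit_sq (unc2 H)" "rank_le A unit_sq (unc2 H) r" "0 < e" "e < 1/2"
    and c: "\<And>s. s \<in> {0..1} \<Longrightarrow> collar e (\<lambda>t. H t s)" "\<And>t. t \<in> {0..1} \<Longrightarrow> collar e (\<lambda>s. H t s)"
  shows "good r (unc2 (ext2 H)) p"
proof -
  have "unc2 H p = unc2 H (clamp_vec e p)" if "p \<in> cbox 0 One" for p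
  proof -
    obtain t s where "p = (t, s)" by force
    moreover have "t \<in> {0..1}" "s \<in> {0..1}"
      using that mem_unit_sq[of t s] calculation unfolding unit_sq_eq by auto
    ultimately have p: "p = (t, s)" "t \<in> {0..1}" "s \<in> {0..1}" by auto
    have "clamp_to e t \<in> {0..1}" using assms(3,4) by (auto simp: clamp_to_def)
    then show ?thesis
      using collar_clamp[OF c(1) assms(3,4), of s t] collar_clamp[OF c(2) assms(3,4), of "clamp_to e t" s] p
      by (simp add: clamp_vec_Pair clamp_vec_real)
  qed
  then have "good r (\<lambda>q. unc2 H (clamp_vec 0 q)) p"
    using assms(1-4) unfolding unit_sq_eq by (intro good_clamp) auto
  moreover have "unc2 H (clamp_vec 0 q) = unc2 (ext2 H) q" for q
    by (cases q) (simp add: clamp_vec_Pair clamp_vec_real ext2_def)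
  ultimately show ?thesis by simp
qed

lemma good_clamp3:
  assumes "smooth_cube A unit_cube3 (unc3 J)" "rank_le A unit_cube3 (unc3 J) k" "0 < e" "e < 1/2"
    and c: "\<And>s r. s \<in> {0..1} \<Longrightarrow> r \<in> {0..1} \<Longrightarrow> collar e (\<lambda>t. J t s r)"
      "\<And>t r. t \<in> {0..1} \<Longrightarrow> r \<in> {0..1} \<Longrightarrow> collar e (\<lambda>s. J t s r)"
      "\<And>t s. t \<in> {0..1} \<Longrightarrow> s \<in> {0..1} \<Longrightarrow> collar e (\<lambda>r. J t s r)"
  shows "good k (unc3 (\<lambda>t s r. J (clamp_to 0 t) (clamp_to 0 s) (clamp_to 0 r))) p"
proof -
  have "unc3 J p = unc3 J (clamp_vec e p)" if "p \<in> cbox 0 One" for p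
  proof -
    obtain t s r where "p = (t, s, r)" using prod_cases3 by blast
    moreover have "t \<in> {0..1}" "s \<in> {0..1}" "r \<in> {0..1}"
      using that mem_unit_cube3[of t s r] calculation unfolding unit_cube3_eq by auto
    ultimately have p: "p = (t, s, r)" "t \<in> {0..1}" "s \<in> {0..1}" "r \<in> {0..1}" by auto
    have "clamp_to e t \<in> {0..1}" "clamp_to e s \<in> {0..1}" using assms(3,4) by (auto simp: clamp_to_def)
    then show ?thesis
      using collar_clamp[OF c(1) assms(3,4), of s r t]
        collar_clamp[OF c(2) assms(3,4), of "clamp_to e t" r s]
        collar_clamp[OF c(3) assms(3,4), of "clamp_to e t" "clamp_to e s" r] p
      by (simp add: clamp_vec_Pair clamp_vec_real)
  qed
  then have "good k (\<lambda>q. unc3 J (clamp_vec 0 q)) p"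
    using assms(1-4) unfolding unit_cube3_eq by (intro good_clamp) auto
  moreover have "unc3 J (clamp_vec 0 q) = unc3 (\<lambda>t s r. J (clamp_to 0 t) (clamp_to 0 s) (clamp_to 0 r)) q" for q
    by (cases q) (simp add: clamp_vec_Pair clamp_vec_real)
  ultimately show ?thesis by simp
qed

text \<open>For fixed \<open>c\<close> the map \<open>\<lambda>t. G t c\<close> lives on the line,
  so its rank is at most 1 by dimension, and substituting \<open>f\<close> for \<open>t\<close>
  preserves this.\<close>

lemma good_edge:
  assumes "\<And>p. good r (unc2 G) p" "smooth_on UNIV f"
  shows "good 1 (\<lambda>p. G (f p) c) p"
proof -
  have "good r (\<lambda>t. unc2 G (t, c)) q" for q :: real
    by (rule good_compose[OF assms(1)]) (intro smooth_intros)
  then have "good 1 (\<lambda>t. G t c) q" for q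
    using good_DIM[of r "\<lambda>t. G t c" q 1] by simp
  then show ?thesis by (rule good_compose[OF _ assms(2)])
qed

section \<open>Rank conditions on homotopies and their edges\<close>

text \<open>The last two conditions say that \<open>J\<close> restricts to rank-1 homotopies of the lower and upper edges.\<close>

definition hgood :: "(real \<Rightarrow> real \<Rightarrow> real \<Rightarrow> 'm) \<Rightarrow> bool" where
  "hgood J \<longleftrightarrow> (\<forall>p. good 2 (unc3 J) p) \<and> (\<forall>p. good 1 (unc2 (\<lambda>t r. J t 0 r)) p)
     \<and> (\<forall>p. good 1 (unc2 (\<lambda>t r. J t 1 r)) p)"

lemma hgoodI:
  assumes "\<And>p. good 2 (unc3 J) p" "\<And>c p. c = 0 \<or> c = 1 \<Longrightarrow> good 1 (unc2 (\<lambda>t r. J t c r)) p"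
  shows "hgood J"
  using assms unfolding hgood_def by blast

lemma hgoodD:
  assumes "hgood J"
  shows "good 2 (unc3 J) p" "c = 0 \<or> c = 1 \<Longrightarrow> good 1 (unc2 (\<lambda>t r. J t c r)) q"
  using assms unfolding hgood_def by blast+

text \<open>The inclusion of the face \<open>s = c\<close> into 3-space is continuous, so a
  neighbourhood on which \<open>J\<close> agrees with some \<open>K\<close> restricts to a
  neighbourhood in the face; the edge conditions are thus inherited together with the spatial
  one.\<close>

lemma hgood_local:
  assumes "\<And>p. \<exists>K. hgood K \<and> (\<forall>\<^sub>F q in nhds p. unc3 K q = unc3 J q)"
  shows "hgood J"
proof -
  have "good 2 (unc3 J) p" for p
  proof -
    obtain K where K: "hgood K" "\<forall>\<^sub>F q in nhds p. unc3 K q = unc3 J q" using assms by blast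
    then have "good 2 (unc3 K) p" by (blast intro: hgoodD)
    then show ?thesis using K(2) by (rule good_cong)
  qed
  moreover have "good 1 (unc2 (\<lambda>t r. J t c r)) p" if c: "c = 0 \<or> c = 1" for c p
  proof -
    obtain K where K: "hgood K" "\<forall>\<^sub>F q in nhds (fst p, c, snd p). unc3 K q = unc3 J q" using assms by blast
    have "((\<lambda>q. (fst q, c, snd q)) \<longlongrightarrow> (fst p, c, snd p)) (nhds p)"
      by (intro tendsto_Pair tendsto_fst tendsto_snd tendsto_const filterlim_ident)
    from eventually_compose_filterlim[OF K(2) this]
    have "\<forall>\<^sub>F q in nhds p. unc2 (\<lambda>t r. K t c r) q = unc2 (\<lambda>t r. J t c r) q" by simp
    moreover have "good 1 (unc2 (\<lambda>t r. K t c r)) p" by (rule hgoodD(2)[OF K(1) c])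
    ultimately show ?thesis by (rule good_cong[rotated])
  qed
  ultimately show ?thesis by (rule hgoodI)
qed

text \<open>A substitution that leaves \<open>s\<close> alone maps each of the two edge faces to
  itself, so all three rank bounds survive precomposition.\<close>

lemma hgood_tr:
  assumes "hgood J" "smooth_on UNIV (unc2 l)" "smooth_on UNIV m"
  shows "hgood (\<lambda>t s r. J (l t r) s (m r))"
proof -
  have l: "smooth_on UNIV (\<lambda>p. l (f p) (g p))" if "smooth_on UNIV f" "smooth_on UNIV g"
    for f g :: "'c::euclidean_space \<Rightarrow> real"
    using smooth_on_compose[OF smooth_on_Pair[OF that] assms(2)] by (simp add: o_def)
  have m: "smooth_on UNIV (\<lambda>p. m (f p))" if "smooth_on UNIV f" for f :: "'c::euclidean_space \<Rightarrow> real"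
    using smooth_on_compose[OF that assms(3)] by (simp add: o_def)
  have "good 2 (unc3 (\<lambda>t s r. J (l t r) s (m r))) p" for p
    using good_compose[of 2 "unc3 J" "\<lambda>p. (l (fst p) (snd (snd p)), fst (snd p), m (snd (snd p)))" p]
      hgoodD(1)[OF assms(1)] by (simp add: smooth_intros l m)
  moreover have "good 1 (unc2 (\<lambda>t r. J (l t r) c (m r))) p" if "c = 0 \<or> c = 1" for c p
  proof -
    have "good 1 (unc2 (\<lambda>t r. J t c r)) (l (fst p) (snd p), m (snd p))"
      by (rule hgoodD(2)[OF assms(1) that])
    then show ?thesis
      using good_compose[of 1 "unc2 (\<lambda>t r. J t c r)" "\<lambda>p. (l (fst p) (snd p), m (snd p))" p]
      by (simp add: smooth_intros l m)
  qed
  ultimately show ?thesis by (rule hgoodI)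
qed

text \<open>When \<open>s\<close> moves with \<open>r\<close>, an edge may pass through regions
  where \<open>G\<close> has rank 2. The edge bounds are therefore hypotheses here, while the bound
  2 comes from factoring through the plane.\<close>

lemma hgood_s:
  assumes G: "\<And>p. good k (unc2 G) p" and l: "smooth_on UNIV (unc2 l)"
    and edge: "\<And>p. good 1 (unc2 (\<lambda>t r. G t (l 0 r))) p" "\<And>p. good 1 (unc2 (\<lambda>t r. G t (l 1 r))) p"
  shows "hgood (\<lambda>t s r. G t (l s r))"
proof -
  have "smooth_on UNIV (\<lambda>p :: real \<times> real \<times> real. (fst p, l (fst (snd p)) (snd (snd p))))"
    using smooth_on_compose[OF _ l, of UNIV snd] by (intro smooth_intros) (simp add: o_def smooth_intros)
  from good_compose[OF good_DIM[OF G] this]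
  have "good 2 (unc3 (\<lambda>t s r. G t (l s r))) p" for p by simp
  then show ?thesis using edge unfolding hgood_def by blast
qed

lemma hgood_path:
  assumes "\<And>p. good k (unc2 G) p"
  shows "hgood (\<lambda>t s r. G t s)"
proof (rule hgood_s[OF assms])
  show "good 1 (unc2 (\<lambda>t r. G t c)) p" for c p
    by (rule good_edge[OF assms]) (intro smooth_intros)
  then show "good 1 (unc2 (\<lambda>t r. G t c)) p" for c p .
qed (intro smooth_intros)

lemma hgood_flip:
  assumes "hgood J"
  shows "hgood (\<lambda>t s r. J t (1 - s) r)"
proof -
  have "smooth_on UNIV (\<lambda>p :: real \<times> real \<times> real. (fst p, 1 - fst (snd p), snd (snd p)))"
    by (intro smooth_intros)
  from good_compose[OF hgoodD(1)[OF assms] this]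
  have "good 2 (unc3 (\<lambda>t s r. J t (1 - s) r)) p" for p by simp
  moreover have "good 1 (unc2 (\<lambda>t r. J t (1 - c) r)) p" if "c = 0 \<or> c = 1" for c p
    by (rule hgoodD(2)[OF assms]) (use that in auto)
  ultimately show ?thesis by (rule hgoodI)
qed

section \<open>Globally extended 2-paths and homotopies with explicit collars\<close>

definition gpath2 :: "real \<Rightarrow> 'm \<Rightarrow> 'm \<Rightarrow> (real \<Rightarrow> real \<Rightarrow> 'm) \<Rightarrow> bool" where
  "gpath2 e a b G \<longleftrightarrow> 0 < e \<and> e < 1/2 \<and> (\<forall>p. good 2 (unc2 G) p) \<and>
     (\<forall>t s. (t \<le> e \<longrightarrow> G t s = a) \<and> (t \<ge> 1 - e \<longrightarrow> G t s = b) \<and>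
            (s \<le> e \<longrightarrow> G t s = G t 0) \<and> (s \<ge> 1 - e \<longrightarrow> G t s = G t 1))"

lemma gpath2I:
  assumes "0 < e" "e < 1/2" "\<And>p. good 2 (unc2 G) p"
    "\<And>t s. t \<le> e \<Longrightarrow> G t s = a" "\<And>t s. t \<ge> 1 - e \<Longrightarrow> G t s = b"
    "\<And>t s. s \<le> e \<Longrightarrow> G t s = G t 0" "\<And>t s. s \<ge> 1 - e \<Longrightarrow> G t s = G t 1"
  shows "gpath2 e a b G"
  using assms unfolding gpath2_def by blast

lemma gpath2D:
  assumes "gpath2 e a b G"
  shows "0 < e" "e < 1/2" "good 2 (unc2 G) p"
    "t \<le> e \<Longrightarrow> G t s = a" "t \<ge> 1 - e \<Longrightarrow> G t s = b"
    "s \<le> e \<Longrightarrow> G t s = G t 0" "s \<ge> 1 - e \<Longrightarrow> G t s = G t 1"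
  using assms unfolding gpath2_def by blast+

lemma gpath2_mono:
  assumes "gpath2 e a b G" "0 < d" "d \<le> e"
  shows "gpath2 d a b G"
  by (rule gpath2I; (rule gpath2D[OF assms(1)])?; use gpath2D(1,2)[OF assms(1)] assms(2,3) in simp)

lemma path2_collars:
  assumes "path2 A G"
  obtains e where "0 < e" "e < 1/2" "\<And>s. s \<in> {0..1} \<Longrightarrow> collar e (\<lambda>t. G t s)"
    "\<And>t. t \<in> {0..1} \<Longrightarrow> collar e (\<lambda>s. G t s)"
    "\<And>s. s \<in> {0..1} \<Longrightarrow> G 0 s = G 0 0" "\<And>s. s \<in> {0..1} \<Longrightarrow> G 1 s = G 1 0"
proof -
  obtain e where e: "e > 0" "\<And>t s. t \<in> {0..1} \<Longrightarrow> s \<in> {0..1} \<Longrightarrow>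
        (t \<le> e \<longrightarrow> G t s = G 0 0) \<and> (t \<ge> 1 - e \<longrightarrow> G t s = G 1 0) \<and>
        (s \<le> e \<longrightarrow> G t s = G t 0) \<and> (s \<ge> 1 - e \<longrightarrow> G t s = G t 1)"
    using assms unfolding path2_def by blast
  have 0: "G 0 s = G 0 0" "G 1 s = G 1 0" if "s \<in> {0..1}" for s
    using e(2)[of 0 s] e(2)[of 1 s] e(1) that by simp_all
  \<comment> \<open>The cap 1/3 keeps the width below 1/2, so that the interval onto which
    \<open>clamp_to d\<close> retracts is nondegenerate.\<close>
  define d where "d = min e (1/3)"
  have d: "t \<le> e" if "t \<le> d" for t using that by (simp add: d_def)
  have d': "t \<ge> 1 - e" if "t \<ge> 1 - d" for t using that by (simp add: d_def)
  show ?thesis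
  proof (rule that[of d])
    show "0 < d" "d < 1/2" using e(1) by (auto simp: d_def)
    show "collar d (\<lambda>t. G t s)" if "s \<in> {0..1}" for s
    proof (rule collarI)
      show "G t s = G 0 s" if "t \<in> {0..1}" "t \<le> d" for t
        using e(2)[OF that(1) \<open>s \<in> {0..1}\<close>] 0(1)[OF \<open>s \<in> {0..1}\<close>] d that by metis
      show "G t s = G 1 s" if "t \<in> {0..1}" "t \<ge> 1 - d" for t
        using e(2)[OF that(1) \<open>s \<in> {0..1}\<close>] 0(2)[OF \<open>s \<in> {0..1}\<close>] d' that by metis
    qed
    show "collar d (\<lambda>s. G t s)" if "t \<in> {0..1}" for t
      by (rule collarI) (use e(2)[OF that] d d' in blast)+
  qed (use 0 in blast)+
qed

lemma path2E:
  assumes "path2 A G"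
  obtains e where "gpath2 e (G 0 0) (G 1 0) (ext2 G)"
proof -
  obtain e where e: "0 < e" "e < 1/2" and c: "\<And>s. s \<in> {0..1} \<Longrightarrow> collar e (\<lambda>t. G t s)"
    "\<And>t. t \<in> {0..1} \<Longrightarrow> collar e (\<lambda>s. G t s)"
    and 0: "\<And>s. s \<in> {0..1} \<Longrightarrow> G 0 s = G 0 0" "\<And>s. s \<in> {0..1} \<Longrightarrow> G 1 s = G 1 0"
    using path2_collars[OF assms] by metis
  have "rank_le A unit_sq (unc2 G) 2" using rank_le_DIM[of A unit_sq "unc2 G"] by (simp add: numeral_2_eq_2)
  then have "good 2 (unc2 (ext2 G)) p" for p
    using assms e c unfolding path2_def by (intro good_clamp2) auto
  moreover have "t \<le> e \<Longrightarrow> ext2 G t s = G 0 0" "t \<ge> 1 - e \<Longrightarrow> ext2 G t s = G 1 0" for t s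
    using collar_ext[OF c(1), of "clamp_to 0 s" t] 0[of "clamp_to 0 s"] e by (simp_all add: ext2_def)
  moreover have "s \<le> e \<Longrightarrow> ext2 G t s = ext2 G t 0" "s \<ge> 1 - e \<Longrightarrow> ext2 G t s = ext2 G t 1" for t s
    using collar_ext[OF c(2), of "clamp_to 0 t" s] e by (simp_all add: ext2_def)
  ultimately show ?thesis using e by (intro that[of e] gpath2I) blast+
qed

lemma path2I:
  assumes good: "\<And>p. good k (unc2 H) p" and d: "0 < d"
    and eq: "\<And>t s. t \<in> {0..1} \<Longrightarrow> s \<in> {0..1} \<Longrightarrow> G t s = H t s"
    and H: "\<And>t s. t \<in> {0..1} \<Longrightarrow> s \<in> {0..1} \<Longrightarrow> t \<le> d \<Longrightarrow> H t s = a"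
      "\<And>t s. t \<in> {0..1} \<Longrightarrow> s \<in> {0..1} \<Longrightarrow> t \<ge> 1 - d \<Longrightarrow> H t s = b"
      "\<And>t s. t \<in> {0..1} \<Longrightarrow> s \<in> {0..1} \<Longrightarrow> s \<le> d \<Longrightarrow> H t s = H t 0"
      "\<And>t s. t \<in> {0..1} \<Longrightarrow> s \<in> {0..1} \<Longrightarrow> s \<ge> 1 - d \<Longrightarrow> H t s = H t 1"
  shows "path2 A G"
  unfolding path2_def
proof
  show "smooth_cube A unit_sq (unc2 G)"
    by (rule smooth_cube_good[OF good]) (use eq in \<open>auto simp del: cbox_Pair_eq\<close>)
  have "0 \<in> {0..1::real}" "1 \<in> {0..1::real}" by auto
  then have 0: "G 0 0 = a" "G 1 0 = b"
    using eq[of 0 0] eq[of 1 0] H(1)[of 0 0] H(2)[of 1 0] d by simp_all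
  show "\<exists>\<epsilon>>0. \<forall>t\<in>{0..1}. \<forall>s\<in>{0..1}.
        (t \<le> \<epsilon> \<longrightarrow> G t s = G 0 0) \<and> (t \<ge> 1 - \<epsilon> \<longrightarrow> G t s = G 1 0) \<and>
        (s \<le> \<epsilon> \<longrightarrow> G t s = G t 0) \<and> (s \<ge> 1 - \<epsilon> \<longrightarrow> G t s = G t 1)"
  proof (intro exI[of _ d] conjI ballI impI d)
    fix t s :: real assume ts: "t \<in> {0..1}" "s \<in> {0..1}"
    have *: "G t s = H t s" "G t 0 = H t 0" "G t 1 = H t 1" using eq ts by simp_all
    show "G t s = G 0 0" if "t \<le> d" unfolding 0 * by (rule H(1)[OF ts that])
    show "G t s = G 1 0" if "t \<ge> 1 - d" unfolding 0 * by (rule H(2)[OF ts that])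
    show "G t s = G t 0" if "s \<le> d" unfolding * by (rule H(3)[OF ts that])
    show "G t s = G t 1" if "s \<ge> 1 - d" unfolding * by (rule H(4)[OF ts that])
  qed
qed

lemma path2_gpath2:
  assumes "gpath2 e a b H" "\<And>t s. t \<in> {0..1} \<Longrightarrow> s \<in> {0..1} \<Longrightarrow> G t s = H t s"
  shows "path2 A G"
  by (rule path2I[OF gpath2D(3)[OF assms(1)] gpath2D(1)[OF assms(1)] assms(2)])
    (assumption | rule gpath2D(4-)[OF assms(1)])+

definition ghtpy :: "real \<Rightarrow> 'm \<Rightarrow> 'm \<Rightarrow> (real \<Rightarrow> real \<Rightarrow> real \<Rightarrow> 'm) \<Rightarrow> bool" where
  "ghtpy e a b J \<longleftrightarrow> 0 < e \<and> e < 1/2 \<and> hgood J \<and>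
     (\<forall>t s r. (t \<le> e \<longrightarrow> J t s r = a) \<and> (t \<ge> 1 - e \<longrightarrow> J t s r = b) \<and>
            (s \<le> e \<longrightarrow> J t s r = J t 0 r) \<and> (s \<ge> 1 - e \<longrightarrow> J t s r = J t 1 r) \<and>
            (r \<le> e \<longrightarrow> J t s r = J t s 0) \<and> (r \<ge> 1 - e \<longrightarrow> J t s r = J t s 1))"

lemma ghtpyI:
  assumes "0 < e" "e < 1/2" "hgood J"
    "\<And>t s r. t \<le> e \<Longrightarrow> J t s r = a" "\<And>t s r. t \<ge> 1 - e \<Longrightarrow> J t s r = b"
    "\<And>t s r. s \<le> e \<Longrightarrow> J t s r = J t 0 r" "\<And>t s r. s \<ge> 1 - e \<Longrightarrow> J t s r = J t 1 r"
    "\<And>t s r. r \<le> e \<Longrightarrow> J t s r = J t s 0" "\<And>t s r. r \<ge> 1 - e \<Longrightarrow> J t s r = J t s 1"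
  shows "ghtpy e a b J"
  using assms unfolding ghtpy_def by blast

lemma ghtpyD:
  assumes "ghtpy e a b J"
  shows "0 < e" "e < 1/2" "hgood J"
    "t \<le> e \<Longrightarrow> J t s r = a" "t \<ge> 1 - e \<Longrightarrow> J t s r = b"
    "s \<le> e \<Longrightarrow> J t s r = J t 0 r" "s \<ge> 1 - e \<Longrightarrow> J t s r = J t 1 r"
    "r \<le> e \<Longrightarrow> J t s r = J t s 0" "r \<ge> 1 - e \<Longrightarrow> J t s r = J t s 1"
  using assms unfolding ghtpy_def by blast+

lemma ghtpy_mono:
  assumes "ghtpy e a b J" "0 < d" "d \<le> e"
  shows "ghtpy d a b J"
  by (rule ghtpyI; (rule ghtpyD[OF assms(1)])?; use ghtpyD(1,2)[OF assms(1)] assms(2,3) in simp)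

lemma rank2_htpcE:
  assumes "rank2_htpc A G G'"
  obtains e J where "ghtpy e (G 0 0) (G 1 0) J"
    "\<And>t s. J t s 0 = ext2 G t s" "\<And>t s. J t s 1 = ext2 G' t s"
proof -
  from assms obtain J e where J0: "smooth_cube A unit_cube3 (unc3 J)"
    "\<forall>t\<in>{0..1}. \<forall>s\<in>{0..1}. J t s 0 = G t s \<and> J t s 1 = G' t s"
    "\<forall>s\<in>{0..1}. \<forall>r\<in>{0..1}. J 0 s r = J 0 0 0 \<and> J 1 s r = J 1 0 0"
    and edge: "rank1_htpy_via A (\<lambda>t r. J t 0 r) (\<lambda>t. G t 0) (\<lambda>t. G' t 0)"
      "rank1_htpy_via A (\<lambda>t r. J t 1 r) (\<lambda>t. G t 1) (\<lambda>t. G' t 1)"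
    and e: "e > 0" and coll: "\<forall>t\<in>{0..1}. \<forall>s\<in>{0..1}. \<forall>r\<in>{0..1}.
           (t \<le> e \<longrightarrow> J t s r = J 0 s r) \<and> (t \<ge> 1 - e \<longrightarrow> J t s r = J 1 s r) \<and>
           (s \<le> e \<longrightarrow> J t s r = J t 0 r) \<and> (s \<ge> 1 - e \<longrightarrow> J t s r = J t 1 r) \<and>
           (r \<le> e \<longrightarrow> J t s r = J t s 0) \<and> (r \<ge> 1 - e \<longrightarrow> J t s r = J t s 1)"
    and rk: "rank_le A unit_cube3 (unc3 J) 2"
    unfolding rank2_htpc_def by (elim conjE exE) (rule that)
  have coll: "(t \<le> e \<longrightarrow> J t s r = J 0 s r) \<and> (t \<ge> 1 - e \<longrightarrow> J t s r = J 1 s r) \<and>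
           (s \<le> e \<longrightarrow> J t s r = J t 0 r) \<and> (s \<ge> 1 - e \<longrightarrow> J t s r = J t 1 r) \<and>
           (r \<le> e \<longrightarrow> J t s r = J t s 0) \<and> (r \<ge> 1 - e \<longrightarrow> J t s r = J t s 1)"
    if "t \<in> {0..1}" "s \<in> {0..1}" "r \<in> {0..1}" for t s r
    by (rule coll[THEN bspec, OF that(1), THEN bspec, OF that(2), THEN bspec, OF that(3)])
  note e0 = e coll
  have J: "smooth_cube A unit_cube3 (unc3 J)"
    "\<And>t s. t \<in> {0..1} \<Longrightarrow> s \<in> {0..1} \<Longrightarrow> J t s 0 = G t s \<and> J t s 1 = G' t s"
    "\<And>s r. s \<in> {0..1} \<Longrightarrow> r \<in> {0..1} \<Longrightarrow> J 0 s r = J 0 0 0 \<and> J 1 s r = J 1 0 0"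
    using J0 by blast+
  define d where "d = min e (1/3)"
  have d: "0 < d" "d < 1/2" using e0(1) by (auto simp: d_def)
  have dd: "t \<le> d \<Longrightarrow> t \<le> e" "t \<ge> 1 - d \<Longrightarrow> t \<ge> 1 - e" for t by (simp_all add: d_def)
  have c: "collar d (\<lambda>t. J t s r)" if "s \<in> {0..1}" "r \<in> {0..1}" for s r
    by (rule collarI) (use e0(2)[OF _ that] dd in blast)+
  have c': "collar d (\<lambda>s. J t s r)" if "t \<in> {0..1}" "r \<in> {0..1}" for t r
    by (rule collarI) (use e0(2)[OF that(1) _ that(2)] dd in blast)+
  have c'': "collar d (\<lambda>r. J t s r)" if "t \<in> {0..1}" "s \<in> {0..1}" for t s
    by (rule collarI) (use e0(2)[OF that] dd in blast)+
  let ?c = "clamp_to 0"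
  let ?J = "\<lambda>t s r. J (?c t) (?c s) (?c r)"
  have "good 2 (unc3 ?J) p" for p by (rule good_clamp3[OF J(1) rk d c c' c''])
  \<comment> \<open>The edge homotopies inherit their collars from \<open>J\<close>, so they can be
    clamped with the same width \<open>d\<close> as the cube.\<close>
  moreover have "good 1 (unc2 (\<lambda>t r. J (?c t) 0 (?c r))) p" for p
    using good_clamp2[OF _ _ d, of "\<lambda>t r. J t 0 r" 1 p] edge(1) c c''
    unfolding rank1_htpy_via_def path2_def by (simp add: ext2_def)
  moreover have "good 1 (unc2 (\<lambda>t r. J (?c t) 1 (?c r))) p" for p
    using good_clamp2[OF _ _ d, of "\<lambda>t r. J t 1 r" 1 p] edge(2) c c''
    unfolding rank1_htpy_via_def path2_def by (simp add: ext2_def)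
  ultimately have "hgood ?J" unfolding hgood_def by simp
  moreover have "t \<le> d \<Longrightarrow> ?J t s r = G 0 0" "t \<ge> 1 - d \<Longrightarrow> ?J t s r = G 1 0" for t s r
    using collar_ext[OF c, of "?c s" "?c r" t] J(3)[of "?c s" "?c r"] J(2)[of 0 0] J(2)[of 1 0] d
    by simp_all
  moreover have "s \<le> d \<Longrightarrow> ?J t s r = ?J t 0 r" "s \<ge> 1 - d \<Longrightarrow> ?J t s r = ?J t 1 r" for t s r
    using collar_ext[OF c', of "?c t" "?c r" s] d by simp_all
  moreover have "r \<le> d \<Longrightarrow> ?J t s r = ?J t s 0" "r \<ge> 1 - d \<Longrightarrow> ?J t s r = ?J t s 1" for t s r
    using collar_ext[OF c'', of "?c t" "?c s" r] d by simp_all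
  ultimately have "ghtpy d (G 0 0) (G 1 0) ?J" using d by (intro ghtpyI) blast+
  then show ?thesis by (rule that) (use J(2) in \<open>simp_all add: ext2_def\<close>)
qed

text \<open>The parameter of the homotopy is reparametrized by \<open>smooth_step\<close>, so that \<open>J\<close> need not be
  independent of it near the ends.\<close>

lemma rank2_htpcI:
  assumes good: "hgood (\<lambda>t s r. J t s (smooth_step r))" and d: "0 < d"
    and G: "\<And>t s. t \<in> {0..1} \<Longrightarrow> s \<in> {0..1} \<Longrightarrow> G t s = J t s 0"
      "\<And>t s. t \<in> {0..1} \<Longrightarrow> s \<in> {0..1} \<Longrightarrow> G' t s = J t s 1"
    and J: "\<And>t s q. t \<in> {0..1} \<Longrightarrow> s \<in> {0..1} \<Longrightarrow> q \<in> {0..1} \<Longrightarrow> t \<le> d \<Longrightarrow> J t s q = a"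
      "\<And>t s q. t \<in> {0..1} \<Longrightarrow> s \<in> {0..1} \<Longrightarrow> q \<in> {0..1} \<Longrightarrow> t \<ge> 1 - d \<Longrightarrow> J t s q = b"
      "\<And>t s q. t \<in> {0..1} \<Longrightarrow> s \<in> {0..1} \<Longrightarrow> q \<in> {0..1} \<Longrightarrow> s \<le> d \<Longrightarrow> J t s q = J t 0 q"
      "\<And>t s q. t \<in> {0..1} \<Longrightarrow> s \<in> {0..1} \<Longrightarrow> q \<in> {0..1} \<Longrightarrow> s \<ge> 1 - d \<Longrightarrow> J t s q = J t 1 q"
  shows "rank2_htpc A G G'"
proof -
  let ?J = "\<lambda>t s r. J t s (smooth_step r)"
  \<comment> \<open>The cap 1/3 is the width on which \<open>smooth_step\<close> is constant at
    either end; it provides the collars in \<open>r\<close>.\<close>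
  define e where "e = min d (1/3)"
  have e: "0 < e" "e \<le> d" "e \<le> 1/3" using d by (auto simp: e_def)
  have q: "smooth_step r \<in> {0..1}" "r \<le> e \<Longrightarrow> smooth_step r = 0" "r \<ge> 1 - e \<Longrightarrow> smooth_step r = 1" for r
    using smooth_step_range[of r] smooth_step_0[of r] smooth_step_1[of r] e by auto
  have q01: "smooth_step 0 = 0" "smooth_step 1 = 1" by (simp_all add: smooth_step_0 smooth_step_1)
  have g3: "good 2 (unc3 ?J) p" for p by (rule hgoodD(1)[OF good])
  have edge: "good 1 (unc2 (\<lambda>t r. ?J t c r)) p" if "c = 0 \<or> c = 1" for c p
    by (rule hgoodD(2)[OF good that])
  have p: "path2 A H" if "\<And>t s. t \<in> {0..1} \<Longrightarrow> s \<in> {0..1} \<Longrightarrow> H t s = ?J t s c" for c H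
  proof (rule path2I[OF _ d that])
    have "good 2 (\<lambda>p. unc3 ?J (fst p, snd p, c)) p" for p :: "real \<times> real"
      by (rule good_compose[OF g3]) (intro smooth_intros)
    then show "good 2 (unc2 (\<lambda>t s. ?J t s c)) p" for p by simp
  qed (use q(1) in \<open>blast intro: J\<close>)+
  have via: "rank1_htpy_via A (\<lambda>t r. ?J t c r) (\<lambda>t. G t c) (\<lambda>t. G' t c)" if c: "c = 0 \<or> c = 1" for c
    unfolding rank1_htpy_via_def
  proof (intro conjI)
    show "path2 A (\<lambda>t r. ?J t c r)"
    proof (rule path2I[OF edge[OF c] e(1) refl, where a=a and b=b])
      have c: "c \<in> {0..1}" using c by auto
      show "?J t c r = a" if "t \<in> {0..1}" "t \<le> e" for t r
        by (rule J(1)) (use that c q(1) e in auto)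
      show "?J t c r = b" if "t \<in> {0..1}" "t \<ge> 1 - e" for t r
        by (rule J(2)) (use that c q(1) e in auto)
    qed (simp_all add: q q01)
    show "rank_le A unit_sq (unc2 (\<lambda>t r. ?J t c r)) 1"
      unfolding unit_sq_eq by (rule rank_le_good[OF edge[OF c]]) simp
    show "\<forall>t\<in>{0..1}. ?J t c 0 = G t c \<and> ?J t c 1 = G' t c" using G c by (auto simp: q01)
  qed
  show ?thesis
    unfolding rank2_htpc_def
  proof (intro conjI exI[of _ ?J])
    show "path2 A G" "path2 A G'" using p[of G 0] p[of G' 1] G by (simp_all add: q01)
    show "smooth_cube A unit_cube3 (unc3 ?J)" by (rule smooth_cube_good[OF g3]) simp
    show "rank_le A unit_cube3 (unc3 ?J) 2"
      unfolding unit_cube3_eq by (rule rank_le_good[OF g3]) simp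
    show "\<forall>t\<in>{0..1}. \<forall>s\<in>{0..1}. ?J t s 0 = G t s \<and> ?J t s 1 = G' t s" using G by (simp add: q01)
    show "\<forall>s\<in>{0..1}. \<forall>r\<in>{0..1}. ?J 0 s r = ?J 0 0 0 \<and> ?J 1 s r = ?J 1 0 0"
    proof (intro ballI conjI)
      fix s r :: real assume "s \<in> {0..1}"
      then show "?J 0 s r = ?J 0 0 0" "?J 1 s r = ?J 1 0 0"
        using J(1)[OF _ _ q(1), of 0 s r] J(1)[OF _ _ q(1), of 0 0 0]
          J(2)[OF _ _ q(1), of 1 s r] J(2)[OF _ _ q(1), of 1 0 0] d by simp_all
    qed
    show "rank1_htpy_via A (\<lambda>t r. ?J t 0 r) (\<lambda>t. G t 0) (\<lambda>t. G' t 0)"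
      "rank1_htpy_via A (\<lambda>t r. ?J t 1 r) (\<lambda>t. G t 1) (\<lambda>t. G' t 1)" by (rule via; simp)+
    have "(t \<le> e \<longrightarrow> ?J t s r = ?J 0 s r) \<and> (t \<ge> 1 - e \<longrightarrow> ?J t s r = ?J 1 s r) \<and>
           (s \<le> e \<longrightarrow> ?J t s r = ?J t 0 r) \<and> (s \<ge> 1 - e \<longrightarrow> ?J t s r = ?J t 1 r) \<and>
           (r \<le> e \<longrightarrow> ?J t s r = ?J t s 0) \<and> (r \<ge> 1 - e \<longrightarrow> ?J t s r = ?J t s 1)"
      if "t \<in> {0..1}" "s \<in> {0..1}" for t s r
    proof (intro conjI impI)
      note j = J(1)[OF _ that(2) q(1)] J(2)[OF _ that(2) q(1)]
      show "?J t s r = ?J 0 s r" if "t \<le> e"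
        using j(1)[of t r] j(1)[of 0 r] that \<open>t \<in> {0..1}\<close> e by simp
      show "?J t s r = ?J 1 s r" if "t \<ge> 1 - e"
        using j(2)[of t r] j(2)[of 1 r] that \<open>t \<in> {0..1}\<close> e by simp
      show "?J t s r = ?J t 0 r" if "s \<le> e" by (rule J(3)) (use that \<open>t \<in> _\<close> \<open>s \<in> _\<close> q(1) e in auto)
      show "?J t s r = ?J t 1 r" if "s \<ge> 1 - e" by (rule J(4)) (use that \<open>t \<in> _\<close> \<open>s \<in> _\<close> q(1) e in auto)
    qed (simp_all add: q q01)
    then show "\<exists>\<epsilon>>0. \<forall>t\<in>{0..1}. \<forall>s\<in>{0..1}. \<forall>r\<in>{0..1}.
           (t \<le> \<epsilon> \<longrightarrow> ?J t s r = ?J 0 s r) \<and> (t \<ge> 1 - \<epsilon> \<longrightarrow> ?J t s r = ?J 1 s r) \<and>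
           (s \<le> \<epsilon> \<longrightarrow> ?J t s r = ?J t 0 r) \<and> (s \<ge> 1 - \<epsilon> \<longrightarrow> ?J t s r = ?J t 1 r) \<and>
           (r \<le> \<epsilon> \<longrightarrow> ?J t s r = ?J t s 0) \<and> (r \<ge> 1 - \<epsilon> \<longrightarrow> ?J t s r = ?J t s 1)"
      using e(1) by blast
  qed
qed

end

section \<open>Rank-2 homotopy\<close>

lemma smooth_cube_compose:
  assumes "smooth_cube A K F" "smooth_on UNIV f" "f ` K' \<subseteq> K"
  shows "smooth_cube A K' (\<lambda>p. F (f p))"
proof -
  obtain W G where W: "open W" "K \<subseteq> W" "mfld_smooth A W G" "\<forall>x\<in>K. G x = F x"
    using assms(1) unfolding smooth_cube_def by blast
  have "open (f -` W)"
    using W(1) smooth_on_continuous[OF assms(2)] continuous_on_open_vimage[of UNIV f] by auto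
  moreover have "mfld_smooth A (f -` W) (G \<circ> f)"
    by (rule mfld_smooth_compose[OF W(3) smooth_on_subset[OF assms(2)]]) auto
  moreover have "K' \<subseteq> f -` W" "\<forall>p\<in>K'. (G \<circ> f) p = F (f p)" using assms(3) W by auto
  ultimately show ?thesis unfolding smooth_cube_def by blast
qed

lemma path2_idpath2:
  assumes "path1 A \<gamma>"
  shows "path2 A (idpath2 \<gamma>)"
proof -
  have "smooth_cube A unit_sq (\<lambda>p. \<gamma> (fst p))"
    by (rule smooth_cube_compose[where K = "{0..1}"])
      (use assms in \<open>auto simp: path1_def intro!: smooth_intros\<close>)
  moreover obtain e where "e > 0" "\<forall>t\<in>{0..1}. (t \<le> e \<longrightarrow> \<gamma> t = \<gamma> 0) \<and> (t \<ge> 1 - e \<longrightarrow> \<gamma> t = \<gamma> 1)"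
    using assms unfolding path1_def by blast
  ultimately show ?thesis unfolding path2_def idpath2_def by blast
qed

definition rev2 :: "(real \<Rightarrow> real \<Rightarrow> 'm) \<Rightarrow> real \<Rightarrow> real \<Rightarrow> 'm" where
  "rev2 G t s = G (1 - t) s"

definition flip2 :: "(real \<Rightarrow> real \<Rightarrow> 'm) \<Rightarrow> real \<Rightarrow> real \<Rightarrow> 'm" where
  "flip2 G t s = G t (1 - s)"

text \<open>Where at each point at least one of two maps is locally constant \<open>x\<close>, they can be superposed
  without losing smoothness; horizontal compositions are of this form.\<close>

definition join_at :: "'m \<Rightarrow> 'm \<Rightarrow> 'm \<Rightarrow> 'm" where
  "join_at x a b = (if a = x then b else a)"

lemma join_at_simps [simp]: "join_at x x b = b" "join_at x a x = a"
  by (simp_all add: join_at_def)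

context charted begin

lemma path1_edge:
  assumes "path2 A G" "c \<in> {0..1}"
  shows "path1 A (\<lambda>t. G t c)"
proof -
  have "smooth_cube A {0..1} (\<lambda>t. unc2 G (t, c))"
    by (rule smooth_cube_compose[where f = "\<lambda>t. (t, c)" and K = unit_sq])
      (use assms in \<open>auto simp: path2_def intro!: smooth_intros\<close>)
  moreover obtain e where e: "0 < e" "e < 1/2" "\<And>s. s \<in> {0..1} \<Longrightarrow> collar e (\<lambda>t. G t s)"
    using path2_collars[OF assms(1)] by metis
  ultimately show ?thesis
    unfolding path1_def using e(3)[OF assms(2), unfolded collar_def] by (simp only: fst_conv snd_conv) blast
qed

lemma rank2_htpc_path2:
  assumes "rank2_htpc A G G'"
  shows "path2 A G" "path2 A G'"
  using assms unfolding rank2_htpc_def by simp_all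

lemma rank2_htpc_edge:
  assumes "rank2_htpc A G G'" "c = 0 \<or> c = 1"
  shows "rank1_htpc A (\<lambda>t. G t c) (\<lambda>t. G' t c)"
proof -
  have "\<exists>H. rank1_htpy_via A H (\<lambda>t. G t 0) (\<lambda>t. G' t 0)"
    using assms(1) unfolding rank2_htpc_def by (elim conjE exE) (rule exI)
  moreover have "\<exists>H. rank1_htpy_via A H (\<lambda>t. G t 1) (\<lambda>t. G' t 1)"
    using assms(1) unfolding rank2_htpc_def by (elim conjE exE) (rule exI)
  ultimately have "\<exists>H. rank1_htpy_via A H (\<lambda>t. G t c) (\<lambda>t. G' t c)"
    using assms(2) by auto
  moreover have "c \<in> {0..1}" using assms(2) by auto
  ultimately show ?thesis
    using path1_edge rank2_htpc_path2[OF assms(1)] unfolding rank1_htpc_def by blast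
qed

lemma rank2_htpc_corners:
  assumes "rank2_htpc A G G'"
  shows "G' 0 0 = G 0 0" "G' 1 0 = G 1 0"
proof -
  from assms obtain e J where J: "ghtpy e (G 0 0) (G 1 0) J"
    "\<And>t s. J t s 0 = ext2 G t s" "\<And>t s. J t s 1 = ext2 G' t s" by (rule rank2_htpcE) (rule that)
  show "G' 0 0 = G 0 0" "G' 1 0 = G 1 0"
    using ghtpyD(4)[OF J(1), of 0 0 1] ghtpyD(5)[OF J(1), of 1 0 1] ghtpyD(1)[OF J(1)] J(3)
    by (simp_all add: ext2_unit)
qed

lemma gpath2_ghtpy:
  assumes "gpath2 e a b G"
  shows "ghtpy e a b (\<lambda>t s r. G t s)"
  by (rule ghtpyI; (rule hgood_path gpath2D[OF assms] refl)+)

section \<open>Rank-2 homotopy as an equivalence relation\<close>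

lemma rank2_htpc_refl:
  assumes "path2 A G"
  shows "rank2_htpc A G G"
proof -
  from assms obtain e where e: "gpath2 e (G 0 0) (G 1 0) (ext2 G)" by (rule path2E)
  show ?thesis
    by (rule rank2_htpcI[where J = "\<lambda>t s q. ext2 G t s" and d = e])
      (rule hgood_path gpath2D[OF e] ext2_unit[symmetric] | assumption)+
qed

lemma rank2_htpc_sym:
  assumes "rank2_htpc A G G'"
  shows "rank2_htpc A G' G"
proof -
  from assms obtain e J where J: "ghtpy e (G 0 0) (G 1 0) J"
    "\<And>t s. J t s 0 = ext2 G t s" "\<And>t s. J t s 1 = ext2 G' t s" by (rule rank2_htpcE) (rule that)
  show ?thesis
  proof (rule rank2_htpcI[where J = "\<lambda>t s q. J t s (1 - q)" and d = e])
    show "hgood (\<lambda>t s r. J t s (1 - smooth_step r))"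
      by (rule hgood_tr[OF ghtpyD(3)[OF J(1)]]) (intro smooth_intros)+
    show "J t s (1 - q) = G 0 0" if "t \<le> e" for t s q by (rule ghtpyD(4)[OF J(1) that])
    show "J t s (1 - q) = G 1 0" if "t \<ge> 1 - e" for t s q by (rule ghtpyD(5)[OF J(1) that])
    show "J t s (1 - q) = J t 0 (1 - q)" if "s \<le> e" for t s q by (rule ghtpyD(6)[OF J(1) that])
    show "J t s (1 - q) = J t 1 (1 - q)" if "s \<ge> 1 - e" for t s q by (rule ghtpyD(7)[OF J(1) that])
  qed (simp_all add: J(2,3) ext2_unit ghtpyD(1)[OF J(1)])
qed

text \<open>The homotopies are stacked along \<open>q\<close>. By their collars both equal the
  extension of \<open>G'\<close> near \<open>q = 1/2\<close>, so each formula stays valid a little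
  beyond its own half, and near every point the stack is one of the two smooth maps.\<close>

lemma rank2_htpc_trans:
  assumes "rank2_htpc A G G'" "rank2_htpc A G' G''"
  shows "rank2_htpc A G G''"
proof -
  from assms(1) obtain e J where J: "ghtpy e (G 0 0) (G 1 0) J"
    "\<And>t s. J t s 0 = ext2 G t s" "\<And>t s. J t s 1 = ext2 G' t s" by (rule rank2_htpcE) (rule that)
  from assms(2) obtain d K where K: "ghtpy d (G' 0 0) (G' 1 0) K"
    "\<And>t s. K t s 0 = ext2 G' t s" "\<And>t s. K t s 1 = ext2 G'' t s" by (rule rank2_htpcE) (rule that)
  have K': "ghtpy d (G 0 0) (G 1 0) K" using K(1) rank2_htpc_corners[OF assms(1)] by simp
  define c where "c = min d e"
  have c: "0 < c" "c \<le> d" "c \<le> e" using ghtpyD(1)[OF J(1)] ghtpyD(1)[OF K'] by (auto simp: c_def)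
  note j = ghtpyD[OF ghtpy_mono[OF J(1) c(1,3)]] and k = ghtpyD[OF ghtpy_mono[OF K' c(1,2)]]
  let ?L = "\<lambda>t s q. if q \<le> 1/2 then J t s (2 * q) else K t s (2 * q - 1)"
  have LJ: "?L t s q = J t s (2 * q)" if "2 * q < 1 + c" for t s q
    using j(9)[of "2 * q" t s] k(8)[of "2 * q - 1" t s] that c(1) J(3) K(2) by auto
  have LK: "?L t s q = K t s (2 * q - 1)" if "2 * q > 1 - c" for t s q
    using j(9)[of "2 * q" t s] k(8)[of "2 * q - 1" t s] that c(1) J(3) K(2) by auto
  show ?thesis
  proof (rule rank2_htpcI[where J = ?L and d = c])
    show "hgood (\<lambda>t s r. ?L t s (smooth_step r))"
    proof (rule hgood_local)
      fix p :: "real \<times> real \<times> real"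
      let ?q = "\<lambda>p :: real \<times> real \<times> real. smooth_step (snd (snd p))"
      have cont: "continuous_on UNIV ?q"
        by (rule smooth_on_continuous) (intro smooth_intros)
      consider "2 * ?q p < 1 + c" | "2 * ?q p > 1 - c" using c(1) by linarith
      then show "\<exists>M. hgood M \<and> (\<forall>\<^sub>F p in nhds p. unc3 M p = unc3 (\<lambda>t s r. ?L t s (smooth_step r)) p)"
      proof cases
        case 1
        have "open {p. 2 * ?q p < 1 + c}" by (intro open_Collect_less continuous_intros cont)
        then have "\<forall>\<^sub>F p in nhds p. 2 * ?q p < 1 + c" using 1 by (auto simp: eventually_nhds)
        then have "\<forall>\<^sub>F p in nhds p. unc3 (\<lambda>t s r. J t s (2 * smooth_step r)) p = unc3 (\<lambda>t s r. ?L t s (smooth_step r)) p"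
          by (rule eventually_mono) (rule LJ[symmetric])
        moreover have "hgood (\<lambda>t s r. J t s (2 * smooth_step r))"
          by (rule hgood_tr[OF j(3)]) (intro smooth_intros)+
        ultimately show ?thesis by blast
      next
        case 2
        have "open {p. 1 - c < 2 * ?q p}" by (intro open_Collect_less continuous_intros cont)
        then have "\<forall>\<^sub>F p in nhds p. 1 - c < 2 * ?q p" using 2 by (auto simp: eventually_nhds)
        then have "\<forall>\<^sub>F p in nhds p. unc3 (\<lambda>t s r. K t s (2 * smooth_step r - 1)) p = unc3 (\<lambda>t s r. ?L t s (smooth_step r)) p"
          by (rule eventually_mono) (rule LK[symmetric])
        moreover have "hgood (\<lambda>t s r. K t s (2 * smooth_step r - 1))"
          by (rule hgood_tr[OF k(3)]) (intro smooth_intros)+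
        ultimately show ?thesis by blast
      qed
    qed
    show "?L t s q = G 0 0" if "t \<le> c" for t s q using j(4)[OF that] k(4)[OF that] by simp
    show "?L t s q = G 1 0" if "t \<ge> 1 - c" for t s q using j(5)[OF that] k(5)[OF that] by simp
    show "?L t s q = ?L t 0 q" if "s \<le> c" for t s q
      using j(6)[OF that, of t "2 * q"] k(6)[OF that, of t "2 * q - 1"] by simp
    show "?L t s q = ?L t 1 q" if "s \<ge> 1 - c" for t s q
      using j(7)[OF that, of t "2 * q"] k(7)[OF that, of t "2 * q - 1"] by simp
  qed (simp_all add: c J(2) K(3) ext2_unit)
qed

text \<open>A rank-1 homotopy, read as independent of \<open>s\<close>, satisfies the interior and
  the edge bounds at once. Conversely, the face \<open>s = 0\<close> of a rank-2 homotopy is the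
  required rank-1 homotopy.\<close>

lemma rank1_htpc_iff: "rank1_htpc A \<gamma> \<phi> \<longleftrightarrow> rank2_htpc A (idpath2 \<gamma>) (idpath2 \<phi>)"
proof
  assume "rank2_htpc A (idpath2 \<gamma>) (idpath2 \<phi>)"
  from rank2_htpc_edge[OF this, of 0] show "rank1_htpc A \<gamma> \<phi>" by (simp add: idpath2_def)
next
  assume "rank1_htpc A \<gamma> \<phi>"
  then obtain H where H: "path2 A H" "rank_le A unit_sq (unc2 H) 1" "\<forall>t\<in>{0..1}. H t 0 = \<gamma> t \<and> H t 1 = \<phi> t"
    unfolding rank1_htpc_def rank1_htpy_via_def by blast
  from H(1) obtain e where e: "gpath2 e (H 0 0) (H 1 0) (ext2 H)" by (rule path2E)
  obtain d where "0 < d" "d < 1/2" "\<And>s. s \<in> {0..1} \<Longrightarrow> collar d (\<lambda>t. H t s)"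
    "\<And>t. t \<in> {0..1} \<Longrightarrow> collar d (\<lambda>s. H t s)" using path2_collars[OF H(1)] by metis
  then have g: "good 1 (unc2 (ext2 H)) p" for p
    using good_clamp2[OF _ H(2)] H(1) unfolding path2_def by blast
  show "rank2_htpc A (idpath2 \<gamma>) (idpath2 \<phi>)"
  proof (rule rank2_htpcI[where J = "\<lambda>t s q. ext2 H t q" and d = e])
    show "hgood (\<lambda>t s r. ext2 H t (smooth_step r))"
    proof (rule hgoodI)
      have "good 1 (\<lambda>p. unc2 (ext2 H) (fst p, smooth_step (snd (snd p)))) p" for p :: "real \<times> real \<times> real"
        by (rule good_compose[OF g]) (intro smooth_intros)
      then show "good 2 (unc3 (\<lambda>t s r. ext2 H t (smooth_step r))) p" for p
        using good_mono[of 1 _ p 2] by simp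
      have "good 1 (\<lambda>p. unc2 (ext2 H) (fst p, smooth_step (snd p))) p" for p :: "real \<times> real"
        by (rule good_compose[OF g]) (intro smooth_intros)
      then show "good 1 (unc2 (\<lambda>t r. ext2 H t (smooth_step r))) p" for p by simp
    qed
    show "ext2 H t q = H 0 0" if "t \<le> e" for t q by (rule gpath2D(4)[OF e that])
    show "ext2 H t q = H 1 0" if "t \<ge> 1 - e" for t q by (rule gpath2D(5)[OF e that])
  qed (use H(3) gpath2D(1)[OF e] in \<open>simp_all add: ext2_unit idpath2_def\<close>)
qed

section \<open>Horizontal composition of 2-paths with corners at the base point\<close>

definition loop2 :: "'m \<Rightarrow> (real \<Rightarrow> real \<Rightarrow> 'm) \<Rightarrow> bool" where
  "loop2 x G \<longleftrightarrow> path2 A G \<and> G 0 0 = x \<and> G 1 0 = x"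

lemma loop2_htpc: "rank2_htpc A G G' \<Longrightarrow> loop2 x G \<longleftrightarrow> loop2 x G'"
  using rank2_htpc_path2[of G G'] rank2_htpc_corners[of G G'] unfolding loop2_def by auto

lemma loop2E:
  assumes "loop2 x G"
  obtains e where "gpath2 e x x (ext2 G)"
  using assms path2E[of G] unfolding loop2_def by metis

lemma hgood_join:
  assumes "hgood J" "hgood K"
    and "\<And>p. (\<forall>\<^sub>F q in nhds p. unc3 J q = x) \<or> (\<forall>\<^sub>F q in nhds p. unc3 K q = x)"
  shows "hgood (\<lambda>t s r. join_at x (J t s r) (K t s r))"
proof (rule hgood_local)
  fix p
  show "\<exists>M. hgood M \<and> (\<forall>\<^sub>F q in nhds p. unc3 M q = unc3 (\<lambda>t s r. join_at x (J t s r) (K t s r)) q)"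
  proof (cases "\<forall>\<^sub>F q in nhds p. unc3 J q = x")
    case True
    then have "\<forall>\<^sub>F q in nhds p. unc3 K q = unc3 (\<lambda>t s r. join_at x (J t s r) (K t s r)) q"
      by (rule eventually_mono) simp
    then show ?thesis using assms(2) by blast
  next
    case False
    then have "\<forall>\<^sub>F q in nhds p. unc3 K q = x" using assms(3) by blast
    then have "\<forall>\<^sub>F q in nhds p. unc3 J q = unc3 (\<lambda>t s r. join_at x (J t s r) (K t s r)) q"
      by (rule eventually_mono) simp
    then show ?thesis using assms(1) by blast
  qed
qed

text \<open>The collar reaches a distance \<open>e\<close> into the interval, so a weak inequality
  for \<open>l\<close> at the single point \<open>p\<close> gives the constant value on a whole
  neighbourhood. This delivers the local constancy that \<open>hgood_join\<close> requires.\<close>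

lemma ghtpy_eventually:
  assumes J: "ghtpy e x x J" and l: "smooth_on UNIV (unc2 l)"
    and p: "l (fst p) (snd (snd p)) \<le> 0 \<or> 1 \<le> l (fst p) (snd (snd p))"
  shows "\<forall>\<^sub>F q in nhds p. unc3 (\<lambda>t s r. J (l t r) s (m r)) q = x"
proof -
  let ?l = "\<lambda>p :: real \<times> real \<times> real. l (fst p) (snd (snd p))"
  have "smooth_on UNIV (unc2 l \<circ> (\<lambda>p :: real \<times> real \<times> real. (fst p, snd (snd p))))"
    by (rule smooth_on_compose[OF _ l]) (auto intro!: smooth_intros)
  then have cont: "continuous_on UNIV ?l" using smooth_on_continuous by (fastforce simp: o_def)
  have e: "0 < e" by (rule ghtpyD(1)[OF J])
  have "open {p. ?l p < e}" "open {p. 1 - e < ?l p}"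
    by (intro open_Collect_less continuous_intros cont)+
  then have "open ({p. ?l p < e} \<union> {p. 1 - e < ?l p})" by (rule open_Un)
  then have "\<forall>\<^sub>F q in nhds p. q \<in> {p. ?l p < e} \<union> {p. 1 - e < ?l p}"
    by (rule eventually_nhds_in_open) (use p e in auto)
  then show ?thesis
    by (rule eventually_mono) (use ghtpyD(4,5)[OF J] in fastforce)
qed

lemma hgood_join_tr:
  assumes "ghtpy e x x J" "ghtpy e x x K" "smooth_on UNIV (unc2 l)" "smooth_on UNIV (unc2 m)"
    and "\<And>t r. l t r \<ge> 1 \<or> m t r \<le> 0"
  shows "hgood (\<lambda>t s r. join_at x (J (l t r) s (smooth_step r)) (K (m t r) s (smooth_step r)))"
proof (rule hgood_join)
  fix p :: "real \<times> real \<times> real"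
  show "(\<forall>\<^sub>F q in nhds p. unc3 (\<lambda>t s r. J (l t r) s (smooth_step r)) q = x) \<or>
        (\<forall>\<^sub>F q in nhds p. unc3 (\<lambda>t s r. K (m t r) s (smooth_step r)) q = x)"
    using ghtpy_eventually[OF assms(1,3), of p smooth_step] ghtpy_eventually[OF assms(2,4), of p smooth_step]
      assms(5)[of "fst p" "snd (snd p)"] by blast
qed (rule hgood_tr[OF ghtpyD(3)[OF assms(1)] assms(3)] hgood_tr[OF ghtpyD(3)[OF assms(2)] assms(4)],
    intro smooth_intros)+

lemma hcomp_join:
  assumes "\<And>t s. t \<ge> 1 \<Longrightarrow> H t s = x" "\<And>t s. t \<le> 0 \<Longrightarrow> H' t s = x"
    and "\<And>t s. t \<in> {0..1} \<Longrightarrow> s \<in> {0..1} \<Longrightarrow> G t s = H t s"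
    and "\<And>t s. t \<in> {0..1} \<Longrightarrow> s \<in> {0..1} \<Longrightarrow> G' t s = H' t s"
    and "t \<in> {0..1}" "s \<in> {0..1}"
  shows "hcomp G G' t s = join_at x (H (2 * t) s) (H' (2 * t - 1) s)"
proof (cases "t \<le> 1/2")
  case True
  then show ?thesis using assms(2)[of "2 * t - 1" s] assms(3)[of "2 * t" s] assms(5,6)
    by (simp add: hcomp_def)
next
  case False
  then show ?thesis using assms(1)[of "2 * t" s] assms(4)[of "2 * t - 1" s] assms(5,6)
    by (simp add: hcomp_def)
qed

lemma hcomp_ext2:
  assumes "G 1 0 = x" "G' 0 0 = x" "path2 A G" "path2 A G'" "t \<in> {0..1}" "s \<in> {0..1}"
  shows "hcomp G G' t s = join_at x (ext2 G (2 * t) s) (ext2 G' (2 * t - 1) s)"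
proof -
  from assms(3) obtain e where e: "gpath2 e (G 0 0) (G 1 0) (ext2 G)" by (rule path2E)
  from assms(4) obtain d where d: "gpath2 d (G' 0 0) (G' 1 0) (ext2 G')" by (rule path2E)
  show ?thesis
  proof (rule hcomp_join[OF _ _ _ _ assms(5,6)])
    show "ext2 G t s = x" if "t \<ge> 1" for t s
      using gpath2D(5)[OF e, of t s] gpath2D(1)[OF e] that assms(1) by simp
    show "ext2 G' t s = x" if "t \<le> 0" for t s
      using gpath2D(4)[OF d, of t s] gpath2D(1)[OF d] that assms(2) by simp
  qed (simp_all add: ext2_unit)
qed

lemma hcomp_cong:
  assumes G: "rank2_htpc A G G'" "loop2 x G" and H: "rank2_htpc A H H'" "loop2 x H"
  shows "rank2_htpc A (hcomp G H) (hcomp G' H')"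
proof -
  have x: "G 0 0 = x" "G 1 0 = x" "H 0 0 = x" "H 1 0 = x" using assms by (auto simp: loop2_def)
  have x': "G' 0 0 = x" "G' 1 0 = x" "H' 0 0 = x" "H' 1 0 = x"
    using x rank2_htpc_corners[OF G(1)] rank2_htpc_corners[OF H(1)] by auto
  from G(1) obtain e J where J: "ghtpy e (G 0 0) (G 1 0) J"
    "\<And>t s. J t s 0 = ext2 G t s" "\<And>t s. J t s 1 = ext2 G' t s" by (rule rank2_htpcE) (rule that)
  from H(1) obtain d K where K: "ghtpy d (H 0 0) (H 1 0) K"
    "\<And>t s. K t s 0 = ext2 H t s" "\<And>t s. K t s 1 = ext2 H' t s" by (rule rank2_htpcE) (rule that)
  define c where "c = min d e"
  have c: "0 < c" "c \<le> d" "c \<le> e" using ghtpyD(1)[OF J(1)] ghtpyD(1)[OF K(1)] by (auto simp: c_def)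
  have Jc: "ghtpy c x x J" and Kc: "ghtpy c x x K"
    using ghtpy_mono[OF J(1) c(1,3)] ghtpy_mono[OF K(1) c(1,2)] x by simp_all
  note j = ghtpyD[OF Jc] and k = ghtpyD[OF Kc]
  show ?thesis
  \<comment> \<open>Each factor is traversed at double speed, which halves the collar in
    \<open>t\<close>.\<close>
  proof (rule rank2_htpcI[where J = "\<lambda>t s q. join_at x (J (2 * t) s q) (K (2 * t - 1) s q)" and d = "c / 2"])
    show "hgood (\<lambda>t s r. join_at x (J (2 * t) s (smooth_step r)) (K (2 * t - 1) s (smooth_step r)))"
      by (rule hgood_join_tr[OF Jc Kc]) (auto intro!: smooth_intros)
    show "hcomp G H t s = join_at x (J (2 * t) s 0) (K (2 * t - 1) s 0)" if "t \<in> {0..1}" "s \<in> {0..1}" for t s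
      unfolding J K by (rule hcomp_ext2[OF x(2,3) rank2_htpc_path2(1)[OF G(1)] rank2_htpc_path2(1)[OF H(1)] that])
    show "hcomp G' H' t s = join_at x (J (2 * t) s 1) (K (2 * t - 1) s 1)" if "t \<in> {0..1}" "s \<in> {0..1}" for t s
      unfolding J K by (rule hcomp_ext2[OF x'(2,3) rank2_htpc_path2(2)[OF G(1)] rank2_htpc_path2(2)[OF H(1)] that])
    show "join_at x (J (2 * t) s q) (K (2 * t - 1) s q) = x" if "t \<le> c / 2" for t s q
      using j(4)[of "2 * t" s q] k(4)[of "2 * t - 1" s q] that j(2) by simp
    show "join_at x (J (2 * t) s q) (K (2 * t - 1) s q) = x" if "t \<ge> 1 - c / 2" for t s q
      using j(5)[of "2 * t" s q] k(5)[of "2 * t - 1" s q] that j(1,2) by simp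
    show "join_at x (J (2 * t) s q) (K (2 * t - 1) s q) = join_at x (J (2 * t) 0 q) (K (2 * t - 1) 0 q)"
      if "s \<le> c / 2" for t s q
      using j(6)[of s "2 * t" q] k(6)[of s "2 * t - 1" q] that j(1) by simp
    show "join_at x (J (2 * t) s q) (K (2 * t - 1) s q) = join_at x (J (2 * t) 1 q) (K (2 * t - 1) 1 q)"
      if "s \<ge> 1 - c / 2" for t s q
      using j(7)[of s "2 * t" q] k(7)[of s "2 * t - 1" q] that j(1) by simp
  qed (use c in simp)
qed

text \<open>\<open>rank2_htpc\<close> includes that both of its arguments are 2-paths; smoothness of
  the composite is thus read off from \<open>hcomp_cong\<close> applied to reflexive
  homotopies.\<close>

lemma hcomp_loop2:
  assumes "loop2 x G" "loop2 x H"
  shows "loop2 x (hcomp G H)"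
proof -
  have "path2 A (hcomp G H)"
    using hcomp_cong[OF rank2_htpc_refl assms(1) rank2_htpc_refl assms(2)] assms rank2_htpc_path2
    unfolding loop2_def by blast
  then show ?thesis using assms unfolding loop2_def by (simp add: hcomp_def)
qed

end

section \<open>Homotopies for the group laws and the interchange law\<close>

context charted begin

lemma hgood_path_tr:
  assumes "\<And>p. good k (unc2 G) p" "smooth_on UNIV (unc2 l)"
  shows "hgood (\<lambda>t s r. G (l t r) s)"
  by (rule hgood_tr[OF hgood_path[OF assms(1)] assms(2) smooth_on_id])

lemma loop2_const: "loop2 x (\<lambda>_ _. x)"
proof -
  have "gpath2 (1/3) x x (\<lambda>_ _. x)" by (rule gpath2I) (simp_all add: good_const)
  then show ?thesis unfolding loop2_def using path2_gpath2[of "1/3" x x] by simp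
qed

lemma hcomp_const_left:
  assumes "loop2 x G"
  shows "rank2_htpc A (hcomp (\<lambda>_ _. x) G) G"
proof -
  from assms obtain e where e: "gpath2 e x x (ext2 G)" by (rule loop2E)
  note g = gpath2D[OF e]
  \<comment> \<open>Since \<open>ext2 G\<close> is constant to the left of 0, prefixing the constant
    2-path amounts to the substitution of \<open>2 * t - 1\<close> for \<open>t\<close>; the convex
    combination joins it to the identity.\<close>
  let ?l = "\<lambda>q t. (1 - q) * (2 * t - 1) + q * t :: real"
  show ?thesis
  proof (rule rank2_htpcI[where J = "\<lambda>t s q. ext2 G (?l q t) s" and d = "e / 2"])
    show "hgood (\<lambda>t s r. ext2 G (?l (smooth_step r) t) s)"
      by (rule hgood_path_tr[OF g(3)]) (intro smooth_intros)
    show "hcomp (\<lambda>_ _. x) G t s = ext2 G (?l 0 t) s" if "t \<in> {0..1}" "s \<in> {0..1}" for t s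
      using that g(4)[of "2 * t - 1" s] g(1) by (simp add: hcomp_def ext2_unit)
    show "G t s = ext2 G (?l 1 t) s" if "t \<in> {0..1}" "s \<in> {0..1}" for t s
      using that by (simp add: ext2_unit)
    have l: "?l q t = t - (1 - q) * (1 - t)" for q t by algebra
    show "ext2 G (?l q t) s = x" if "t \<in> {0..1}" "q \<in> {0..1}" "t \<le> e / 2" for t s q
    proof (rule g(4))
      have "0 \<le> (1 - q) * (1 - t)" using that by simp
      then show "?l q t \<le> e" unfolding l using that g(1) by linarith
    qed
    show "ext2 G (?l q t) s = x" if "t \<in> {0..1}" "q \<in> {0..1}" "t \<ge> 1 - e / 2" for t s q
    proof (rule g(5))
      have "(1 - q) * (1 - t) \<le> 1 * (1 - t)" by (rule mult_right_mono) (use that in auto)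
      then have "(1 - q) * (1 - t) \<le> e / 2" using that by simp
      then show "?l q t \<ge> 1 - e" unfolding l using that by linarith
    qed
    show "ext2 G (?l q t) s = ext2 G (?l q t) 0" if "s \<le> e / 2" for t s q
      by (rule g(6)) (use that g(1) in linarith)
    show "ext2 G (?l q t) s = ext2 G (?l q t) 1" if "s \<ge> 1 - e / 2" for t s q
      by (rule g(7)) (use that g(1) in linarith)
  qed (use g(1) in simp)
qed

lemma hcomp_assoc:
  assumes "loop2 x G" "loop2 x H" "loop2 x K"
  shows "rank2_htpc A (hcomp (hcomp G H) K) (hcomp G (hcomp H K))"
proof -
  from assms(1) obtain e1 where e1: "gpath2 e1 x x (ext2 G)" by (rule loop2E)
  from assms(2) obtain e2 where e2: "gpath2 e2 x x (ext2 H)" by (rule loop2E)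
  from assms(3) obtain e3 where e3: "gpath2 e3 x x (ext2 K)" by (rule loop2E)
  define e where "e = min e1 (min e2 e3)"
  have "0 < e" "e \<le> e1" "e \<le> e2" "e \<le> e3"
    using gpath2D(1)[OF e1] gpath2D(1)[OF e2] gpath2D(1)[OF e3] by (auto simp: e_def)
  then have gG: "gpath2 e x x (ext2 G)" and gH: "gpath2 e x x (ext2 H)" and gK: "gpath2 e x x (ext2 K)"
    using gpath2_mono[OF e1] gpath2_mono[OF e2] gpath2_mono[OF e3] by simp_all
  note g = gpath2D[OF gG] and h = gpath2D[OF gH] and k = gpath2D[OF gK]
  note jG = gpath2_ghtpy[OF gG] and jH = gpath2_ghtpy[OF gH] and jK = gpath2_ghtpy[OF gK]
  \<comment> \<open>At \<open>q = 0\<close> the three functions are \<open>4 * t\<close>,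
    \<open>4 * t - 1\<close>, \<open>2 * t - 1\<close>, the local times of the factors in the left
    bracketing; at \<open>q = 1\<close> they are \<open>2 * t\<close>, \<open>4 * t - 2\<close>,
    \<open>4 * t - 3\<close>, those of the right one. In between they are affine in
    \<open>q\<close>.\<close>
  let ?a = "\<lambda>q t. (4 - 2 * q) * t :: real"
  let ?b = "\<lambda>q t. 4 * t - 1 - q :: real"
  let ?c = "\<lambda>q t. (2 + 2 * q) * t - 1 - 2 * q :: real"
  \<comment> \<open>No two factors run at the same time: \<open>G\<close> ends at
    \<open>t = 1 / (4 - 2 * q)\<close>, no later than \<open>(1 + q) / 4\<close> where
    \<open>H\<close> starts, and \<open>H\<close> ends at \<open>(2 + q) / 4\<close>, no later than
    \<open>(1 + 2 * q) / (2 + 2 * q)\<close> where \<open>K\<close> starts. Both comparisons come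
    down to \<open>q * q \<le> q\<close>.\<close>
  have split: "1 \<le> ?a q t \<or> (?b q t \<le> 0 \<and> ?c q t \<le> 0)" "1 \<le> ?b q t \<or> ?c q t \<le> 0"
    if q: "q \<in> {0..1}" for q t
  proof -
    have q': "0 \<le> q" "q \<le> 1" "q * q \<le> q" using q mult_left_le[of q q] by auto
    show "1 \<le> ?b q t \<or> ?c q t \<le> 0"
    proof (cases "1 \<le> ?b q t")
      case False
      then have "t \<le> (2 + q) / 4" by simp
      then have "(2 + 2 * q) * t \<le> (2 + 2 * q) * ((2 + q) / 4)"
        using q' by (intro mult_left_mono) simp_all
      also have "\<dots> = 1 + (3/2) * q + (q * q) / 2" by (simp add: field_simps)
      finally show ?thesis using q' by linarith
    qed simp
    show "1 \<le> ?a q t \<or> (?b q t \<le> 0 \<and> ?c q t \<le> 0)"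
    proof (cases "t \<le> (1 + q) / 4")
      case True
      then have "?b q t \<le> 0" by simp
      moreover have "(2 + 2 * q) * t \<le> (2 + 2 * q) * ((1 + q) / 4)"
        using q' True by (intro mult_left_mono) linarith+
      then have "?c q t \<le> 0" using q' by (simp add: field_simps)
      ultimately show ?thesis by simp
    next
      case False
      then have "(4 - 2 * q) * t \<ge> (4 - 2 * q) * ((1 + q) / 4)"
        using q' by (intro mult_left_mono) linarith+
      also have "(4 - 2 * q) * ((1 + q) / 4) = 1 + q / 2 - (q * q) / 2" by (simp add: field_simps)
      finally show ?thesis using q' by linarith
    qed
  qed
  let ?J = "\<lambda>t s q. join_at x (ext2 G (?a q t) s) (join_at x (ext2 H (?b q t) s) (ext2 K (?c q t) s))"
  have sa: "smooth_on UNIV (unc2 (\<lambda>t r. ?a (smooth_step r) t))"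
    and sb: "smooth_on UNIV (unc2 (\<lambda>t r. ?b (smooth_step r) t))"
    and sc: "smooth_on UNIV (unc2 (\<lambda>t r. ?c (smooth_step r) t))" by (intro smooth_intros)+
  have sp: "smooth_step r \<in> {0..1}" for r using smooth_step_range[of r] by simp
  show ?thesis
  \<comment> \<open>The slopes of \<open>?a\<close>, \<open>?b\<close> and \<open>?c\<close> in
    \<open>t\<close> are at most 4.\<close>
  proof (rule rank2_htpcI[where J = ?J and d = "e / 4"])
    have HK: "hgood (\<lambda>t s r. join_at x (ext2 H (?b (smooth_step r) t) s) (ext2 K (?c (smooth_step r) t) s))"
      by (rule hgood_join_tr[OF jH jK sb sc]) (rule split(2)[OF sp])
    show "hgood (\<lambda>t s r. ?J t s (smooth_step r))"
    proof (rule hgood_join[OF _ HK])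
      show "hgood (\<lambda>t s r. ext2 G (?a (smooth_step r) t) s)"
        by (rule hgood_path_tr[OF g(3) sa])
      fix p :: "real \<times> real \<times> real"
      let ?t = "fst p" and ?q = "smooth_step (snd (snd p))"
      consider "1 \<le> ?a ?q ?t" | "?b ?q ?t \<le> 0" "?c ?q ?t \<le> 0"
        using split(1)[OF sp] by blast
      then show "(\<forall>\<^sub>F p in nhds p. unc3 (\<lambda>t s r. ext2 G (?a (smooth_step r) t) s) p = x) \<or>
          (\<forall>\<^sub>F p in nhds p. unc3 (\<lambda>t s r. join_at x (ext2 H (?b (smooth_step r) t) s)
              (ext2 K (?c (smooth_step r) t) s)) p = x)"
      proof cases
        case 1
        then show ?thesis using ghtpy_eventually[OF jG sa, of p] by simp
      next
        case 2
        have "\<forall>\<^sub>F p in nhds p. unc3 (\<lambda>t s r. ext2 H (?b (smooth_step r) t) s) p = x"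
          "\<forall>\<^sub>F p in nhds p. unc3 (\<lambda>t s r. ext2 K (?c (smooth_step r) t) s) p = x"
          using ghtpy_eventually[OF jH sb, of p] ghtpy_eventually[OF jK sc, of p] 2 by simp_all
        then have "\<forall>\<^sub>F p in nhds p. unc3 (\<lambda>t s r. join_at x (ext2 H (?b (smooth_step r) t) s)
              (ext2 K (?c (smooth_step r) t) s)) p = x"
          by (rule eventually_elim2) simp
        then show ?thesis by blast
      qed
    qed
    have e: "0 < e" "e < 1/2" using g(1,2) .
    have x0: "ext2 G t s = x" "ext2 H t s = x" "ext2 K t s = x" if "t \<le> 0" for t s
      using g(4)[of t s] h(4)[of t s] k(4)[of t s] that e by simp_all
    have x1: "ext2 G t s = x" "ext2 H t s = x" "ext2 K t s = x" if "t \<ge> 1" for t s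
      using g(5)[of t s] h(5)[of t s] k(5)[of t s] that e by simp_all
    show "hcomp (hcomp G H) K t s = ?J t s 0" if "t \<in> {0..1}" "s \<in> {0..1}" for t s
    proof -
      consider "t \<le> 1/4" | "1/4 < t" "t \<le> 1/2" | "1/2 < t" by linarith
      then show ?thesis
      proof cases
        case 1
        then show ?thesis using that x0(2)[of "4 * t - 1" s] x0(3)[of "2 * t - 1" s]
          by (simp add: hcomp_def ext2_unit)
      next
        case 2
        then show ?thesis using that x1(1)[of "4 * t" s] x0(3)[of "2 * t - 1" s]
          by (simp add: hcomp_def ext2_unit)
      next
        case 3
        then show ?thesis using that x1(1)[of "4 * t" s] x1(2)[of "4 * t - 1" s]
          by (simp add: hcomp_def ext2_unit)
      qed
    qed
    show "hcomp G (hcomp H K) t s = ?J t s 1" if "t \<in> {0..1}" "s \<in> {0..1}" for t s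
    proof -
      consider "t \<le> 1/2" | "1/2 < t" "t \<le> 3/4" | "3/4 < t" by linarith
      then show ?thesis
      proof cases
        case 1
        then show ?thesis using that x0(2)[of "4 * t - 2" s] x0(3)[of "4 * t - 3" s]
          by (simp add: hcomp_def ext2_unit)
      next
        case 2
        then show ?thesis using that x1(1)[of "2 * t" s] x0(3)[of "4 * t - 3" s]
          by (simp add: hcomp_def ext2_unit)
      next
        case 3
        then show ?thesis using that x1(1)[of "2 * t" s] x1(2)[of "4 * t - 2" s]
          by (simp add: hcomp_def ext2_unit)
      qed
    qed
    show "?J t s q = x" if "t \<in> {0..1}" "s \<in> {0..1}" "q \<in> {0..1}" "t \<le> e / 4" for t s q
    proof -
      have "q * t \<ge> 0" "q * t \<le> q * 1" using that by (simp_all add: mult_left_le)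
      then have "?a q t \<le> e" "?b q t \<le> e" "?c q t \<le> e"
        using that e by (simp_all add: algebra_simps)
      then show ?thesis by (simp add: g(4) h(4) k(4))
    qed
    show "?J t s q = x" if "t \<in> {0..1}" "s \<in> {0..1}" "q \<in> {0..1}" "t \<ge> 1 - e / 4" for t s q
    proof -
      have "q * (1 - t) \<ge> 0" "q * (1 - t) \<le> 1 * (1 - t)" "q * t \<le> 1 * t"
        using that by (simp_all add: mult_left_le_one_le)
      then have "?a q t \<ge> 1 - e" "?b q t \<ge> 1 - e" "?c q t \<ge> 1 - e"
        using that e by (simp_all add: algebra_simps)
      then show ?thesis by (simp add: g(5) h(5) k(5))
    qed
    show "?J t s q = ?J t 0 q" if "s \<le> e / 4" for t s q
    proof -
      have "s \<le> e" using that e by linarith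
      from g(6)[OF this] h(6)[OF this] k(6)[OF this] show ?thesis by metis
    qed
    show "?J t s q = ?J t 1 q" if "s \<ge> 1 - e / 4" for t s q
    proof -
      have "s \<ge> 1 - e" using that e by linarith
      from g(7)[OF this] h(7)[OF this] k(7)[OF this] show ?thesis by metis
    qed
  qed (use gpath2D(1)[OF gG] in simp)
qed

section \<open>Reversal, reflection and inverses\<close>

lemma rev2_cong:
  assumes "rank2_htpc A G G'"
  shows "rank2_htpc A (rev2 G) (rev2 G')"
proof -
  from assms obtain e J where J: "ghtpy e (G 0 0) (G 1 0) J"
    "\<And>t s. J t s 0 = ext2 G t s" "\<And>t s. J t s 1 = ext2 G' t s" by (rule rank2_htpcE) (rule that)
  note j = ghtpyD[OF J(1)]
  show ?thesis
  proof (rule rank2_htpcI[where J = "\<lambda>t s q. J (1 - t) s q" and d = e])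
    show "hgood (\<lambda>t s r. J (1 - t) s (smooth_step r))"
      by (rule hgood_tr[OF j(3)]) (intro smooth_intros)+
    show "J (1 - t) s q = G 1 0" if "t \<le> e" for t s q by (rule j(5)) (use that in simp)
    show "J (1 - t) s q = G 0 0" if "t \<ge> 1 - e" for t s q by (rule j(4)) (use that in simp)
    show "J (1 - t) s q = J (1 - t) 0 q" if "s \<le> e" for t s q by (rule j(6)[OF that])
    show "J (1 - t) s q = J (1 - t) 1 q" if "s \<ge> 1 - e" for t s q by (rule j(7)[OF that])
  qed (simp_all add: J(2,3) ext2_unit rev2_def j(1))
qed

lemma flip2_cong:
  assumes "rank2_htpc A G G'"
  shows "rank2_htpc A (flip2 G) (flip2 G')"
proof -
  from assms obtain e J where J: "ghtpy e (G 0 0) (G 1 0) J"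
    "\<And>t s. J t s 0 = ext2 G t s" "\<And>t s. J t s 1 = ext2 G' t s" by (rule rank2_htpcE) (rule that)
  note j = ghtpyD[OF J(1)]
  show ?thesis
  proof (rule rank2_htpcI[where J = "\<lambda>t s q. J t (1 - s) q" and d = e])
    show "hgood (\<lambda>t s r. J t (1 - s) (smooth_step r))"
      by (rule hgood_flip[of "\<lambda>t s r. J t s (smooth_step r)"], rule hgood_tr[OF j(3)]) (intro smooth_intros)+
    show "J t (1 - s) q = G 0 0" if "t \<le> e" for t s q by (rule j(4)[OF that])
    show "J t (1 - s) q = G 1 0" if "t \<ge> 1 - e" for t s q by (rule j(5)[OF that])
    show "J t (1 - s) q = J t (1 - 0) q" if "s \<le> e" for t s q using j(7)[of "1 - s" t q] that by simp
    show "J t (1 - s) q = J t (1 - 1) q" if "s \<ge> 1 - e" for t s q using j(6)[of "1 - s" t q] that by simp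
  qed (simp_all add: J(2,3) ext2_unit flip2_def j(1))
qed

lemma loop2_rev2:
  assumes "loop2 x G"
  shows "loop2 x (rev2 G)"
proof -
  have "path2 A G" using assms by (simp add: loop2_def)
  then have "path2 A (rev2 G)" by (rule rank2_htpc_path2[OF rev2_cong[OF rank2_htpc_refl]])
  then show ?thesis using assms by (simp add: loop2_def rev2_def)
qed

lemma loop2_flip2:
  assumes "loop2 x G"
  shows "loop2 x (flip2 G)"
proof -
  have "path2 A G" using assms by (simp add: loop2_def)
  then have "path2 A (flip2 G)" by (rule rank2_htpc_path2[OF flip2_cong[OF rank2_htpc_refl]])
  \<comment> \<open>\<open>loop2\<close> records the corners at \<open>s = 0\<close>; those at
    \<open>s = 1\<close> are also \<open>x\<close> because the left and right edges of a 2-path are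
    constant.\<close>
  moreover obtain e where "gpath2 e x x (ext2 G)" using assms by (rule loop2E)
  then have "ext2 G 0 1 = x" "ext2 G 1 1 = x" using gpath2D(1,4,5) by fastforce+
  ultimately show ?thesis by (simp add: loop2_def flip2_def ext2_unit)
qed

text \<open>The convex combination of \<open>t\<close> and its square lies below \<open>t\<close> by
  \<open>q * (t * (1 - t))\<close>, which is between 0 and \<open>1 - t\<close> on the unit square.
  Hence it stays in the collar near both ends.\<close>

lemma square_reparam:
  assumes "loop2 x G"
  shows "rank2_htpc A G (\<lambda>t s. G (t\<^sup>2) s)"
proof -
  from assms obtain e where e: "gpath2 e x x (ext2 G)" by (rule loop2E)
  note g = gpath2D[OF e]
  let ?l = "\<lambda>q t. (1 - q) * t + q * t\<^sup>2 :: real"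
  have l: "?l q t = t - q * (t * (1 - t))" for q t by (simp add: power2_eq_square algebra_simps)
  show ?thesis
  proof (rule rank2_htpcI[where J = "\<lambda>t s q. ext2 G (?l q t) s" and d = "e / 2"])
    show "hgood (\<lambda>t s r. ext2 G (?l (smooth_step r) t) s)"
      by (rule hgood_path_tr[OF g(3)]) (intro smooth_intros)
    show "G (t\<^sup>2) s = ext2 G (?l 1 t) s" if "t \<in> {0..1}" "s \<in> {0..1}" for t s
      using that by (simp add: ext2_unit power_le_one)
    show "ext2 G (?l q t) s = x" if "t \<in> {0..1}" "q \<in> {0..1}" "t \<le> e / 2" for t s q
    proof (rule g(4))
      have "0 \<le> q * (t * (1 - t))" using that by simp
      then show "?l q t \<le> e" unfolding l using that g(1) by linarith
    qed
    show "ext2 G (?l q t) s = x" if "t \<in> {0..1}" "q \<in> {0..1}" "t \<ge> 1 - e / 2" for t s q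
    proof (rule g(5))
      have "q * (t * (1 - t)) \<le> 1 * (1 * (1 - t))" by (intro mult_mono) (use that in auto)
      then have "q * (t * (1 - t)) \<le> e / 2" using that by simp
      then show "?l q t \<ge> 1 - e" unfolding l using that by linarith
    qed
    show "ext2 G (?l q t) s = ext2 G (?l q t) 0" if "s \<le> e / 2" for t s q
      by (rule g(6)) (use that g(1) in linarith)
    show "ext2 G (?l q t) s = ext2 G (?l q t) 1" if "s \<ge> 1 - e / 2" for t s q
      by (rule g(7)) (use that g(1) in linarith)
  qed (use g(1) in \<open>simp_all add: ext2_unit\<close>)
qed

text \<open>After reparametrizing \<open>G\<close> by \<open>t\<^sup>2\<close>, the fold \<open>\<bar>2 t - 1\<bar>\<close> of \<open>[0,1]\<close> becomes the smooth
  function \<open>(2 t - 1)\<^sup>2\<close>.\<close>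

lemma hcomp_rev2_left:
  assumes "loop2 x G"
  shows "rank2_htpc A (hcomp (rev2 G) G) (\<lambda>_ _. x)"
proof -
  from assms obtain e where e: "gpath2 e x x (ext2 G)" by (rule loop2E)
  note g = gpath2D[OF e]
  let ?G = "\<lambda>t s. G (t\<^sup>2) s"
  \<comment> \<open>Adding \<open>q\<close> pushes the folded time towards and beyond 1, where
    \<open>ext2 G\<close> is constantly \<open>x\<close>; at \<open>q = 1\<close> nothing else is
    left.\<close>
  let ?l = "\<lambda>q t. (2 * t - 1)\<^sup>2 + q :: real"
  have "rank2_htpc A (hcomp (rev2 ?G) ?G) (\<lambda>_ _. x)"
  proof (rule rank2_htpcI[where J = "\<lambda>t s q. ext2 G (?l q t) s" and d = "e / 4"])
    show "hgood (\<lambda>t s r. ext2 G (?l (smooth_step r) t) s)"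
      by (rule hgood_path_tr[OF g(3)]) (intro smooth_intros)
    show "hcomp (rev2 ?G) ?G t s = ext2 G (?l 0 t) s" if "t \<in> {0..1}" "s \<in> {0..1}" for t s
    proof -
      have "(1 - 2 * t)\<^sup>2 = (2 * t - 1)\<^sup>2" by (simp add: power2_eq_square algebra_simps)
      moreover have "(2 * t - 1)\<^sup>2 \<le> 1" using that by (simp add: abs_square_le_1 abs_le_iff)
      ultimately show ?thesis using that by (simp add: hcomp_def rev2_def ext2_unit)
    qed
    show "x = ext2 G (?l 1 t) s" for t s
      by (rule g(5)[symmetric]) (use g(1) zero_le_power2[of "2 * t - 1"] in linarith)
    show "ext2 G (?l q t) s = x" if "t \<in> {0..1}" "q \<in> {0..1}" "t \<le> e / 4" for t s q
    proof (rule g(5))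
      have "?l q t = 1 - 4 * t + 4 * (t * t) + q" by (simp add: power2_eq_square algebra_simps)
      moreover have "0 \<le> t * t" by simp
      moreover have "0 \<le> q" using that by simp
      ultimately show "?l q t \<ge> 1 - e" using that(3) by linarith
    qed
    show "ext2 G (?l q t) s = x" if "t \<in> {0..1}" "q \<in> {0..1}" "t \<ge> 1 - e / 4" for t s q
    proof (rule g(5))
      define u where "u = 1 - t"
      have "(2 * t - 1)\<^sup>2 = 1 - 4 * u + 4 * (u * u)"
        by (simp add: u_def power2_eq_square algebra_simps)
      moreover have "0 \<le> u * u" by simp
      moreover have "u \<le> e / 4" "0 \<le> q" using that by (simp_all add: u_def)
      ultimately show "?l q t \<ge> 1 - e" by linarith
    qed
    show "ext2 G (?l q t) s = ext2 G (?l q t) 0" if "s \<le> e / 4" for t s q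
      by (rule g(6)) (use that g(1) in linarith)
    show "ext2 G (?l q t) s = ext2 G (?l q t) 1" if "s \<ge> 1 - e / 4" for t s q
      by (rule g(7)) (use that g(1) in linarith)
  qed (use g(1) in simp)
  moreover have "rank2_htpc A (hcomp (rev2 G) G) (hcomp (rev2 ?G) ?G)"
    by (rule hcomp_cong[OF rev2_cong[OF square_reparam[OF assms]] loop2_rev2[OF assms] square_reparam[OF assms] assms])
  ultimately show ?thesis using rank2_htpc_trans by blast
qed

text \<open>The homotopy from the constant path to the lower edge is glued below the 2-path.\<close>

lemma lower_edge_const_representative:
  assumes "loop2 x G" "rank1_htpc A (\<lambda>_. x) (\<lambda>t. G t 0)"
  obtains e K where "rank2_htpc A G K" "gpath2 e x x K" "\<And>t s. s \<le> 2/3 \<Longrightarrow> K t s = x"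
proof -
  from assms(1) obtain e1 where e1: "gpath2 e1 x x (ext2 G)" by (rule loop2E)
  from assms(2)[unfolded rank1_htpc_iff] obtain e2 J
    where J: "ghtpy e2 (idpath2 (\<lambda>_. x) 0 0) (idpath2 (\<lambda>_. x) 1 0) J"
      "\<And>t s. J t s 0 = ext2 (idpath2 (\<lambda>_. x)) t s"
      "\<And>t s. J t s 1 = ext2 (idpath2 (\<lambda>t. G t 0)) t s"
    by (rule rank2_htpcE) (rule that)
  \<comment> \<open>The cap 1/6 is the length of the interval above 5/6, on which the step
    \<open>k\<close> introduced below is constantly 1.\<close>
  define e where "e = min (1/6) (min e1 e2)"
  have e: "0 < e" "e \<le> e1" "e \<le> e2" "e \<le> 1/6"
    using gpath2D(1)[OF e1] ghtpyD(1)[OF J(1)] by (auto simp: e_def)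
  note g = gpath2D[OF gpath2_mono[OF e1 e(1,2)]]
    and j = ghtpyD[OF ghtpy_mono[OF J(1)[unfolded idpath2_def] e(1,3)]]
  let ?H = "\<lambda>t r. J t 0 r"
  have H0: "?H t 0 = x" and H1: "?H t 1 = ext2 G t 0" for t
    by (simp_all add: J(2,3) ext2_def idpath2_def)
  \<comment> \<open>A 2-path of double height: \<open>u\<close> from -1 to 0 runs through the rank-1
    homotopy, \<open>u\<close> from 0 to 1 through \<open>G\<close>. Around \<open>u = 0\<close>
    both pieces equal the lower edge of \<open>G\<close> by their collars.\<close>
  define P where "P t u = (if u \<le> 0 then ?H t (u + 1) else ext2 G t u)" for t u
  have PG: "P t u = ext2 G t u" if "u > - e" for t u
    using that j(9)[of "u + 1" t 0] g(6)[of u t] H1[of t] e(1) by (simp add: P_def)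
  have PH: "P t u = ?H t (u + 1)" if "u < e" for t u
    using that j(9)[of "u + 1" t 0] g(6)[of u t] H1[of t] e(1) by (simp add: P_def)
  have H: "good 1 (unc2 ?H) p" for p by (rule hgoodD(2)[OF j(3)]) simp
  have P: "good 2 (unc2 P) p" for p
  proof (cases "snd p < e")
    case True
    have "open {p :: real \<times> real. snd p < e}" by (intro open_Collect_less continuous_intros)
    then have "\<forall>\<^sub>F p in nhds p. snd p < e" using True by (auto simp: eventually_nhds)
    then have ev: "\<forall>\<^sub>F p in nhds p. unc2 ?H (fst p, snd p + 1) = unc2 P p"
      by (rule eventually_mono) (simp add: PH)
    have "good 1 (\<lambda>p. unc2 ?H (fst p, snd p + 1)) p"
      by (rule good_compose[OF H]) (intro smooth_intros)
    then show ?thesis using good_cong[OF good_mono ev] by simp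
  next
    case False
    have "open {p :: real \<times> real. - e < snd p}" by (intro open_Collect_less continuous_intros)
    then have "\<forall>\<^sub>F p in nhds p. - e < snd p"
      using eventually_nhds_in_open[of "{p :: real \<times> real. - e < snd p}" p] False e(1) by simp
    then have "\<forall>\<^sub>F p in nhds p. unc2 (ext2 G) p = unc2 P p"
      by (rule eventually_mono) (simp add: PG)
    then show ?thesis by (rule good_cong[OF g(3)])
  qed
  have Px: "P t u = x" if "t \<le> e \<or> t \<ge> 1 - e" for t u
    using that g(4,5)[of t u] j(4,5)[of t 0 "u + 1"] by (auto simp: P_def)
  \<comment> \<open>The transition takes place between 2/3 and 5/6. Being flat up to 2/3 leaves room
    for the reflected version, which is constant from 1/3 on: the open sets \<open>s > 1/3\<close>
    and \<open>s < 2/3\<close> then cover the square.\<close>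
  define k where "k s = smooth_step (2 * s - 1)" for s
  have k0: "k s = 0" if "s \<le> 2/3" for s unfolding k_def by (rule smooth_step_0) (use that in simp)
  have k1: "k s = 1" if "s \<ge> 5/6" for s unfolding k_def by (rule smooth_step_1) (use that in simp)
  have k01: "0 \<le> k s" "k s \<le> 1" for s unfolding k_def by (rule smooth_step_range)+
  have ks: "smooth_on UNIV (\<lambda>p. k (f p))" if "smooth_on UNIV f" for f :: "'a::euclidean_space \<Rightarrow> real"
    unfolding k_def by (intro smooth_intros that)
  have ek: "k s = 0" if "s \<le> e" for s using k0[of s] that e(4) by simp
  have ek1: "k s = 1" if "s \<ge> 1 - e" for s using k1[of s] that e(4) by simp
  have kk: "k 0 = 0" "k 1 = 1" using k0[of 0] k1[of 1] by simp_all
  let ?M = "\<lambda>t s. ext2 G t (k s)" and ?K = "\<lambda>t s. P t (2 * k s - 1)"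
  \<comment> \<open>Replacing \<open>s\<close> by \<open>k s\<close> keeps both edges fixed. It has
    to precede the next homotopy, which moves the lower edge through heights where \<open>P\<close>
    varies with \<open>u\<close>: independence of \<open>s\<close> near the faces then comes from
    \<open>k\<close>, not from \<open>P\<close>.\<close>
  have 1: "rank2_htpc A G ?M"
  proof (rule rank2_htpcI[where J = "\<lambda>t s q. ext2 G t ((1 - q) * s + q * k s)" and d = e])
    show "hgood (\<lambda>t s r. ext2 G t ((1 - smooth_step r) * s + smooth_step r * k s))"
    proof (rule hgood_s[OF g(3)])
      show "good 1 (unc2 (\<lambda>t r. ext2 G t ((1 - smooth_step r) * 0 + smooth_step r * k 0))) p" for p
        using good_edge[OF g(3), of fst 0 p] by (simp add: kk smooth_intros)
      show "good 1 (unc2 (\<lambda>t r. ext2 G t ((1 - smooth_step r) * 1 + smooth_step r * k 1))) p" for p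
        using good_edge[OF g(3), of fst 1 p] by (simp add: kk smooth_intros)
    qed (intro smooth_intros ks)
    show "ext2 G t ((1 - q) * s + q * k s) = ext2 G t ((1 - q) * 0 + q * k 0)"
      if "s \<in> {0..1}" "q \<in> {0..1}" "s \<le> e" for t s q
    proof -
      have "(1 - q) * s \<le> 1 * s" using that by (intro mult_right_mono) auto
      then show ?thesis using g(6)[of "(1 - q) * s" t] that by (simp add: ek kk)
    qed
    show "ext2 G t ((1 - q) * s + q * k s) = ext2 G t ((1 - q) * 1 + q * k 1)"
      if "s \<in> {0..1}" "q \<in> {0..1}" "s \<ge> 1 - e" for t s q
    proof -
      have "0 \<le> q * (1 - s)" using that by simp
      then have "(1 - q) * s + q \<ge> s" by (simp add: algebra_simps)
      then show ?thesis using g(7)[of "(1 - q) * s + q" t] that by (simp add: ek1 kk)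
    qed
    show "ext2 G t u = x" if "t \<le> e" for t u by (rule g(4)[OF that])
    show "ext2 G t u = x" if "t \<ge> 1 - e" for t u by (rule g(5)[OF that])
  qed (simp_all add: e(1) ext2_unit)
  \<comment> \<open>The height slides from \<open>k s\<close> down to \<open>2 * k s - 1\<close>.
    The upper edge stays at height 1, and the lower edge descends to height \<open>- q\<close>, that
    is, it runs backwards along the rank-1 homotopy.\<close>
  have 2: "rank2_htpc A ?M ?K"
  proof (rule rank2_htpcI[where J = "\<lambda>t s q. P t (k s - q * (1 - k s))" and d = e])
    show "hgood (\<lambda>t s r. P t (k s - smooth_step r * (1 - k s)))"
    proof (rule hgood_s[OF P])
      have "good 1 (\<lambda>p. unc2 ?H (fst p, 1 - smooth_step (snd p))) p" for p :: "real \<times> real"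
        by (rule good_compose[OF H]) (intro smooth_intros)
      then show "good 1 (unc2 (\<lambda>t r. P t (k 0 - smooth_step r * (1 - k 0)))) p" for p
        using smooth_step_range(1) by (simp add: kk P_def)
      show "good 1 (unc2 (\<lambda>t r. P t (k 1 - smooth_step r * (1 - k 1)))) p" for p
        using good_edge[OF P, of fst 1 p] by (simp add: kk smooth_intros)
    qed (intro smooth_intros ks)
    show "?M t s = P t (k s - 0 * (1 - k s))" for t s
      using PG[of "k s" t] k01(1)[of s] e(1) by simp
    show "P t u = x" if "t \<le> e" for t u using Px that by blast
    show "P t u = x" if "t \<ge> 1 - e" for t u using Px that by blast
  qed (simp_all add: e(1) ek ek1 kk)
  have "gpath2 e x x ?K"
  proof (rule gpath2I)
    have "good 2 (\<lambda>p. unc2 P (fst p, 2 * k (snd p) - 1)) p" for p :: "real \<times> real"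
      by (rule good_compose[OF P]) (intro smooth_intros ks)
    then show "good 2 (unc2 ?K) p" for p by simp
    show "P t u = x" if "t \<le> e" for t u using Px that by blast
    show "P t u = x" if "t \<ge> 1 - e" for t u using Px that by blast
  qed (use e in \<open>simp_all add: ek ek1 kk\<close>)
  moreover have "?K t s = x" if "s \<le> 2/3" for t s using k0[OF that] H0 by (simp add: P_def)
  ultimately show ?thesis using rank2_htpc_trans[OF 1 2] that by blast
qed

text \<open>\<open>flip2\<close> exchanges the two edges, is an involution and respects rank-2
  homotopy, so the case of the lower edge can be reflected.\<close>

lemma upper_edge_const_representative:
  assumes "loop2 x G" "rank1_htpc A (\<lambda>_. x) (\<lambda>t. G t 1)"
  obtains e K where "rank2_htpc A G K" "gpath2 e x x K" "\<And>t s. s \<ge> 1/3 \<Longrightarrow> K t s = x"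
proof -
  obtain e K where K: "rank2_htpc A (flip2 G) K" "gpath2 e x x K" "\<And>t s. s \<le> 2/3 \<Longrightarrow> K t s = x"
    by (rule lower_edge_const_representative[OF loop2_flip2[OF assms(1)]])
      (use assms(2) in \<open>auto simp: flip2_def\<close>)
  note k = gpath2D[OF K(2)]
  have "flip2 (flip2 G) = G" by (simp add: flip2_def fun_eq_iff)
  then have "rank2_htpc A G (flip2 K)" using flip2_cong[OF K(1)] by simp
  moreover have "gpath2 e x x (flip2 K)"
  proof (rule gpath2I[OF k(1,2)])
    have "good 2 (\<lambda>p. unc2 K (fst p, 1 - snd p)) p" for p :: "real \<times> real"
      by (rule good_compose[OF k(3)]) (intro smooth_intros)
    then show "good 2 (unc2 (flip2 K)) p" for p by (simp add: flip2_def)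
    show "flip2 K t s = x" if "t \<le> e" for t s unfolding flip2_def by (rule k(4)[OF that])
    show "flip2 K t s = x" if "t \<ge> 1 - e" for t s unfolding flip2_def by (rule k(5)[OF that])
    show "flip2 K t s = flip2 K t 0" if "s \<le> e" for t s
      using k(7)[of "1 - s" t] that by (simp add: flip2_def)
    show "flip2 K t s = flip2 K t 1" if "s \<ge> 1 - e" for t s
      using k(6)[of "1 - s" t] that by (simp add: flip2_def)
  qed
  moreover have "flip2 K t s = x" if "s \<ge> 1/3" for t s
    using K(3)[of "1 - s" t] that by (simp add: flip2_def)
  ultimately show ?thesis using that by blast
qed

text \<open>An Eckmann--Hilton argument: when one factor is concentrated in the lower and the other one in
  the upper part of the square, they can be moved past each other horizontally.\<close>

lemma hcomp_commute:
  assumes T: "loop2 x T" "rank1_htpc A (\<lambda>_. x) (\<lambda>t. T t 1)"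
    and G: "loop2 x G" "rank1_htpc A (\<lambda>_. x) (\<lambda>t. G t 0)"
  shows "rank2_htpc A (hcomp T G) (hcomp G T)"
proof -
  from T obtain e1 L where L: "rank2_htpc A T L" "gpath2 e1 x x L" "\<And>t s. s \<ge> 1/3 \<Longrightarrow> L t s = x"
    by (rule upper_edge_const_representative) (rule that)
  from G obtain e2 K where K: "rank2_htpc A G K" "gpath2 e2 x x K" "\<And>t s. s \<le> 2/3 \<Longrightarrow> K t s = x"
    by (rule lower_edge_const_representative) (rule that)
  define e where "e = min e1 e2"
  have e: "0 < e" "e \<le> e1" "e \<le> e2" using gpath2D(1)[OF L(2)] gpath2D(1)[OF K(2)] by (auto simp: e_def)
  note l = gpath2D[OF gpath2_mono[OF L(2) e(1,2)]] and k = gpath2D[OF gpath2_mono[OF K(2) e(1,3)]]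
  have "rank2_htpc A (hcomp L K) (hcomp K L)"
  \<comment> \<open>\<open>L\<close> slides to the right and \<open>K\<close> to the left. At
    \<open>q = 1/2\<close> they occupy the same range of \<open>t\<close> at different heights, so
    at every time one of them is locally constant.\<close>
  proof (rule rank2_htpcI[where J = "\<lambda>t s q. join_at x (L (2 * t - q) s) (K (2 * t - 1 + q) s)" and d = "e / 2"])
    show "hgood (\<lambda>t s r. join_at x (L (2 * t - smooth_step r) s) (K (2 * t - 1 + smooth_step r) s))"
    proof (rule hgood_join)
      show "hgood (\<lambda>t s r. L (2 * t - smooth_step r) s)" "hgood (\<lambda>t s r. K (2 * t - 1 + smooth_step r) s)"
        by (rule hgood_path_tr[OF l(3)] hgood_path_tr[OF k(3)], intro smooth_intros)+
      fix p :: "real \<times> real \<times> real"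
      have "open {p :: real \<times> real \<times> real. 1/3 < fst (snd p)}" "open {p :: real \<times> real \<times> real. fst (snd p) < 2/3}"
        by (intro open_Collect_less continuous_intros)+
      then have "(\<forall>\<^sub>F p in nhds p. 1/3 < fst (snd p)) \<or> (\<forall>\<^sub>F p in nhds p. fst (snd p) < 2/3)"
        by (cases "1/3 < fst (snd p)") (auto simp: eventually_nhds)
      then show "(\<forall>\<^sub>F p in nhds p. unc3 (\<lambda>t s r. L (2 * t - smooth_step r) s) p = x) \<or>
          (\<forall>\<^sub>F p in nhds p. unc3 (\<lambda>t s r. K (2 * t - 1 + smooth_step r) s) p = x)"
      proof
        assume "\<forall>\<^sub>F p in nhds p. 1/3 < fst (snd p)"
        then have "\<forall>\<^sub>F p in nhds p. unc3 (\<lambda>t s r. L (2 * t - smooth_step r) s) p = x"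
          by (rule eventually_mono) (simp add: L(3))
        then show ?thesis ..
      next
        assume "\<forall>\<^sub>F p in nhds p. fst (snd p) < 2/3"
        then have "\<forall>\<^sub>F p in nhds p. unc3 (\<lambda>t s r. K (2 * t - 1 + smooth_step r) s) p = x"
          by (rule eventually_mono) (simp add: K(3))
        then show ?thesis ..
      qed
    qed
    have l1: "L t s = x" and k1: "K t s = x" if "t \<ge> 1" for t s
      using l(5)[of t s] k(5)[of t s] that e(1) by simp_all
    have l0: "L t s = x" and k0: "K t s = x" if "t \<le> 0" for t s
      using l(4)[of t s] k(4)[of t s] that e(1) by simp_all
    show "hcomp L K t s = join_at x (L (2 * t - 0) s) (K (2 * t - 1 + 0) s)"
      if "t \<in> {0..1}" "s \<in> {0..1}" for t s
      using hcomp_join[OF l1 k0 refl refl that] by simp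
    show "hcomp K L t s = join_at x (L (2 * t - 1) s) (K (2 * t - 1 + 1) s)"
      if "t \<in> {0..1}" "s \<in> {0..1}" for t s
      using l0[of "2 * t - 1" s] k1[of "2 * t" s] by (cases "t \<le> 1/2") (simp_all add: hcomp_def)
    show "join_at x (L (2 * t - q) s) (K (2 * t - 1 + q) s) = x" if "q \<in> {0..1}" "t \<le> e / 2" for t s q
      using l(4)[of "2 * t - q" s] k(4)[of "2 * t - 1 + q" s] that by simp
    show "join_at x (L (2 * t - q) s) (K (2 * t - 1 + q) s) = x" if "q \<in> {0..1}" "t \<ge> 1 - e / 2" for t s q
      using l(5)[of "2 * t - q" s] k(5)[of "2 * t - 1 + q" s] that by simp
    show "join_at x (L (2 * t - q) s) (K (2 * t - 1 + q) s) = join_at x (L (2 * t - q) 0) (K (2 * t - 1 + q) 0)"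
      if "s \<le> e / 2" for t s q
    proof -
      have "s \<le> e" using that e(1) by linarith
      from l(6)[OF this] k(6)[OF this] show ?thesis by metis
    qed
    show "join_at x (L (2 * t - q) s) (K (2 * t - 1 + q) s) = join_at x (L (2 * t - q) 1) (K (2 * t - 1 + q) 1)"
      if "s \<ge> 1 - e / 2" for t s q
    proof -
      have "s \<ge> 1 - e" using that e(1) by linarith
      from l(7)[OF this] k(7)[OF this] show ?thesis by metis
    qed
  qed (use e in simp)
  then show ?thesis
    using hcomp_cong[OF L(1) T(1) K(1) G(1)] hcomp_cong[OF K(1) G(1) L(1) T(1)]
      rank2_htpc_trans rank2_htpc_sym by meson
qed

end

section \<open>The crossed module\<close>

context charted begin

text \<open>The track of a map that is not a 2-path is empty. Equality of tracks becomes informative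
  through the member \<open>G'\<close> of its own class.\<close>

lemma track2_eq:
  assumes "path2 A G'"
  shows "track2 A G = track2 A G' \<longleftrightarrow> rank2_htpc A G G'"
proof
  assume "track2 A G = track2 A G'"
  moreover have "G' \<in> track2 A G'" using rank2_htpc_refl[OF assms] by (simp add: track2_def)
  ultimately have "G' \<in> track2 A G" by simp
  then show "rank2_htpc A G G'" by (simp add: track2_def)
next
  assume *: "rank2_htpc A G G'"
  have "rank2_htpc A G H \<longleftrightarrow> rank2_htpc A G' H" for H
    using rank2_htpc_trans[OF *] rank2_htpc_trans[OF rank2_htpc_sym[OF *]] by blast
  then show "track2 A G = track2 A G'" by (simp add: track2_def)
qed

lemma track2_eqI: "rank2_htpc A G G' \<Longrightarrow> track2 A G = track2 A G'"
  using track2_eq[OF rank2_htpc_path2(2)] by blast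

lemma some_track2:
  assumes "path2 A G"
  shows "rank2_htpc A G (SOME H. H \<in> track2 A G)"
  using someI[of "\<lambda>H. H \<in> track2 A G" G] rank2_htpc_refl[OF assms] by (simp add: track2_def)

lemma track1_eq:
  assumes "path1 A \<phi>"
  shows "track1 A \<gamma> = track1 A \<phi> \<longleftrightarrow> rank2_htpc A (idpath2 \<gamma>) (idpath2 \<phi>)"
proof
  assume "track1 A \<gamma> = track1 A \<phi>"
  moreover have "\<phi> \<in> track1 A \<phi>"
    using rank2_htpc_refl[OF path2_idpath2[OF assms]] by (simp add: track1_def rank1_htpc_iff)
  ultimately have "\<phi> \<in> track1 A \<gamma>" by simp
  then show "rank2_htpc A (idpath2 \<gamma>) (idpath2 \<phi>)" by (simp add: track1_def rank1_htpc_iff)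
next
  assume *: "rank2_htpc A (idpath2 \<gamma>) (idpath2 \<phi>)"
  have "rank2_htpc A (idpath2 \<gamma>) H \<longleftrightarrow> rank2_htpc A (idpath2 \<phi>) H" for H
    using rank2_htpc_trans[OF *] rank2_htpc_trans[OF rank2_htpc_sym[OF *]] by blast
  then show "track1 A \<gamma> = track1 A \<phi>" by (simp add: track1_def rank1_htpc_iff)
qed

lemma track1_eqI:
  assumes "rank2_htpc A (idpath2 \<gamma>) (idpath2 \<phi>)"
  shows "track1 A \<gamma> = track1 A \<phi>"
proof -
  have "path1 A \<phi>" using assms unfolding rank1_htpc_iff[symmetric] rank1_htpc_def by simp
  then show ?thesis using assms by (simp add: track1_eq)
qed

lemma some_track1:
  assumes "path1 A \<gamma>"
  shows "rank2_htpc A (idpath2 \<gamma>) (idpath2 (SOME \<phi>. \<phi> \<in> track1 A \<gamma>))"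
  using someI[of "\<lambda>\<phi>. \<phi> \<in> track1 A \<gamma>" \<gamma>] rank2_htpc_refl[OF path2_idpath2[OF assms]]
  by (simp add: track1_def rank1_htpc_iff)

definition loop1 :: "'m \<Rightarrow> (real \<Rightarrow> 'm) \<Rightarrow> bool" where
  "loop1 x \<gamma> \<longleftrightarrow> path1 A \<gamma> \<and> \<gamma> 0 = x \<and> \<gamma> 1 = x"

lemma loop1D: "loop1 x \<gamma> \<Longrightarrow> path1 A \<gamma>"
  and loop2D: "loop2 x G \<Longrightarrow> path2 A G"
  by (simp_all add: loop1_def loop2_def)

lemma loop2_idpath2: "loop2 x (idpath2 \<gamma>) \<longleftrightarrow> loop1 x \<gamma>"
proof -
  have "path1 A \<gamma>" if "path2 A (idpath2 \<gamma>)"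
    using path1_edge[OF that, of 0] by (simp add: idpath2_def)
  then show ?thesis using path2_idpath2[of A \<gamma>] by (auto simp: loop2_def loop1_def idpath2_def)
qed

lemma loop1_edge:
  assumes "loop2 x G" "c = 0 \<or> c = 1"
  shows "loop1 x (\<lambda>t. G t c)"
proof -
  from assms(1) obtain e where e: "gpath2 e x x (ext2 G)" by (rule loop2E)
  have c: "c \<in> {0..1}" using assms(2) by auto
  have "G 0 c = x" "G 1 c = x"
    using gpath2D(4)[OF e, of 0 c] gpath2D(5)[OF e, of 1 c] gpath2D(1)[OF e] c by (simp_all add: ext2_unit)
  then show ?thesis using path1_edge[OF loop2D[OF assms(1)] c] by (simp add: loop1_def)
qed

text \<open>These are equalities of functions, not merely homotopies, so statements about 1-paths
  are obtained by rewriting.\<close>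

lemma idpath2_simps:
  "idpath2 (concat1 \<gamma> \<phi>) = hcomp (idpath2 \<gamma>) (idpath2 \<phi>)"
  "idpath2 (rev1 \<gamma>) = rev2 (idpath2 \<gamma>)"
  "idpath2 (\<lambda>_. x) = (\<lambda>_ _. x)"
  by (simp_all add: fun_eq_iff idpath2_def concat1_def hcomp_def rev1_def rev2_def)

lemma loop1_concat1: "loop1 x \<gamma> \<Longrightarrow> loop1 x \<phi> \<Longrightarrow> loop1 x (concat1 \<gamma> \<phi>)"
  and loop1_rev1: "loop1 x \<gamma> \<Longrightarrow> loop1 x (rev1 \<gamma>)"
  and loop1_const: "loop1 x (\<lambda>_. x)"
  using hcomp_loop2 loop2_rev2 loop2_const unfolding loop2_idpath2[symmetric] idpath2_simps by blast+

section \<open>The groups of 2-tracks and of 1-tracks\<close>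

text \<open>The group of all 2-tracks whose corners are the base point; \<open>pi221\<close> is the kernel of its
  lower boundary map.\<close>

definition tracks2 :: "'m \<Rightarrow> (real \<Rightarrow> real \<Rightarrow> 'm) set monoid" where
  "tracks2 x = (pi221 A x) \<lparr>carrier := track2 A ` Collect (loop2 x)\<rparr>"

lemma tracks2_simps:
  "carrier (tracks2 x) = track2 A ` Collect (loop2 x)"
  "mult (tracks2 x) = mult (pi221 A x)"
  "one (tracks2 x) = track2 A (\<lambda>_ _. x)"
  by (simp_all add: tracks2_def pi221_def)

text \<open>The product is defined through chosen representatives; \<open>hcomp_cong\<close> shows
  that the choice does not affect the class.\<close>

lemma mult_track2:
  assumes "loop2 x G" "loop2 x H"
  shows "track2 A G \<otimes>\<^bsub>pi221 A x\<^esub> track2 A H = track2 A (hcomp G H)"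
proof -
  have "rank2_htpc A (hcomp G H) (hcomp (SOME K. K \<in> track2 A G) (SOME K. K \<in> track2 A H))"
    by (rule hcomp_cong[OF some_track2 assms(1) some_track2 assms(2)]) (rule assms[THEN loop2D])+
  from track2_eqI[OF this] show ?thesis by (simp add: pi221_def)
qed

text \<open>\<open>groupI\<close> asks for a left unit and for left inverses, which is why the
  corresponding homotopies are built on that side.\<close>

lemma group_tracks2: "group (tracks2 x)"
proof (rule groupI)
  show "\<one>\<^bsub>tracks2 x\<^esub> \<in> carrier (tracks2 x)" using loop2_const by (simp add: tracks2_simps)
next
  fix X Y assume "X \<in> carrier (tracks2 x)" "Y \<in> carrier (tracks2 x)"
  then show "X \<otimes>\<^bsub>tracks2 x\<^esub> Y \<in> carrier (tracks2 x)"
    by (auto simp: tracks2_simps mult_track2 hcomp_loop2)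
next
  fix X Y Z assume "X \<in> carrier (tracks2 x)" "Y \<in> carrier (tracks2 x)" "Z \<in> carrier (tracks2 x)"
  then show "X \<otimes>\<^bsub>tracks2 x\<^esub> Y \<otimes>\<^bsub>tracks2 x\<^esub> Z = X \<otimes>\<^bsub>tracks2 x\<^esub> (Y \<otimes>\<^bsub>tracks2 x\<^esub> Z)"
    by (auto simp: tracks2_simps mult_track2 hcomp_loop2 track2_eqI[OF hcomp_assoc])
next
  fix X assume "X \<in> carrier (tracks2 x)"
  then obtain G where G: "loop2 x G" "X = track2 A G" by (auto simp: tracks2_simps)
  show "\<one>\<^bsub>tracks2 x\<^esub> \<otimes>\<^bsub>tracks2 x\<^esub> X = X"
    by (simp add: tracks2_simps G mult_track2 loop2_const track2_eqI[OF hcomp_const_left])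
  show "\<exists>Y\<in>carrier (tracks2 x). Y \<otimes>\<^bsub>tracks2 x\<^esub> X = \<one>\<^bsub>tracks2 x\<^esub>"
    by (rule bexI[of _ "track2 A (rev2 G)"])
      (simp_all add: tracks2_simps G mult_track2 loop2_rev2 track2_eqI[OF hcomp_rev2_left])
qed

lemma pi11_simps:
  "carrier (pi11 A x) = track1 A ` Collect (loop1 x)"
  "one (pi11 A x) = track1 A (\<lambda>_. x)"
  by (auto simp: pi11_def loops1_def loop1_def)

lemma mult_track1:
  assumes "loop1 x \<gamma>" "loop1 x \<phi>"
  shows "track1 A \<gamma> \<otimes>\<^bsub>pi11 A x\<^esub> track1 A \<phi> = track1 A (concat1 \<gamma> \<phi>)"
proof -
  let ?g = "SOME g. g \<in> track1 A \<gamma>" and ?f = "SOME f. f \<in> track1 A \<phi>"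
  have "rank2_htpc A (idpath2 (concat1 \<gamma> \<phi>)) (idpath2 (concat1 ?g ?f))"
    unfolding idpath2_simps
    by (rule hcomp_cong[of _ _ x]; (rule some_track1)?; use assms in \<open>simp add: loop2_idpath2 loop1D\<close>)
  from track1_eqI[OF this] show ?thesis by (simp add: pi11_def)
qed

lemma group_pi11: "group (pi11 A x)"
proof (rule groupI)
  show "\<one>\<^bsub>pi11 A x\<^esub> \<in> carrier (pi11 A x)" using loop1_const by (simp add: pi11_simps)
next
  fix P Q assume "P \<in> carrier (pi11 A x)" "Q \<in> carrier (pi11 A x)"
  then show "P \<otimes>\<^bsub>pi11 A x\<^esub> Q \<in> carrier (pi11 A x)"
    by (auto simp: pi11_simps mult_track1 loop1_concat1)
next
  fix P Q R assume "P \<in> carrier (pi11 A x)" "Q \<in> carrier (pi11 A x)" "R \<in> carrier (pi11 A x)"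
  then obtain p q r where *: "loop1 x p" "loop1 x q" "loop1 x r"
    "P = track1 A p" "Q = track1 A q" "R = track1 A r" by (auto simp: pi11_simps)
  then have "track1 A (concat1 (concat1 p q) r) = track1 A (concat1 p (concat1 q r))"
    by (intro track1_eqI) (simp add: idpath2_simps hcomp_assoc[of x] loop2_idpath2)
  then show "P \<otimes>\<^bsub>pi11 A x\<^esub> Q \<otimes>\<^bsub>pi11 A x\<^esub> R = P \<otimes>\<^bsub>pi11 A x\<^esub> (Q \<otimes>\<^bsub>pi11 A x\<^esub> R)"
    by (simp add: * mult_track1 loop1_concat1)
next
  fix P assume "P \<in> carrier (pi11 A x)"
  then obtain p where p: "loop1 x p" "P = track1 A p" by (auto simp: pi11_simps)
  have "track1 A (concat1 (\<lambda>_. x) p) = track1 A p"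
    by (intro track1_eqI) (simp add: idpath2_simps hcomp_const_left loop2_idpath2 p)
  then show "\<one>\<^bsub>pi11 A x\<^esub> \<otimes>\<^bsub>pi11 A x\<^esub> P = P"
    by (simp add: pi11_simps p mult_track1 loop1_const)
  have "track1 A (concat1 (rev1 p) p) = track1 A (\<lambda>_. x)"
    by (intro track1_eqI) (simp add: idpath2_simps hcomp_rev2_left loop2_idpath2 p)
  then show "\<exists>Q\<in>carrier (pi11 A x). Q \<otimes>\<^bsub>pi11 A x\<^esub> P = \<one>\<^bsub>pi11 A x\<^esub>"
    by (intro bexI[of _ "track1 A (rev1 p)"]) (simp_all add: pi11_simps p mult_track1 loop1_rev1)
qed

section \<open>The edge homomorphisms and their common section\<close>

text \<open>The parameter \<open>c\<close> treats both edges at once: \<open>edge_track 1\<close> is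
  \<open>bdry_u\<close>, and the kernel of \<open>edge_track 0\<close> is the carrier of
  \<open>pi221\<close>.\<close>

definition edge_track :: "real \<Rightarrow> (real \<Rightarrow> real \<Rightarrow> 'm) set \<Rightarrow> (real \<Rightarrow> 'm) set" where
  "edge_track c X = track1 A (\<lambda>t. (SOME G. G \<in> X) t c)"

lemma edge_track:
  assumes "path2 A G" "c = 0 \<or> c = 1"
  shows "edge_track c (track2 A G) = track1 A (\<lambda>t. G t c)"
  using track1_eqI[OF rank2_htpc_edge[OF some_track2[OF assms(1)] assms(2), unfolded rank1_htpc_iff]]
  by (simp add: edge_track_def)

lemma edge_track_hom:
  assumes c: "c = 0 \<or> c = 1"
  shows "edge_track c \<in> hom (tracks2 x) (pi11 A x)"
proof (rule homI)
  fix X assume "X \<in> carrier (tracks2 x)"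
  then show "edge_track c X \<in> carrier (pi11 A x)"
    using loop1_edge[OF _ c] by (auto simp: tracks2_simps pi11_simps edge_track[OF loop2D c])
next
  fix X Y assume "X \<in> carrier (tracks2 x)" "Y \<in> carrier (tracks2 x)"
  then obtain G H where *: "loop2 x G" "loop2 x H" "X = track2 A G" "Y = track2 A H"
    by (auto simp: tracks2_simps)
  have "(\<lambda>t. hcomp G H t c) = concat1 (\<lambda>t. G t c) (\<lambda>t. H t c)"
    by (simp add: fun_eq_iff hcomp_def concat1_def)
  then have "edge_track c (track2 A (hcomp G H)) = track1 A (concat1 (\<lambda>t. G t c) (\<lambda>t. H t c))"
    using edge_track[OF loop2D[OF hcomp_loop2[OF *(1,2)]] c] by simp
  also have "\<dots> = edge_track c X \<otimes>\<^bsub>pi11 A x\<^esub> edge_track c Y"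
    using mult_track1[OF loop1_edge[OF *(1) c] loop1_edge[OF *(2) c]]
      edge_track[OF loop2D[OF *(1)] c] edge_track[OF loop2D[OF *(2)] c] *(3,4) by simp
  finally show "edge_track c (X \<otimes>\<^bsub>tracks2 x\<^esub> Y) = edge_track c X \<otimes>\<^bsub>pi11 A x\<^esub> edge_track c Y"
    using *(1,2) by (simp add: *(3,4) tracks2_simps mult_track2)
qed

definition id_track :: "(real \<Rightarrow> 'm) set \<Rightarrow> (real \<Rightarrow> real \<Rightarrow> 'm) set" where
  "id_track P = track2 A (idpath2 (SOME \<gamma>. \<gamma> \<in> P))"

lemma id_track: "path1 A \<gamma> \<Longrightarrow> id_track (track1 A \<gamma>) = track2 A (idpath2 \<gamma>)"
  using track2_eqI[OF some_track1] by (simp add: id_track_def)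

lemma id_track_hom: "id_track \<in> hom (pi11 A x) (tracks2 x)"
proof (rule homI)
  fix P assume "P \<in> carrier (pi11 A x)"
  then show "id_track P \<in> carrier (tracks2 x)"
    by (auto simp: tracks2_simps pi11_simps id_track[OF loop1D] loop2_idpath2)
next
  fix P Q assume "P \<in> carrier (pi11 A x)" "Q \<in> carrier (pi11 A x)"
  then show "id_track (P \<otimes>\<^bsub>pi11 A x\<^esub> Q) = id_track P \<otimes>\<^bsub>tracks2 x\<^esub> id_track Q"
    by (auto simp: tracks2_simps pi11_simps id_track[OF loop1D] id_track[OF loop1D[OF loop1_concat1]]
        mult_track1 mult_track2 loop2_idpath2 idpath2_simps)
qed

lemma edge_id_track:
  assumes "P \<in> carrier (pi11 A x)" "c = 0 \<or> c = 1"
  shows "edge_track c (id_track P) = P"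
proof -
  from assms(1) obtain p where p: "loop1 x p" "P = track1 A p" by (auto simp: pi11_simps)
  then show ?thesis using edge_track[OF loop2D assms(2), of x "idpath2 p"] id_track[OF loop1D[OF p(1)]]
    by (simp add: loop2_idpath2) (simp add: idpath2_def)
qed

lemma inv_track2:
  assumes "loop2 x G"
  shows "inv\<^bsub>tracks2 x\<^esub> (track2 A G) = track2 A (rev2 G)"
  by (rule group.inv_equality[OF group_tracks2])
    (simp_all add: assms tracks2_simps mult_track2 loop2_rev2 track2_eqI[OF hcomp_rev2_left])

text \<open>The last factor \<open>idpath2 (rev1 \<gamma>)\<close> equals
  \<open>rev2 (idpath2 \<gamma>)\<close>, which represents the inverse of \<open>id_track P\<close>;
  congruence of composition and reversal absorbs the choice of representatives.\<close>

lemma act21_conjugation: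
  assumes "P \<in> carrier (pi11 A x)" "X \<in> carrier (tracks2 x)"
  shows "act21 A P X = id_track P \<otimes>\<^bsub>tracks2 x\<^esub> X \<otimes>\<^bsub>tracks2 x\<^esub> inv\<^bsub>tracks2 x\<^esub> (id_track P)"
proof -
  from assms obtain p G where *: "loop1 x p" "P = track1 A p" "loop2 x G" "X = track2 A G"
    by (auto simp: pi11_simps tracks2_simps)
  let ?p = "SOME \<gamma>. \<gamma> \<in> P" and ?G = "SOME G. G \<in> X"
  have p: "rank2_htpc A (idpath2 p) (idpath2 ?p)" and G: "rank2_htpc A G ?G"
    using some_track1[OF loop1D[OF *(1)]] some_track2[OF loop2D[OF *(3)]] * by simp_all
  have l: "loop2 x (idpath2 p)" using * by (simp add: loop2_idpath2)
  have "rank2_htpc A (hcomp (hcomp (idpath2 p) G) (rev2 (idpath2 p)))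
      (hcomp (hcomp (idpath2 ?p) ?G) (rev2 (idpath2 ?p)))"
    by (intro hcomp_cong[of _ _ x] rev2_cong p G l *(3) loop2_rev2 hcomp_loop2)
  from track2_eqI[OF this]
  have "act21 A P X = track2 A (hcomp (hcomp (idpath2 p) G) (rev2 (idpath2 p)))"
    by (simp add: act21_def Let_def idpath2_simps)
  then show ?thesis
    by (simp add: * id_track[OF loop1D[OF *(1)]] inv_track2 l tracks2_simps mult_track2 hcomp_loop2 loop2_rev2)
qed

lemma loops21_kernel: "loops21 A x = {X \<in> carrier (tracks2 x). edge_track 0 X = \<one>\<^bsub>pi11 A x\<^esub>}"
proof -
  have "X \<in> loops21 A x \<longleftrightarrow> (\<exists>G. loop2 x G \<and> X = track2 A G \<and> edge_track 0 (track2 A G) = \<one>\<^bsub>pi11 A x\<^esub>)" for X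
  proof -
    have "X \<in> loops21 A x \<longleftrightarrow>
        (\<exists>G. loop2 x G \<and> X = track2 A G \<and> track1 A (\<lambda>t. G t 0) = track1 A (\<lambda>_. x))"
      unfolding loops21_def loop2_def by blast
    then show ?thesis using edge_track[OF loop2D, of x _ 0] by (simp add: pi11_simps cong: conj_cong)
  qed
  then show ?thesis by (auto simp: tracks2_simps)
qed

lemma pi221_eq: "pi221 A x = (tracks2 x)\<lparr>carrier := {X \<in> carrier (tracks2 x). edge_track 0 X = \<one>\<^bsub>pi11 A x\<^esub>}\<rparr>"
  unfolding loops21_kernel[symmetric] by (simp add: tracks2_def pi221_def)

lemma tracks2_commute:
  assumes "X \<in> carrier (tracks2 x)" "edge_track 1 X = \<one>\<^bsub>pi11 A x\<^esub>"
    and "Y \<in> carrier (tracks2 x)" "edge_track 0 Y = \<one>\<^bsub>pi11 A x\<^esub>"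
  shows "X \<otimes>\<^bsub>tracks2 x\<^esub> Y = Y \<otimes>\<^bsub>tracks2 x\<^esub> X"
proof -
  from assms(1,3) obtain G H where *: "loop2 x G" "loop2 x H" "X = track2 A G" "Y = track2 A H"
    by (auto simp: tracks2_simps)
  \<comment> \<open>The kernel conditions are equalities of 1-tracks; here they become rank-1
    homotopies starting at the constant path, as \<open>hcomp_commute\<close> expects.\<close>
  have "rank1_htpc A (\<lambda>_. x) (\<lambda>t. K t c)" if "loop2 x K" "edge_track c (track2 A K) = \<one>\<^bsub>pi11 A x\<^esub>" "c = 0 \<or> c = 1" for K c
  proof -
    have "track1 A (\<lambda>_. x) = track1 A (\<lambda>t. K t c)"
      using that edge_track[OF loop2D that(3)] by (simp add: pi11_simps)
    then show ?thesis
      unfolding rank1_htpc_iff using track1_eq[OF loop1D[OF loop1_edge[OF that(1,3)]]] by simp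
  qed
  then have "rank2_htpc A (hcomp G H) (hcomp H G)"
    using hcomp_commute[of x G H] assms * by blast
  from track2_eqI[OF this] show ?thesis by (simp add: * tracks2_simps mult_track2)
qed

end

section \<open>From cat^1-groups to crossed modules\<close>

text \<open>The hypotheses describe a cat\<open>\<^sup>1\<close>-group in the sense of Loday. The Peiffer identity holds
  because \<open>i (u g)\<^sup>-\<^sup>1 g\<close> lies in the kernel of \<open>u\<close>.\<close>

lemma crossed_module_cat1_group:
  fixes G :: "('a, 'c) monoid_scheme" and H :: "('b, 'd) monoid_scheme"
  assumes "group G" "group H" and d: "d \<in> hom G H" and u: "u \<in> hom G H" and i: "i \<in> hom H G"
    and di: "\<And>h. h \<in> carrier H \<Longrightarrow> d (i h) = h" and ui: "\<And>h. h \<in> carrier H \<Longrightarrow> u (i h) = h"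
    and comm: "\<And>a b. a \<in> carrier G \<Longrightarrow> u a = \<one>\<^bsub>H\<^esub> \<Longrightarrow> b \<in> carrier G \<Longrightarrow> d b = \<one>\<^bsub>H\<^esub> \<Longrightarrow> a \<otimes>\<^bsub>G\<^esub> b = b \<otimes>\<^bsub>G\<^esub> a"
    and act: "\<And>h g. h \<in> carrier H \<Longrightarrow> g \<in> carrier G \<Longrightarrow> act h g = i h \<otimes>\<^bsub>G\<^esub> g \<otimes>\<^bsub>G\<^esub> inv\<^bsub>G\<^esub> (i h)"
  shows "crossed_module (G\<lparr>carrier := {g \<in> carrier G. d g = \<one>\<^bsub>H\<^esub>}\<rparr>) H u act"
proof -
  interpret G: group G by fact
  interpret H: group H by fact
  interpret d: group_hom G H d using d by unfold_locales
  interpret u: group_hom G H u using u by unfold_locales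
  interpret i: group_hom H G i using i by unfold_locales
  let ?K = "{g \<in> carrier G. d g = \<one>\<^bsub>H\<^esub>}"
  let ?N = "G\<lparr>carrier := ?K\<rparr>"
  have sub: "subgroup ?K G" by (rule G.subgroupI) auto
  have cancel: "inv\<^bsub>G\<^esub> y \<otimes>\<^bsub>G\<^esub> (y \<otimes>\<^bsub>G\<^esub> z) = z" if "y \<in> carrier G" "z \<in> carrier G" for y z
    using that by (simp add: G.m_assoc[symmetric])
  have gN: "group ?N" by (rule G.subgroup_imp_group[OF sub])
  have invN: "inv\<^bsub>?N\<^esub> g = inv\<^bsub>G\<^esub> g" if "g \<in> ?K" for g
    using G.m_inv_consistent[OF sub that] .
  have actK: "act h g \<in> ?K" if "h \<in> carrier H" "g \<in> ?K" for h g
    using that by (simp add: act di H.m_assoc)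
  have act_mult: "act (h \<otimes>\<^bsub>H\<^esub> k) g = act h (act k g)"
    if "h \<in> carrier H" "k \<in> carrier H" "g \<in> ?K" for h k g
    using that by (simp add: act G.inv_mult_group G.m_assoc)
  have act_one: "act \<one>\<^bsub>H\<^esub> g = g" if "g \<in> ?K" for g using that by (simp add: act)
  have act_hom: "act h \<in> hom ?N ?N" if h: "h \<in> carrier H" for h
  proof (rule homI)
    show "act h g \<in> carrier ?N" if "g \<in> carrier ?N" for g using actK[OF h] that by simp
    fix a b assume "a \<in> carrier ?N" "b \<in> carrier ?N"
    then show "act h (a \<otimes>\<^bsub>?N\<^esub> b) = act h a \<otimes>\<^bsub>?N\<^esub> act h b"
      using h by (simp add: act G.m_assoc cancel)
  qed
  have act_bij: "bij_betw (act h) (carrier ?N) (carrier ?N)" if h: "h \<in> carrier H" for h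
  proof (rule bij_betw_byWitness[where f' = "act (inv\<^bsub>H\<^esub> h)"])
    show "\<forall>g\<in>carrier ?N. act (inv\<^bsub>H\<^esub> h) (act h g) = g"
      using act_mult[of "inv\<^bsub>H\<^esub> h" h] act_one h by simp
    show "\<forall>g\<in>carrier ?N. act h (act (inv\<^bsub>H\<^esub> h) g) = g"
      using act_mult[of h "inv\<^bsub>H\<^esub> h"] act_one h by simp
  qed (use actK h in auto)
  have peiffer: "act (u g) g' = g \<otimes>\<^bsub>?N\<^esub> g' \<otimes>\<^bsub>?N\<^esub> inv\<^bsub>?N\<^esub> g" if g: "g \<in> ?K" "g' \<in> ?K" for g g'
  proof -
    define k where "k = inv\<^bsub>G\<^esub> (i (u g)) \<otimes>\<^bsub>G\<^esub> g"
    have k: "k \<in> carrier G" "u k = \<one>\<^bsub>H\<^esub>" using g by (simp_all add: k_def ui)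
    have gk: "g = i (u g) \<otimes>\<^bsub>G\<^esub> k" using g by (simp add: k_def G.m_assoc[symmetric])
    \<comment> \<open>\<open>k\<close> is in the kernel of \<open>u\<close> and \<open>g'\<close> in
      that of \<open>d\<close>, so they commute. Conjugation by \<open>k\<close> can thus be
      inserted freely, and it completes \<open>i (u g)\<close> to \<open>g\<close>.\<close>
    have "k \<otimes>\<^bsub>G\<^esub> g' \<otimes>\<^bsub>G\<^esub> inv\<^bsub>G\<^esub> k = g'"
      using comm[OF k, of g'] g k(1) by (simp add: G.m_assoc)
    then have "i (u g) \<otimes>\<^bsub>G\<^esub> g' \<otimes>\<^bsub>G\<^esub> inv\<^bsub>G\<^esub> (i (u g))
        = i (u g) \<otimes>\<^bsub>G\<^esub> (k \<otimes>\<^bsub>G\<^esub> g' \<otimes>\<^bsub>G\<^esub> inv\<^bsub>G\<^esub> k) \<otimes>\<^bsub>G\<^esub> inv\<^bsub>G\<^esub> (i (u g))" by simp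
    also have "\<dots> = (i (u g) \<otimes>\<^bsub>G\<^esub> k) \<otimes>\<^bsub>G\<^esub> g' \<otimes>\<^bsub>G\<^esub> inv\<^bsub>G\<^esub> (i (u g) \<otimes>\<^bsub>G\<^esub> k)"
      using g k(1) by (simp add: G.m_assoc G.inv_mult_group)
    also have "\<dots> = g \<otimes>\<^bsub>G\<^esub> g' \<otimes>\<^bsub>G\<^esub> inv\<^bsub>G\<^esub> g" using gk by simp
    finally show ?thesis using g by (simp add: act invN)
  qed
  have u_hom: "u \<in> hom ?N H" by (rule homI) auto
  have equi: "u (act h g) = h \<otimes>\<^bsub>H\<^esub> u g \<otimes>\<^bsub>H\<^esub> inv\<^bsub>H\<^esub> h" if "h \<in> carrier H" "g \<in> ?K" for h g
    using that by (simp add: act ui)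
  show ?thesis
    unfolding crossed_module_def
    using gN H.group_axioms u_hom act_hom act_bij act_one act_mult equi peiffer by simp
qed

context charted begin

lemma crossed_module_tracks: "crossed_module (pi221 A x) (pi11 A x) (bdry_u A) (act21 A)"
proof -
  have "bdry_u A = edge_track 1" by (simp add: fun_eq_iff bdry_u_def edge_track_def)
  then show ?thesis
    unfolding pi221_eq
    by (simp only:) (rule crossed_module_cat1_group[OF group_tracks2 group_pi11 edge_track_hom edge_track_hom
          id_track_hom edge_id_track edge_id_track tracks2_commute act21_conjugation]; simp)
qed

text \<open>Membership in \<open>loops21\<close> fixes the corners of some representative; a rank-2
  homotopy does not move corners, so \<open>G\<close> has the same ones.\<close>

lemma loop2_loops21:
  assumes "track2 A G \<in> loops21 A x" "path2 A G"
  shows "loop2 x G"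
proof -
  from assms(1) obtain K where "track2 A G = track2 A K" "loop2 x K"
    unfolding loops21_def loop2_def by blast
  then have "rank2_htpc A G K" "loop2 x K" using track2_eq[OF loop2D] by blast+
  then show ?thesis using loop2_htpc by blast
qed

end

theorem mainTheorem2:
  fixes A :: "('m::{t2_space, second_countable_topology}, 'e::euclidean_space) atlas"
    and x :: 'm
  assumes "smooth_manifold A"
  shows "(\<forall>\<Gamma> \<Gamma>'. track2 A \<Gamma> \<in> loops21 A x \<and> track2 A \<Gamma>' \<in> loops21 A x \<and> path2 A \<Gamma> \<and> path2 A \<Gamma>'
              \<longrightarrow> track2 A \<Gamma> \<otimes>\<^bsub>pi221 A x\<^esub> track2 A \<Gamma>' = track2 A (hcomp \<Gamma> \<Gamma>'))
       \<and> group (pi221 A x)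
       \<and> bdry_u A \<in> hom (pi221 A x) (pi11 A x)
       \<and> crossed_module (pi221 A x) (pi11 A x) (bdry_u A) (act21 A)"
proof -
  interpret charted A
    by unfold_locales (use assms in \<open>auto simp: smooth_manifold_def smooth_atlas_def\<close>)
  have "crossed_module (pi221 A x) (pi11 A x) (bdry_u A) (act21 A)" by (rule crossed_module_tracks)
  moreover from this have "group (pi221 A x)" "bdry_u A \<in> hom (pi221 A x) (pi11 A x)"
    by (simp_all add: crossed_module_def)
  ultimately show ?thesis using mult_track2 loop2_loops21 by blast
qed

end
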